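(* There is an algorithm that solves \textsc{Capacitated Vertex Cover} in time $\mathrm{vi}^{\mathcal{O}(\mathrm{vi}^2)} n^{\mathcal{O}(1)}$, where $\mathrm{vi}$ is the vertex integrity of the input graph and $n$ its number of vertices.
   Context: \textsc{Capacitated Vertex Cover}: the input is an undirected loopless graph $G=(V,E)$, a capacity function $c\colon V\to\mathbb{N}$, and an integer $k$; the question is whether there exists $S\subseteq V$ with $|S|\le k$ and an assignment of every edge to one of its endpoints lying in $S$ such that every $v\in S$ is assigned at most $c(v)$ incident edges. The vertex integrity of a graph $G$ is the minimum integer $p$ such that there exists a set $X\subseteq V(G)$ for which every connected component of $G-X$ has at most $p-|X|$ vertices. *)

theory Defs
  imports Main
begin

section \<open>Graphs and vertex integrity\<close>

definition simple_graph :: "'a set \<Rightarrow> 'a set set \<Rightarrow> bool" where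
  "simple_graph V E \<longleftrightarrow> finite V \<and> (\<forall>e\<in>E. e \<subseteq> V \<and> card e = 2)"

text \<open>The vertex sets of the connected components of the subgraph induced by \<open>W\<close>.\<close>

definition components :: "'a set \<Rightarrow> 'a set set \<Rightarrow> 'a set set" where
  "components W E =
     (\<lambda>v. {u. (v, u) \<in> {(x, y). x \<in> W \<and> y \<in> W \<and> {x, y} \<in> E}\<^sup>*}) ` W"

text \<open>
  The conjunct \<open>card X \<le> p\<close> matters only for \<open>X = V\<close>, where there are no components; it says that
  a maximum over no components counts as 0. It also makes the subtraction on \<^typ>\<open>nat\<close> exact.
\<close>

definition vertex_integrity :: "'a set \<Rightarrow> 'a set set \<Rightarrow> nat" where
  "vertex_integrity V E =
     (LEAST p. \<exists>X\<subseteq>V. card X \<le> p \<and> (\<forall>D\<in>components (V - X) E. card D \<le> p - card X))"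


section \<open>Capacitated Vertex Cover\<close>

definition capacitated_vertex_cover ::
    "'a set \<Rightarrow> 'a set set \<Rightarrow> ('a \<Rightarrow> nat) \<Rightarrow> int \<Rightarrow> bool" where
  "capacitated_vertex_cover V E c k \<longleftrightarrow>
     (\<exists>S\<subseteq>V. int (card S) \<le> k \<and>
       (\<exists>f. (\<forall>e\<in>E. f e \<in> e \<inter> S) \<and> (\<forall>v\<in>S. card {e \<in> E. f e = v} \<le> c v)))"


section \<open>Random access machines\<close>

text \<open>
  Algorithms are structured programs for a random access machine with integer cells: registers,
  and a main memory with indirect addressing. Every operator, test and command costs one step.
  Addition and subtraction are the only arithmetic operations, so \<open>t\<close> steps lengthen the binary
  representation of the numbers by \<open>O(t)\<close> bits only, and unit cost is polynomially
  equivalent to logarithmic cost and to Turing machine time.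
\<close>

datatype aexp =
    Lit int
  | Reg nat
  | Mem aexp
  | Add aexp aexp
  | Sub aexp aexp

datatype bexp =
    Less aexp aexp
  | Neg bexp
  | Conj bexp bexp

datatype com =
    Skip
  | Assign nat aexp
  | Store aexp aexp  \<comment> \<open>address, value\<close>
  | Seq com com
  | Cond bexp com com
  | While bexp com

text \<open>A state consists of the contents of the registers and of the main memory.\<close>

type_synonym state = "(nat \<Rightarrow> int) \<times> (int \<Rightarrow> int)"

fun aval :: "aexp \<Rightarrow> state \<Rightarrow> int" where
  "aval (Lit i) s = i"
| "aval (Reg r) s = fst s r"
| "aval (Mem a) s = snd s (aval a s)"
| "aval (Add a b) s = aval a s + aval b s"
| "aval (Sub a b) s = aval a s - aval b s"

fun bval :: "bexp \<Rightarrow> state \<Rightarrow> bool" where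
  "bval (Less a b) s \<longleftrightarrow> aval a s < aval b s"
| "bval (Neg b) s \<longleftrightarrow> \<not> bval b s"
| "bval (Conj b d) s \<longleftrightarrow> bval b s \<and> bval d s"

fun acost :: "aexp \<Rightarrow> nat" where
  "acost (Lit i) = 1"
| "acost (Reg r) = 1"
| "acost (Mem a) = 1 + acost a"
| "acost (Add a b) = 1 + acost a + acost b"
| "acost (Sub a b) = 1 + acost a + acost b"

fun bcost :: "bexp \<Rightarrow> nat" where
  "bcost (Less a b) = 1 + acost a + acost b"
| "bcost (Neg b) = 1 + bcost b"
| "bcost (Conj b d) = 1 + bcost b + bcost d"

text \<open>
  \<open>exec p s t s'\<close>: started in state \<open>s\<close>, program \<open>p\<close> terminates after exactly \<open>t\<close> steps in
  state \<open>s'\<close>.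
\<close>

inductive exec :: "com \<Rightarrow> state \<Rightarrow> nat \<Rightarrow> state \<Rightarrow> bool" where
  Skip: "exec Skip s 1 s"
| Assign: "exec (Assign r a) s (1 + acost a) ((fst s)(r := aval a s), snd s)"
| Store: "exec (Store a b) s (1 + acost a + acost b) (fst s, (snd s)(aval a s := aval b s))"
| Seq: "\<lbrakk>exec p s t s'; exec q s' u s''\<rbrakk> \<Longrightarrow> exec (Seq p q) s (t + u) s''"
| CondTrue: "\<lbrakk>bval b s; exec p s t s'\<rbrakk> \<Longrightarrow> exec (Cond b p q) s (1 + bcost b + t) s'"
| CondFalse: "\<lbrakk>\<not> bval b s; exec q s t s'\<rbrakk> \<Longrightarrow> exec (Cond b p q) s (1 + bcost b + t) s'"
| WhileFalse: "\<not> bval b s \<Longrightarrow> exec (While b p) s (1 + bcost b) s"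
| WhileTrue: "\<lbrakk>bval b s; exec p s t s'; exec (While b p) s' u s''\<rbrakk> \<Longrightarrow>
    exec (While b p) s (1 + bcost b + t + u) s''"

inductive_cases exec_SkipE: "exec Skip s t s'"
inductive_cases exec_AssignE: "exec (Assign r a) s t s'"
inductive_cases exec_StoreE: "exec (Store a b) s t s'"
inductive_cases exec_SeqE: "exec (Seq p q) s t s'"
inductive_cases exec_CondE: "exec (Cond b p q) s t s'"
inductive_cases exec_WhileE: "exec (While b p) s t s'"

lemma exec_deterministic:
  "exec p s t s' \<Longrightarrow> exec p s u s'' \<Longrightarrow> t = u \<and> s' = s''"
proof (induction arbitrary: u s'' rule: exec.induct)
  case (Skip s)
  from Skip.prems show ?case by (rule exec_SkipE) auto
next
  case (Assign r a s)
  from Assign.prems show ?case by (rule exec_AssignE) auto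
next
  case (Store a b s)
  from Store.prems show ?case by (rule exec_StoreE) auto
next
  case (Seq p s t s1 q v s2)
  from Seq.prems obtain t' v' r where "u = t' + v'" "exec p s t' r" "exec q r v' s''"
    by (rule exec_SeqE)
  with Seq.IH show ?case by metis
next
  case (CondTrue b s p t s1 q)
  from CondTrue.prems CondTrue.hyps(1) obtain t' where "u = 1 + bcost b + t'" "exec p s t' s''"
    by (cases rule: exec_CondE) auto
  with CondTrue.IH show ?case by metis
next
  case (CondFalse b s q t s1 p)
  from CondFalse.prems CondFalse.hyps(1) obtain t' where "u = 1 + bcost b + t'" "exec q s t' s''"
    by (cases rule: exec_CondE) auto
  with CondFalse.IH show ?case by metis
next
  case (WhileFalse b s p)
  from WhileFalse.prems WhileFalse.hyps show ?case
    by (cases rule: exec_WhileE) auto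
next
  case (WhileTrue b s p t s1 v s2)
  from WhileTrue.prems WhileTrue.hyps(1) obtain t' v' r where
    "u = 1 + bcost b + t' + v'" "exec p s t' r" "exec (While b p) r v' s''"
    by (cases rule: exec_WhileE) auto
  with WhileTrue.IH show ?case by metis
qed

text \<open>The input is written into the memory cells 0, 1, 2, and so on; everything else is initially 0.\<close>

definition load :: "int list \<Rightarrow> state" where
  "load xs = (\<lambda>r. 0, \<lambda>a. if 0 \<le> a \<and> a < int (length xs) then xs ! nat a else 0)"

text \<open>
  Encoding of an instance with vertex set \<open>{..<n}\<close>: number of vertices, budget, capacities,
  adjacency matrix row by row.
\<close>

definition cvc_input :: "nat \<Rightarrow> nat set set \<Rightarrow> (nat \<Rightarrow> nat) \<Rightarrow> int \<Rightarrow> int list" where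
  "cvc_input n E c k =
     int n # k # map (\<lambda>v. int (c v)) [0..<n] @
     [of_bool ({u, v} \<in> E). u \<leftarrow> [0..<n], v \<leftarrow> [0..<n]]"

text \<open>
  Program \<open>p\<close> decides Capacitated Vertex Cover, answering 1 or 0 in register 0, within
  \<open>T E n\<close> steps on graphs with vertex set \<open>{..<n}\<close> and edge set \<open>E\<close>.
\<close>

definition solves_cvc_in_time :: "com \<Rightarrow> (nat set set \<Rightarrow> nat \<Rightarrow> nat) \<Rightarrow> bool" where
  "solves_cvc_in_time p T \<longleftrightarrow>
     (\<forall>n E c k. simple_graph {..<n} E \<longrightarrow>
       (\<exists>t s. exec p (load (cvc_input n E c k)) t s \<and>
         fst s 0 = of_bool (capacitated_vertex_cover {..<n} E c k) \<and>
         t \<le> T E n))"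

end

theory Submission
  imports Defs Complex_Main "HOL-Library.FuncSet"
begin

text \<open>
  For \<open>p = 1, 2, ...\<close> a set \<open>X\<close> of at most \<open>p\<close> vertices such that all components of \<open>G - X\<close> have at
  most \<open>p\<close> vertices is found by branching: a connected set with more than \<open>p\<close> vertices must be
  hit. The branching decisions, together with the guess which vertices of \<open>X\<close> belong to the cover,
  are enumerated as the base \<open>4p\<close> digits of one number.

  Given \<open>X\<close> and the guess, the edges split into items, one for each component and one for the edges
  inside \<open>X\<close>. An item has \<open>O(p\<^sup>2)\<close> edges, hence \<open>3 ^ O(p\<^sup>2)\<close> options of assigning each of them to one
  of its endpoints or leaving it unassigned at a high cost, and items interact only through
  the load they put on \<open>X\<close>, a vector with entries at most \<open>p\<close>. A choice of options that is not
  optimal can be improved by changing few items: by the Steinitz lemma the changes towards an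
  optimal choice can be ordered such that their partial sums stay close to a segment, so that among
  more than \<open>(4p\<^sup>2 + 1) ^ p\<close> changes two partial sums have the same offset from it, and the changes
  between them or the remaining ones already are an improvement. Improvements that change so
  few items are found by dynamic programming over the items, with a table indexed by the load
  change; encoding load vectors as numbers in a sufficiently large base turns it into a knapsack
  table of size \<open>p ^ O(p\<^sup>2)\<close>. The cost is polynomial, so polynomially many improvements suffice.
\<close>

section \<open>The Steinitz lemma\<close>

text \<open>The index of a change in the table is the sum of \<open>Q\<close> per changed item and a
  code of the load change. Two difficulties shape the constants. Partial indices have to stay inside
  the table: \<open>Q\<close> exceeds every code that occurs, so starting at \<open>Q\<close> keeps
  them nonnegative, and \<open>L + 2\<close> multiples of \<open>Q\<close> suffice. Moreover, the
  entry at the index of the wanted change may be attained by another change. That one may alter more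
  items, but each of its steps shifts the index by more than \<open>Q / 2\<close>, so there are at
  most \<open>2 * (L + 2)\<close> steps, and \<open>B\<close> is so large that even then equal
  indices mean equal load changes. Both \<open>L\<close> and \<open>B\<close> are of the form
  \<open>p ^ O(p)\<close>; the power \<open>B ^ p\<close> brings the square into the exponent.

  Unassigned edges and overloads outside \<open>X\<close> cost \<open>n + 1\<close> each, more than
  any cover. This makes the empty assignment a feasible start and turns a decision problem into an
  optimisation. The loop over \<open>p\<close> stops at the first \<open>p\<close> for which a guess
  yields a separator, possibly below the vertex integrity; everything after that needs only such a
  separator.\<close>

lemma homogeneous_system_nontrivial:
  fixes a :: "'c \<Rightarrow> 'i \<Rightarrow> real"
  assumes "finite C" "finite S" "card C < card S"
  shows "\<exists>h. (\<exists>i\<in>S. h i \<noteq> 0) \<and> (\<forall>c\<in>C. (\<Sum>i\<in>S. a c i * h i) = 0)"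
  using assms
proof (induction C arbitrary: S a rule: finite_induct)
  case empty
  then obtain i where "i \<in> S" by (metis all_not_in_conv card.empty not_less0)
  then show ?case by (intro exI[of _ "\<lambda>_. 1"]) auto
next
  case (insert c C)
  show ?case
  proof (cases "\<forall>i\<in>S. a c i = 0")
    case True
    from insert.IH[of S a] insert.prems insert.hyps
    obtain h where "\<exists>i\<in>S. h i \<noteq> 0" "\<forall>d\<in>C. (\<Sum>i\<in>S. a d i * h i) = 0" by auto
    with True show ?thesis by (intro exI[of _ h]) auto
  next
    case False
    then obtain j where j: "j \<in> S" "a c j \<noteq> 0" by auto
    \<comment> \<open>Gaussian elimination with pivot \<open>j\<close>: equation \<open>c\<close> is
      used to remove the unknown \<open>h j\<close> from the other equations.\<close>
    define a' where "a' d i = a d i - a d j * a c i / a c j" for d i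
    have "card C < card (S - {j})" using insert j by simp
    with insert.IH[of "S - {j}" a'] insert.prems
    obtain h where h: "\<exists>i\<in>S - {j}. h i \<noteq> 0" "\<forall>d\<in>C. (\<Sum>i\<in>S - {j}. a' d i * h i) = 0"
      by auto
    define hj where "hj = - (\<Sum>i\<in>S - {j}. a c i * h i) / a c j"
    define h' where "h' = h(j := hj)"
    have split: "(\<Sum>i\<in>S. a d i * h' i) = a d j * hj + (\<Sum>i\<in>S - {j}. a d i * h i)" for d
      using j insert.prems by (subst sum.remove[of S j]) (auto simp: h'_def intro!: sum.cong)
    have "(\<Sum>i\<in>S. a c i * h' i) = 0" using j by (simp add: split hj_def)
    moreover have "(\<Sum>i\<in>S. a d i * h' i) = 0" if "d \<in> C" for d
    proof -
      have "0 = (\<Sum>i\<in>S - {j}. a' d i * h i)" using h that by simp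
      also have "\<dots> = (\<Sum>i\<in>S - {j}. a d i * h i - a d j / a c j * (a c i * h i))"
        by (intro sum.cong) (auto simp: a'_def algebra_simps)
      also have "\<dots> = (\<Sum>i\<in>S - {j}. a d i * h i) - a d j / a c j * (\<Sum>i\<in>S - {j}. a c i * h i)"
        by (simp add: sum_subtractf sum_distrib_left)
      finally show ?thesis by (simp add: split hj_def)
    qed
    moreover have "\<exists>i\<in>S. h' i \<noteq> 0" using h(1) by (auto simp: h'_def)
    ultimately show ?thesis by (intro exI[of _ h']) auto
  qed
qed

text \<open>A vertex of the polytope of admissible weights has this property. Instead of vertices,
  weights with the fewest fractional entries are taken: if more than \<open>card X + 1\<close>
  entries are fractional, some direction supported on them preserves all \<open>card X + 1\<close>
  equations, and following it until an entry reaches 0 or 1 gives fewer.\<close>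

lemma few_fractional_weights:
  fixes v :: "'i \<Rightarrow> 'x \<Rightarrow> real"
  assumes fin: "finite S" "finite X"
    and ex: "\<forall>i\<in>S. 0 \<le> m i \<and> m i \<le> 1" "(\<Sum>i\<in>S. m i) = K" "\<forall>x\<in>X. (\<Sum>i\<in>S. m i * v i x) = 0"
  obtains m' where "\<forall>i\<in>S. 0 \<le> m' i \<and> m' i \<le> 1" "(\<Sum>i\<in>S. m' i) = K"
    "\<forall>x\<in>X. (\<Sum>i\<in>S. m' i * v i x) = 0" "card {i\<in>S. 0 < m' i \<and> m' i < 1} \<le> card X + 1"
proof -
  define ok where "ok m \<longleftrightarrow> (\<forall>i\<in>S. 0 \<le> m i \<and> m i \<le> 1) \<and> (\<Sum>i\<in>S. m i) = K
     \<and> (\<forall>x\<in>X. (\<Sum>i\<in>S. m i * v i x) = 0)" for m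
  define fr where "fr m = {i\<in>S. 0 < m i \<and> m i < 1}" for m :: "'i \<Rightarrow> real"
  have "ok m" using ex by (simp add: ok_def)
  from ex_has_least_nat[of ok m "\<lambda>m. card (fr m)", OF this]
  obtain \<mu> where mu: "ok \<mu>" "\<And>m. ok m \<Longrightarrow> card (fr \<mu>) \<le> card (fr m)" by blast
  have "card (fr \<mu>) \<le> card X + 1"
  proof (rule ccontr)
    assume less: "\<not> card (fr \<mu>) \<le> card X + 1"
    define F where "F = fr \<mu>"
    have F: "finite F" "F \<subseteq> S" using fin by (auto simp: F_def fr_def)
    have C: "card (insert None (Some ` X)) = card X + 1"
      using fin by (simp add: card_insert_if card_image)
    \<comment> \<open>\<open>None\<close> stands for the equation that fixes the total weight,
      \<open>Some x\<close> for the coordinate \<open>x\<close>.\<close>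
    obtain h where h: "\<exists>i\<in>F. h i \<noteq> 0"
      "\<forall>c\<in>insert None (Some ` X). (\<Sum>i\<in>F. (case c of None \<Rightarrow> 1 | Some x \<Rightarrow> v i x) * h i) = 0"
      using homogeneous_system_nontrivial[of "insert None (Some ` X)" F
          "\<lambda>c i. case c of None \<Rightarrow> 1 | Some x \<Rightarrow> v i x"] F less C fin by (auto simp: F_def)
    define Nz where "Nz = {i\<in>F. h i \<noteq> 0}"
    \<comment> \<open>\<open>r i\<close> is the step length along \<open>h\<close> at which entry
      \<open>i\<close> reaches 0 or 1, and \<tau> is the first such length.\<close>
    define r where "r i = (if h i > 0 then (1 - \<mu> i) / h i else \<mu> i / (- h i))" for i
    define \<tau> where "\<tau> = Min (r ` Nz)"
    have Nz: "finite Nz" "Nz \<noteq> {}" "Nz \<subseteq> F" using h F by (auto simp: Nz_def)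
    have tau_le: "\<tau> \<le> r i" if "i \<in> Nz" for i using Nz that by (simp add: \<tau>_def)
    obtain i0 where i0: "i0 \<in> Nz" "\<tau> = r i0"
      using Min_in[of "r ` Nz"] Nz by (metis \<tau>_def empty_is_image finite_imageI image_iff)
    have rpos: "0 < r i" if "i \<in> Nz" for i
      using that by (auto simp: Nz_def F_def fr_def r_def divide_simps)
    have taup: "0 < \<tau>" using i0 rpos by simp
    define m' where "m' i = (if i \<in> F then \<mu> i + \<tau> * h i else \<mu> i)" for i
    have in01: "0 \<le> m' i \<and> m' i \<le> 1" if "i \<in> S" for i
    proof (cases "i \<in> Nz")
      case True
      then have i: "i \<in> F" "h i \<noteq> 0" "0 < \<mu> i" "\<mu> i < 1" by (auto simp: Nz_def F_def fr_def)
      show ?thesis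
      proof (cases "h i > 0")
        case hp: True
        with tau_le[OF True] have "\<tau> * h i \<le> 1 - \<mu> i" by (simp add: r_def pos_le_divide_eq)
        moreover have "0 < \<tau> * h i" using hp taup by simp
        ultimately show ?thesis using i(1,3,4) unfolding m'_def by simp
      next
        case hn: False
        with tau_le[OF True] i(2) have "\<tau> * (- h i) \<le> \<mu> i"
          by (simp only: r_def if_False pos_le_divide_eq)
        moreover have "\<tau> * h i < 0" using hn i(2) taup by (simp add: mult_pos_neg)
        ultimately show ?thesis using i(1,3,4) unfolding m'_def by simp
      qed
    next
      case False
      then show ?thesis using that mu(1) by (auto simp: m'_def Nz_def ok_def)
    qed
    have lin: "(\<Sum>i\<in>S. m' i * g i) = (\<Sum>i\<in>S. \<mu> i * g i) + \<tau> * (\<Sum>i\<in>F. g i * h i)" for g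
    proof -
      have "(\<Sum>i\<in>S. m' i * g i) = (\<Sum>i\<in>S. \<mu> i * g i + (if i \<in> F then \<tau> * (g i * h i) else 0))"
        by (intro sum.cong) (auto simp: m'_def algebra_simps)
      also have "\<dots> = (\<Sum>i\<in>S. \<mu> i * g i) + (\<Sum>i\<in>S \<inter> F. \<tau> * (g i * h i))"
        using fin by (simp add: sum.distrib sum.inter_restrict)
      also have "S \<inter> F = F" using F by auto
      finally show ?thesis by (simp add: sum_distrib_left)
    qed
    have "(\<Sum>i\<in>S. m' i) = K"
      using lin[of "\<lambda>_. 1"] h(2) mu(1) by (simp add: ok_def)
    moreover have "\<forall>x\<in>X. (\<Sum>i\<in>S. m' i * v i x) = 0"
    proof
      fix x assume "x \<in> X"
      then show "(\<Sum>i\<in>S. m' i * v i x) = 0"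
        using lin[of "\<lambda>i. v i x"] h(2) mu(1) by (simp add: ok_def)
    qed
    ultimately have okm': "ok m'" using in01 by (simp add: ok_def)
    have "m' i0 = 0 \<or> m' i0 = 1"
    proof -
      have "i0 \<in> F" "h i0 \<noteq> 0" using i0(1) by (auto simp: Nz_def)
      then show ?thesis unfolding m'_def i0(2) r_def by simp
    qed
    moreover have "fr m' \<subseteq> fr \<mu>"
      using F(2) by (auto simp: fr_def m'_def F_def)
    moreover have "i0 \<in> fr \<mu>" using i0(1) Nz(3) F_def by blast
    moreover have "i0 \<notin> fr m'" using calculation(1) by (auto simp: fr_def)
    ultimately have "fr m' \<subset> fr \<mu>" by blast
    then have "card (fr m') < card (fr \<mu>)"
      using F by (simp add: F_def psubset_card_mono)
    with mu(2)[OF okm'] show False by simp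
  qed
  with mu(1) that[of \<mu>] show thesis by (auto simp: ok_def fr_def)
qed

text \<open>
  The Grinberg--Sevastyanov proof of the Steinitz lemma: a set is kept as long as its vectors have
  a vanishing combination with weights in the unit interval that add up to the size of the set
  minus the dimension.
\<close>

lemma steinitz_chain:
  fixes v :: "'i \<Rightarrow> 'x \<Rightarrow> real"
  assumes fin: "finite S" "finite X" and b: "0 \<le> b"
    and small: "\<And>i x. i \<in> S \<Longrightarrow> x \<in> X \<Longrightarrow> \<bar>v i x\<bar> \<le> b"
    and zero: "\<And>x. x \<in> X \<Longrightarrow> (\<Sum>i\<in>S. v i x) = 0"
  obtains F where "F (card S) = S" "\<And>k. k \<le> card S \<Longrightarrow> card (F k) = k"
    "\<And>k l. k \<le> l \<Longrightarrow> l \<le> card S \<Longrightarrow> F k \<subseteq> F l"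
    "\<And>k x. k \<le> card S \<Longrightarrow> x \<in> X \<Longrightarrow> \<bar>\<Sum>i\<in>F k. v i x\<bar> \<le> b * card X"
proof -
  define d where "d = card X"
  \<comment> \<open>Sets of at most \<open>d\<close> vectors are good outright: their sums are
    bounded trivially, and the prescribed total weight \<open>card A - d\<close> would not be
    positive.\<close>
  define good where "good A \<longleftrightarrow> card A \<le> d \<or> (\<exists>m. (\<forall>i\<in>A. 0 \<le> m i \<and> m i \<le> 1)
     \<and> (\<Sum>i\<in>A. m i) = real (card A) - real d \<and> (\<forall>x\<in>X. (\<Sum>i\<in>A. m i * v i x) = 0))" for A
  have bound: "\<bar>\<Sum>i\<in>A. v i x\<bar> \<le> b * d" if A: "A \<subseteq> S" "good A" "x \<in> X" for A x
  proof -
    from A(2) consider "card A \<le> d" | m where "\<forall>i\<in>A. 0 \<le> m i \<and> m i \<le> 1"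
      "(\<Sum>i\<in>A. m i) = real (card A) - real d" "(\<Sum>i\<in>A. m i * v i x) = 0"
      using A(3) unfolding good_def by blast
    then show ?thesis
    proof cases
      case 1
      have "\<bar>\<Sum>i\<in>A. v i x\<bar> \<le> (\<Sum>i\<in>A. \<bar>v i x\<bar>)" by (rule sum_abs)
      also have "\<dots> \<le> (\<Sum>i\<in>A. b)" using A small by (intro sum_mono) auto
      also have "\<dots> = b * card A" by simp
      also have "\<dots> \<le> b * d" using 1 b by (intro mult_left_mono) auto
      finally show ?thesis .
    next
      case (2 m)
      \<comment> \<open>Subtracting the vanishing combination leaves coefficients
        \<open>1 - m i\<close> in the unit interval whose total is only \<open>d\<close>, whatever
        the size of \<open>A\<close>.\<close>
      have "(\<Sum>i\<in>A. v i x) = (\<Sum>i\<in>A. (1 - m i) * v i x)"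
        using 2(3) by (simp add: left_diff_distrib sum_subtractf)
      also have "\<bar>\<dots>\<bar> \<le> (\<Sum>i\<in>A. \<bar>(1 - m i) * v i x\<bar>)" by (rule sum_abs)
      also have "\<dots> \<le> (\<Sum>i\<in>A. (1 - m i) * b)"
        using 2(1) A small by (intro sum_mono) (auto simp: abs_mult intro!: mult_left_mono)
      also have "\<dots> = b * d" using 2(2)
        by (simp add: sum_distrib_right[symmetric] sum_subtractf)
      finally show ?thesis .
    qed
  qed
  have step: "\<exists>i\<in>A. good (A - {i})" if A: "A \<subseteq> S" "good A" "A \<noteq> {}" for A
  proof (cases "card A \<le> d + 1")
    case True
    obtain i where "i \<in> A" using A by auto
    then show ?thesis using True A by (intro bexI[of _ i]) (auto simp: good_def card_Diff_singleton)
  next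
    case False
    have finA: "finite A" using A fin finite_subset by blast
    define n where "n = card A"
    from A(2) False obtain m where m: "\<forall>i\<in>A. 0 \<le> m i \<and> m i \<le> 1"
      "(\<Sum>i\<in>A. m i) = real n - real d" "\<forall>x\<in>X. (\<Sum>i\<in>A. m i * v i x) = 0"
      by (auto simp: good_def n_def)
    \<comment> \<open>Scaling by \<open>f\<close> lowers the total weight from \<open>n - d\<close>
      to \<open>n - d - 1\<close>, the amount required for a set with one vector less.\<close>
    define f where "f = (real n - real d - 1) / (real n - real d)"
    have nd: "d + 1 < n" using False by (simp add: n_def)
    have f: "0 \<le> f" "f \<le> 1" "f * (real n - real d) = real n - real d - 1"
      using nd by (auto simp: f_def)
    have "\<forall>i\<in>A. 0 \<le> f * m i \<and> f * m i \<le> 1" using m(1) f by (auto intro: mult_le_one)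
    moreover have "(\<Sum>i\<in>A. f * m i) = real n - real d - 1"
      using m(2) f(3) by (simp add: sum_distrib_left[symmetric])
    moreover have "\<forall>x\<in>X. (\<Sum>i\<in>A. f * m i * v i x) = 0"
      using m(3) by (simp add: mult.assoc sum_distrib_left[symmetric])
    ultimately obtain m' where m': "\<forall>i\<in>A. 0 \<le> m' i \<and> m' i \<le> 1"
      "(\<Sum>i\<in>A. m' i) = real n - real d - 1" "\<forall>x\<in>X. (\<Sum>i\<in>A. m' i * v i x) = 0"
      "card {i\<in>A. 0 < m' i \<and> m' i < 1} \<le> card X + 1"
      by (rule few_fractional_weights[OF finA fin(2), where m = "\<lambda>i. f * m i" and v = v]) auto
    have "\<exists>i\<in>A. m' i = 0"
    proof (rule ccontr)
      assume "\<not> ?thesis"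
      then have pos: "\<forall>i\<in>A. 0 < m' i" using m'(1) by force
      define Fr where "Fr = {i\<in>A. 0 < m' i \<and> m' i < 1}"
      have one: "m' i = 1" if "i \<in> A - Fr" for i using that pos m'(1) by (force simp: Fr_def)
      have FrA: "Fr \<subseteq> A" "finite Fr" using finA by (auto simp: Fr_def)
      have "(\<Sum>i\<in>A. m' i) = (\<Sum>i\<in>A - Fr. m' i) + (\<Sum>i\<in>Fr. m' i)"
        using sum.subset_diff[OF FrA(1) finA] .
      also have "(\<Sum>i\<in>A - Fr. m' i) = real n - real (card Fr)"
        using one FrA finA card_mono[OF finA FrA(1)]
        by (simp add: card_Diff_subset n_def of_nat_diff)
      finally have eq: "(\<Sum>i\<in>Fr. m' i) = real (card Fr) - real d - 1" using m'(2) by simp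
      have "card Fr \<le> d + 1" using m'(4) by (simp add: Fr_def d_def)
      with eq have le0: "(\<Sum>i\<in>Fr. m' i) \<le> 0" by simp
      have "Fr = {}"
      proof (rule ccontr)
        assume "Fr \<noteq> {}"
        then have "0 < (\<Sum>i\<in>Fr. m' i)" using FrA pos by (intro sum_pos) auto
        with le0 show False by simp
      qed
      with eq show False by simp
    qed
    then obtain i where i: "i \<in> A" "m' i = 0" by auto
    have "(\<Sum>j\<in>A - {i}. m' j * g j) = (\<Sum>j\<in>A. m' j * g j)" for g
      using sum.remove[OF finA i(1), of "\<lambda>j. m' j * g j"] i(2) by simp
    note sums = this
    have "(\<Sum>j\<in>A - {i}. m' j) = real (card (A - {i})) - real d"
      using sums[of "\<lambda>_. 1"] m'(2) i(1) nd finA by (simp add: n_def[symmetric] of_nat_diff)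
    then have "good (A - {i})"
      unfolding good_def using sums m'(1,3) by (intro disjI2 exI[of _ m']) simp
    with i show ?thesis by auto
  qed
  have chain: "\<exists>F. F (card A) = A \<and> (\<forall>k\<le>card A. card (F k) = k \<and> (\<forall>x\<in>X. \<bar>\<Sum>i\<in>F k. v i x\<bar> \<le> b * d))
    \<and> (\<forall>k<card A. F k \<subseteq> F (Suc k))" if "A \<subseteq> S" "good A" "card A = n" for A n
    using that
  proof (induction n arbitrary: A)
    case 0
    then have "A = {}" using fin finite_subset by fastforce
    then show ?case using b by (intro exI[of _ "\<lambda>_. {}"]) auto
  next
    case (Suc n)
    then have finA: "finite A" by (intro card_ge_0_finite) simp
    have "A \<noteq> {}" using Suc by auto
    with step[OF Suc.prems(1,2)] obtain i where i: "i \<in> A" "good (A - {i})" by auto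
    have c: "card (A - {i}) = n" using i Suc by simp
    have "A - {i} \<subseteq> S" using Suc.prems by auto
    from Suc.IH[OF this i(2) c, unfolded c] obtain F where F: "F n = A - {i}"
      "\<forall>k\<le>n. card (F k) = k \<and> (\<forall>x\<in>X. \<bar>\<Sum>i\<in>F k. v i x\<bar> \<le> b * d)" "\<forall>k<n. F k \<subseteq> F (Suc k)"
      by blast
    show ?case unfolding Suc.prems(3)
      using F Suc.prems bound[OF Suc.prems(1,2)]
      by (intro exI[of _ "F(Suc n := A)"]) (auto simp: le_Suc_eq less_Suc_eq)
  qed
  have "good S" using zero unfolding good_def
  proof (cases "card S \<le> d")
    case False
    \<comment> \<open>Since all vectors of \<open>S\<close> together sum to zero, constant weights
      are admissible.\<close>
    define f where "f = (real (card S) - real d) / real (card S)"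
    have "0 \<le> f" "f \<le> 1" "f * card S = real (card S) - real d"
      using False by (auto simp: f_def)
    then show "card S \<le> d \<or> (\<exists>m. (\<forall>i\<in>S. 0 \<le> m i \<and> m i \<le> 1)
     \<and> (\<Sum>i\<in>S. m i) = real (card S) - real d \<and> (\<forall>x\<in>X. (\<Sum>i\<in>S. m i * v i x) = 0))"
      using zero by (intro disjI2 exI[of _ "\<lambda>_. f"])
        (auto simp: sum_distrib_left[symmetric] mult.commute)
  qed auto
  from chain[OF subset_refl this refl] obtain F where F: "F (card S) = S"
    "\<forall>k\<le>card S. card (F k) = k \<and> (\<forall>x\<in>X. \<bar>\<Sum>i\<in>F k. v i x\<bar> \<le> b * d)"
    "\<forall>k<card S. F k \<subseteq> F (Suc k)" by blast
  have "F k \<subseteq> F l" if "k \<le> l" "l \<le> card S" for k l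
    using that
  proof (induction l rule: dec_induct)
    case (step l)
    then show ?case using F(3)[rule_format, of l] by simp
  qed simp
  with F show thesis by (intro that[of F]) (simp_all only: d_def)
qed

text \<open>An improving set \<open>J\<close> of minimal size is small. Otherwise the Steinitz order
  yields a proper part \<open>A\<close> whose change is a difference of two rounded points on the
  segment from 0 to the sum over \<open>J\<close>, so it lies between 0 and that sum, and so does
  the change of the rest. The costs of the two parts add up to a negative number, so one of them is
  a smaller improving set.\<close>

lemma exists_small_improvement:
  fixes \<delta> :: "'i \<Rightarrow> 'x \<Rightarrow> int" and w :: "'i \<Rightarrow> int" and q :: nat
  assumes fin: "finite I" "finite X" and q: "\<And>i x. i \<in> I \<Longrightarrow> x \<in> X \<Longrightarrow> \<bar>\<delta> i x\<bar> \<le> int q"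
    and neg: "(\<Sum>i\<in>I. w i) < 0"
  shows "\<exists>J\<subseteq>I. card J \<le> (4 * q * card X + 1) ^ card X \<and> (\<Sum>i\<in>J. w i) < 0 \<and>
    (\<forall>x\<in>X. min 0 (\<Sum>i\<in>I. \<delta> i x) \<le> (\<Sum>i\<in>J. \<delta> i x) \<and> (\<Sum>i\<in>J. \<delta> i x) \<le> max 0 (\<Sum>i\<in>I. \<delta> i x))"
proof -
  define ok where "ok J \<longleftrightarrow> J \<subseteq> I \<and> (\<Sum>i\<in>J. w i) < 0 \<and> (\<forall>x\<in>X. min 0 (\<Sum>i\<in>I. \<delta> i x) \<le> (\<Sum>i\<in>J. \<delta> i x)
    \<and> (\<Sum>i\<in>J. \<delta> i x) \<le> max 0 (\<Sum>i\<in>I. \<delta> i x))" for J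
  have "ok I" using neg by (auto simp: ok_def)
  from ex_has_least_nat[of ok I card, OF this]
  obtain J where J: "ok J" "\<And>J'. ok J' \<Longrightarrow> card J \<le> card J'" by blast
  define N where "N = card J"
  have finJ: "finite J" using J(1) fin finite_subset by (auto simp: ok_def)
  have JI: "J \<subseteq> I" using J(1) by (auto simp: ok_def)
  have "N \<le> (4 * q * card X + 1) ^ card X"
  proof (rule ccontr)
    assume big: "\<not> ?thesis"
    then have N0: "0 < N" by linarith
    define s where "s x = (\<Sum>i\<in>J. \<delta> i x)" for x
    \<comment> \<open>Subtracting the mean makes the vectors sum to zero. The mean is bounded by
      \<open>q\<close> as well, which gives the bound \<open>2 * q\<close>.\<close>
    define v where "v i x = real_of_int (\<delta> i x) - real_of_int (s x) / N" for i x
    have sq: "\<bar>s x\<bar> \<le> int N * int q" if "x \<in> X" for x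
    proof -
      have "\<bar>s x\<bar> \<le> (\<Sum>i\<in>J. \<bar>\<delta> i x\<bar>)" unfolding s_def by (rule sum_abs)
      also have "\<dots> \<le> (\<Sum>i\<in>J. int q)" using q JI that by (intro sum_mono) auto
      finally show ?thesis by (simp add: N_def)
    qed
    have "\<bar>v i x\<bar> \<le> 2 * real q" if "i \<in> J" "x \<in> X" for i x
    proof -
      have "\<bar>real_of_int (s x)\<bar> \<le> real N * real q"
        using sq[OF that(2), THEN of_int_le_iff[where 'a = real, THEN iffD2]] by simp
      then have "\<bar>real_of_int (s x) / N\<bar> \<le> real q" using N0 by (simp add: field_simps)
      moreover have "\<bar>real_of_int (\<delta> i x)\<bar> \<le> real q"
        using q[of i x, THEN of_int_le_iff[where 'a = real, THEN iffD2]] that JI by auto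
      ultimately show ?thesis unfolding v_def by linarith
    qed
    moreover have "(\<Sum>i\<in>J. v i x) = 0" for x
      using N0 by (simp add: v_def sum_subtractf s_def N_def)
    ultimately obtain F where F: "F N = J" "\<And>k. k \<le> N \<Longrightarrow> card (F k) = k"
      "\<And>k l. k \<le> l \<Longrightarrow> l \<le> N \<Longrightarrow> F k \<subseteq> F l"
      "\<And>k x. k \<le> N \<Longrightarrow> x \<in> X \<Longrightarrow> \<bar>\<Sum>i\<in>F k. v i x\<bar> \<le> 2 * real q * card X"
      unfolding N_def by (rule steinitz_chain[OF finJ fin(2), of "2 * real q" v, rotated 1]) auto
    \<comment> \<open>The segment is rounded down to integers. As the Steinitz bound
      \<open>b\<close> is an integer, the offsets of the integral partial sums from the rounded
      points still lie between \<open>- b\<close> and \<open>b\<close>.\<close>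
    define fl where "fl k x = \<lfloor>real k * real_of_int (s x) / real N\<rfloor>" for k x
    define P where "P k x = (\<Sum>i\<in>F k. \<delta> i x)" for k x
    define b where "b = 2 * int q * int (card X)"
    have range: "P k x - fl k x \<in> {-b..b}" if "k \<le> N" "x \<in> X" for k x
    proof -
      have fe: "card (F k) = k" using F that by auto
      have "(\<Sum>i\<in>F k. v i x) = real_of_int (P k x) - real k * real_of_int (s x) / real N"
        by (simp add: v_def sum_subtractf P_def fe)
      then have "\<bar>real_of_int (P k x) - real k * real_of_int (s x) / real N\<bar> \<le> real_of_int b"
        using F(4)[OF that] by (simp add: b_def)
      moreover define y where "y = real k * real_of_int (s x) / real N"
      moreover have "real_of_int \<lfloor>y\<rfloor> \<le> y" "y < real_of_int \<lfloor>y\<rfloor> + 1" by linarith+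
      ultimately have "real_of_int (- b) \<le> real_of_int (P k x - fl k x)"
        "real_of_int (P k x - fl k x) < real_of_int (b + 1)"
        unfolding fl_def y_def[symmetric] by (simp_all; linarith)+
      then show ?thesis unfolding of_int_le_iff of_int_less_iff by simp
    qed
    \<comment> \<open>Offsets are compared for the indices 1 to \<open>N\<close> only: without index
      0, the difference of two sets in the chain has fewer than \<open>N\<close> elements, so it is
      a proper part of \<open>J\<close>.\<close>
    define g where "g k = restrict (\<lambda>x. P k x - fl k x) X" for k
    have gim: "g ` {1..N} \<subseteq> PiE X (\<lambda>_. {-b..b})" using range by (fastforce simp: g_def)
    \<comment> \<open>Each coordinate admits \<open>2 * b + 1 = 4 * q * card X + 1\<close>
      offsets.\<close>
    have "card (PiE X (\<lambda>_. {-b..b})) = (4 * q * card X + 1) ^ card X"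
      using fin by (simp add: card_PiE b_def nat_add_distrib nat_mult_distrib mult.assoc)
    with big have "card (PiE X (\<lambda>_. {-b..b})) < card {1..N}" by simp
    moreover have "finite (PiE X (\<lambda>_. {-b..b}))" using fin by (intro finite_PiE) auto
    ultimately have "\<not> inj_on g {1..N}"
      using gim by (metis card_image card_mono not_less)
    then obtain k l where kl: "1 \<le> k" "k < l" "l \<le> N" "g k = g l"
      unfolding inj_on_def by (metis atLeastAtMost_iff linorder_neqE_nat)
    define A where "A = F l - F k"
    have Fs: "F k \<subseteq> F l" "F l \<subseteq> J" using F(3)[of k l] F(3)[of l N] F(1) kl by auto
    have AJ: "A \<subseteq> J" using Fs by (auto simp: A_def)
    have "finite (F k)" using finite_subset[OF subset_trans[OF Fs] finJ] .
    then have cA: "card A = l - k"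
      unfolding A_def using card_Diff_subset[OF _ Fs(1)] F(2)[of k] F(2)[of l] kl by auto
    have sumA: "(\<Sum>i\<in>A. \<delta> i x) = fl l x - fl k x" if "x \<in> X" for x
    proof -
      have "P l x - fl l x = P k x - fl k x"
        using fun_cong[OF kl(4), of x] that by (simp add: g_def)
      moreover have "P l x = (\<Sum>i\<in>A. \<delta> i x) + P k x"
        unfolding P_def A_def using Fs finJ by (intro sum.subset_diff) (auto intro: finite_subset)
      ultimately show ?thesis by simp
    qed
    have btw: "min 0 (s x) \<le> fl l x - fl k x \<and> fl l x - fl k x \<le> max 0 (s x)" for x
    proof (cases "0 \<le> s x")
      case True
      have "fl k x \<le> fl l x" unfolding fl_def using kl True
        by (intro floor_mono divide_right_mono mult_right_mono) auto
      moreover have "fl l x \<le> s x"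
      proof -
        have "real l * real_of_int (s x) / real N \<le> real_of_int (s x)"
          using mult_right_mono[of "real l" "real N" "real_of_int (s x)"] kl True N0
          by (simp add: divide_le_eq mult.commute)
        then show ?thesis unfolding fl_def by linarith
      qed
      moreover have "0 \<le> fl k x" unfolding fl_def using True by simp
      ultimately show ?thesis using True by auto
    next
      case False
      have "fl l x \<le> fl k x" unfolding fl_def using kl False
        by (intro floor_mono divide_right_mono mult_right_mono_neg) auto
      moreover have "s x \<le> fl l x"
      proof -
        have "real_of_int (s x) * real N \<le> real_of_int (s x) * real l"
          using kl False by (intro mult_left_mono_neg) auto
        then have "real_of_int (s x) \<le> real l * real_of_int (s x) / real N"
          using N0 by (simp add: le_divide_eq mult.commute)
        then show ?thesis unfolding fl_def by linarith
      qed
      moreover have "fl k x \<le> 0"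
      proof -
        have "real k * real_of_int (s x) / real N \<le> 0"
          using False by (intro divide_nonpos_nonneg mult_nonneg_nonpos) auto
        then show ?thesis unfolding fl_def by linarith
      qed
      ultimately show ?thesis using False by auto
    qed
    have sI: "min 0 (\<Sum>i\<in>I. \<delta> i x) \<le> s x \<and> s x \<le> max 0 (\<Sum>i\<in>I. \<delta> i x)" if "x \<in> X" for x
      using J(1) that by (auto simp: ok_def s_def)
    have dif: "(\<Sum>i\<in>J - A. g i) = (\<Sum>i\<in>J. g i) - (\<Sum>i\<in>A. g i)" for g :: "'i \<Rightarrow> int"
      using AJ finJ by (simp add: sum_diff)
    have cases: "(\<Sum>i\<in>A. w i) < 0 \<or> (\<Sum>i\<in>J - A. w i) < 0"
      using J(1) dif[of w] by (auto simp: ok_def)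
    have okA: "ok A" if "(\<Sum>i\<in>A. w i) < 0"
      unfolding ok_def
    proof (intro conjI ballI that)
      fix x assume x: "x \<in> X"
      show "min 0 (\<Sum>i\<in>I. \<delta> i x) \<le> (\<Sum>i\<in>A. \<delta> i x)"
        "(\<Sum>i\<in>A. \<delta> i x) \<le> max 0 (\<Sum>i\<in>I. \<delta> i x)"
        using btw[of x] sI[OF x] sumA[OF x] by linarith+
    qed (use AJ JI in auto)
    have okB: "ok (J - A)" if "(\<Sum>i\<in>J - A. w i) < 0"
      unfolding ok_def
    proof (intro conjI ballI that)
      fix x assume x: "x \<in> X"
      have "(\<Sum>i\<in>J - A. \<delta> i x) = s x - (fl l x - fl k x)" using dif sumA x by (simp add: s_def)
      then show "min 0 (\<Sum>i\<in>I. \<delta> i x) \<le> (\<Sum>i\<in>J - A. \<delta> i x)"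
        "(\<Sum>i\<in>J - A. \<delta> i x) \<le> max 0 (\<Sum>i\<in>I. \<delta> i x)"
        using btw[of x] sI[OF x] by linarith+
    qed (use JI in auto)
    have "card (J - A) = N - (l - k)" using cA AJ finJ by (simp add: card_Diff_subset finite_subset N_def)
    then have "card (J - A) < N" "card A < N" using cA kl by auto
    with cases okA okB J(2)[of A] J(2)[of "J - A"] show False unfolding N_def by linarith
  qed
  with J(1) show ?thesis unfolding ok_def N_def by blast
qed

section \<open>Assignments as choices of options\<close>

text \<open>With label \<open>n\<close> on \<open>X\<close>, item \<open>n\<close> consists of the
  edges inside \<open>X\<close>; every other edge belongs to the class of an endpoint outside
  \<open>X\<close>.\<close>

definition item_of :: "nat set \<Rightarrow> (nat \<Rightarrow> nat) \<Rightarrow> nat \<Rightarrow> nat \<Rightarrow> nat" where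
  "item_of X lab u v = (if u \<in> X then lab v else lab u)"

definition pair_list :: "nat \<Rightarrow> (nat \<times> nat) list" where
  "pair_list n = List.product [0..<n] [0..<n]"

text \<open>Each edge occurs once, larger endpoint first, in the order in which a double loop over
  the vertices meets it. The position in this list is the position of its digit in an
  option.\<close>

definition item_edges :: "nat \<Rightarrow> nat set set \<Rightarrow> nat set \<Rightarrow> (nat \<Rightarrow> nat) \<Rightarrow> nat \<Rightarrow> (nat \<times> nat) list" where
  "item_edges n E X lab i =
     filter (\<lambda>(u, v). v < u \<and> {u, v} \<in> E \<and> item_of X lab u v = i) (pair_list n)"

text \<open>The base 3 digits of an option say, edge by edge, to which endpoint the edge is assigned, 0 meaning neither.\<close>

definition digit3 :: "nat \<Rightarrow> nat \<Rightarrow> nat" where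
  "digit3 a e = (a div 3 ^ e) mod 3"

definition target :: "nat \<times> nat \<Rightarrow> nat \<Rightarrow> nat option" where
  "target uv d = (if d = 0 then None else if d = 1 then Some (fst uv) else Some (snd uv))"

definition load_at :: "(nat \<times> nat) list \<Rightarrow> nat \<Rightarrow> nat \<Rightarrow> nat" where
  "load_at es a v = card {e. e < length es \<and> target (es ! e) (digit3 a e) = Some v}"

text \<open>The factor \<open>n + 1\<close> exceeds the size of every cover, so a total cost of at
  most \<open>n\<close> certifies that nothing is unassigned or overloaded outside \<open>X\<close>.
  Capacities on \<open>X\<close> are absent because several items load the same vertex of
  \<open>X\<close>.\<close>

definition item_cost :: "nat \<Rightarrow> nat set \<Rightarrow> (nat \<Rightarrow> nat) \<Rightarrow> (nat \<times> nat) list \<Rightarrow> nat \<Rightarrow> nat" where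
  "item_cost n X c es a = (n + 1) * card {e. e < length es \<and> digit3 a e = 0}
     + card {v. v < n \<and> v \<notin> X \<and> 0 < load_at es a v}
     + (n + 1) * card {v. v < n \<and> v \<notin> X \<and> c v < load_at es a v}"

lemma set_pair_list [simp]: "set (pair_list n) = {..<n} \<times> {..<n}"
  by (auto simp: pair_list_def)

lemma distinct_pair_list [simp]: "distinct (pair_list n)"
  by (simp add: pair_list_def distinct_product)

lemma distinct_item_edges [simp]: "distinct (item_edges n E X lab i)"
  by (simp add: item_edges_def)

lemma set_item_edges:
  "set (item_edges n E X lab i) = {(u, v). u < n \<and> v < u \<and> {u, v} \<in> E \<and> item_of X lab u v = i}"
  by (auto simp: item_edges_def)

lemma ex_number_with_digits:
  assumes "\<And>e. e < l \<Longrightarrow> d e < (b :: nat)"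
  shows "\<exists>a<b ^ l. \<forall>e<l. (a div b ^ e) mod b = d e"
  using assms
proof (induction l arbitrary: d)
  case (Suc l)
  from Suc.IH[of "\<lambda>e. d (Suc e)"] Suc.prems obtain a where
    a: "a < b ^ l" "\<And>e. e < l \<Longrightarrow> (a div b ^ e) mod b = d (Suc e)" by auto
  have d0: "d 0 < b" using Suc.prems by auto
  have dv: "(b * a + d 0) div b = a" "(b * a + d 0) mod b = d 0" using d0 by auto
  have "b * a + d 0 < b ^ Suc l"
  proof -
    have "b * (a + 1) \<le> b * b ^ l" using a(1) by (intro mult_le_mono2) simp
    then show ?thesis using d0 by simp
  qed
  moreover have "((b * a + d 0) div b ^ e) mod b = d e" if "e < Suc l" for e
  proof (cases e)
    case 0
    then show ?thesis using dv by simp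
  next
    case (Suc f)
    then have "(b * a + d 0) div b ^ e = a div b ^ f" using dv by (simp add: div_mult2_eq)
    then show ?thesis using a(2) Suc that by simp
  qed
  ultimately show ?case by blast
qed simp

lemma le_multiple_add: "1 \<le> k \<Longrightarrow> (m :: nat) \<le> m * k + a + b" "1 \<le> k \<Longrightarrow> (m :: nat) \<le> b + a + m * k"
  by (cases k; simp)+

text \<open>No edge of the graph without \<open>X\<close> leaves its label class. The bound
  \<open>card_lab\<close> also covers the label \<open>n\<close>, that is \<open>X\<close> itself,
  so that item \<open>n\<close> is as small as the others.\<close>

locale separation =
  fixes n :: nat and E :: "nat set set" and X :: "nat set" and lab :: "nat \<Rightarrow> nat" and p :: nat
  assumes graph: "simple_graph {..<n} E" and XV: "X \<subseteq> {..<n}"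
    and labX: "\<And>v. v \<in> X \<Longrightarrow> lab v = n"
    and lab_less: "\<And>v. v < n \<Longrightarrow> v \<notin> X \<Longrightarrow> lab v < n"
    and lab_adj: "\<And>u v. {u, v} \<in> E \<Longrightarrow> u \<notin> X \<Longrightarrow> v \<notin> X \<Longrightarrow> lab u = lab v"
    and card_lab: "\<And>i. card {v. v < n \<and> lab v = i} \<le> p"
    and cardX: "card X \<le> p" and p1: "1 \<le> p"
begin

abbreviation es :: "nat \<Rightarrow> (nat \<times> nat) list" where
  "es \<equiv> item_edges n E X lab"

definition pairs :: "(nat \<times> nat) set" where
  "pairs = {(u, v). u < n \<and> v < u \<and> {u, v} \<in> E}"

lemma finite_pairs: "finite pairs"
  by (rule finite_subset[of _ "{..<n} \<times> {..<n}"]) (auto simp: pairs_def)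

lemma finX: "finite X" using XV finite_subset by auto

lemma edge_cases:
  assumes "e \<in> E"
  obtains u v where "(u, v) \<in> pairs" "e = {u, v}"
proof -
  from assms graph have "e \<subseteq> {..<n}" "card e = 2" by (auto simp: simple_graph_def)
  then obtain x y where xy: "e = {x, y}" "x \<noteq> y" "x < n" "y < n"
    by (auto simp: card_2_iff)
  show thesis
  proof (cases "y < x")
    case True
    then show thesis using that[of x y] xy assms by (auto simp: pairs_def)
  next
    case False
    then show thesis using that[of y x] xy assms by (auto simp: pairs_def insert_commute)
  qed
qed

lemma bij_pairs: "bij_betw (\<lambda>(u, v). {u, v}) pairs E"
  unfolding bij_betw_def
proof
  show "inj_on (\<lambda>(u, v). {u, v}) pairs"
    by (auto simp: inj_on_def pairs_def doubleton_eq_iff)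
  show "(\<lambda>(u, v). {u, v}) ` pairs = E"
  proof
    show "(\<lambda>(u, v). {u, v}) ` pairs \<subseteq> E" by (auto simp: pairs_def)
    show "E \<subseteq> (\<lambda>(u, v). {u, v}) ` pairs"
    proof
      fix e assume "e \<in> E"
      then obtain u v where "(u, v) \<in> pairs" "e = {u, v}" by (rule edge_cases)
      then show "e \<in> (\<lambda>(u, v). {u, v}) ` pairs" by (intro image_eqI[of _ _ "(u, v)"]) auto
    qed
  qed
qed

lemma card_pairs_edges:
  assumes "\<And>u v. (u, v) \<in> pairs \<Longrightarrow> f {u, v} = F (u, v)"
  shows "card {uv \<in> pairs. F uv = x} = card {e \<in> E. f e = x}"
proof -
  have "{e \<in> E. f e = x} = (\<lambda>(u, v). {u, v}) ` {uv \<in> pairs. F uv = x}"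
  proof (intro equalityI subsetI)
    fix e assume e: "e \<in> {e \<in> E. f e = x}"
    then obtain u v where uv: "(u, v) \<in> pairs" "e = {u, v}" using edge_cases by blast
    then show "e \<in> (\<lambda>(u, v). {u, v}) ` {uv \<in> pairs. F uv = x}"
      using e assms[OF uv(1)] by (intro image_eqI[of _ _ "(u, v)"]) auto
  next
    fix e assume "e \<in> (\<lambda>(u, v). {u, v}) ` {uv \<in> pairs. F uv = x}"
    then obtain u v where uv: "(u, v) \<in> pairs" "F (u, v) = x" "e = {u, v}" by auto
    then show "e \<in> {e \<in> E. f e = x}" using assms[OF uv(1)] by (auto simp: pairs_def)
  qed
  moreover have "inj_on (\<lambda>(u, v). {u, v}) {uv \<in> pairs. F uv = x}"
    using bij_pairs by (auto simp: bij_betw_def intro: inj_on_subset)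
  ultimately show ?thesis by (simp add: card_image)
qed

lemma item_le: "(u, v) \<in> pairs \<Longrightarrow> item_of X lab u v \<le> n"
  using labX[of v] lab_less[of v] lab_less[of u] by (cases "v \<in> X") (auto simp: item_of_def pairs_def)

lemma set_es: "set (es i) = {uv \<in> pairs. item_of X lab (fst uv) (snd uv) = i}"
  by (auto simp: set_item_edges pairs_def)

lemma item_endpoint:
  assumes "(u, v) \<in> set (es i)"
  shows "u \<in> X \<Longrightarrow> lab v = i" "v \<in> X \<Longrightarrow> lab u = i" "u \<notin> X \<Longrightarrow> lab u = i" "v \<notin> X \<Longrightarrow> lab v = i"
  using assms labX lab_adj[of u v] by (auto simp: set_item_edges item_of_def split: if_splits)

text \<open>All endpoints of the edges of an item lie in one label class or in \<open>X\<close>, at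
  most \<open>2 * p\<close> vertices.\<close>

lemma length_es: "length (es i) \<le> 4 * p * p"
proof -
  define K where "K = {v. v < n \<and> lab v = i} \<union> X"
  have fK: "finite K" using finX by (simp add: K_def)
  have "card K \<le> 2 * p" using card_Un_le[of "{v. v < n \<and> lab v = i}" X] card_lab[of i] cardX by (simp add: K_def)
  moreover have "set (es i) \<subseteq> K \<times> K"
  proof
    fix uv assume uv: "uv \<in> set (es i)"
    obtain u v where e: "uv = (u, v)" by fastforce
    then have "u < n" "v < n" using uv by (auto simp: set_item_edges)
    then show "uv \<in> K \<times> K" using item_endpoint[of u v i] uv e by (auto simp: K_def)
  qed
  then have "card (set (es i)) \<le> card K * card K"
    using card_mono[of "K \<times> K"] fK by (simp add: card_cartesian_product)
  ultimately have "card (set (es i)) \<le> (2 * p) * (2 * p)" using mult_le_mono order_trans by blast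
  then show ?thesis by (simp add: distinct_card)
qed

lemma load_at_eq:
  assumes "\<And>e. e < length (es i) \<Longrightarrow> F (es i ! e) = target (es i ! e) (digit3 a e)"
  shows "load_at (es i) a v = card {uv \<in> set (es i). F uv = Some v}"
proof -
  have "bij_betw (nth (es i)) {e. e < length (es i) \<and> F (es i ! e) = Some v} {uv \<in> set (es i). F uv = Some v}"
    unfolding bij_betw_def
  proof
    show "inj_on (nth (es i)) {e. e < length (es i) \<and> F (es i ! e) = Some v}"
      by (auto simp: inj_on_def nth_eq_iff_index_eq)
    show "nth (es i) ` {e. e < length (es i) \<and> F (es i ! e) = Some v} = {uv \<in> set (es i). F uv = Some v}"
      unfolding set_conv_nth by blast
  qed
  from bij_betw_same_card[OF this]
  have "card {e. e < length (es i) \<and> F (es i ! e) = Some v} = card {uv \<in> set (es i). F uv = Some v}" .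
  moreover have "{e. e < length (es i) \<and> F (es i ! e) = Some v}
    = {e. e < length (es i) \<and> target (es i ! e) (digit3 a e) = Some v}" using assms by auto
  ultimately show ?thesis by (simp add: load_at_def)
qed

lemma target_cases: "target (u, v) d = Some x \<Longrightarrow> x = u \<or> x = v"
  by (auto simp: target_def split: if_splits)

text \<open>The edges of one item at a vertex of \<open>X\<close> have different other endpoints,
  and all of these carry the label of the item (in item \<open>n\<close> they lie in
  \<open>X\<close>).\<close>

lemma load_at_le:
  assumes "x \<in> X"
  shows "load_at (es i) a x \<le> p"
proof -
  define S where "S = {e. e < length (es i) \<and> target (es i ! e) (digit3 a e) = Some x}"
  define g where "g e = (if fst (es i ! e) = x then snd (es i ! e) else fst (es i ! e))" for e
  have in_es: "es i ! e \<in> set (es i)" if "e \<in> S" for e using that by (auto simp: S_def)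
  have endp: "fst (es i ! e) = x \<or> snd (es i ! e) = x" if "e \<in> S" for e
    using that target_cases[of "fst (es i ! e)" "snd (es i ! e)"] by (auto simp: S_def)
  have "inj_on g S"
  proof (rule inj_onI)
    fix e f assume e: "e \<in> S" "f \<in> S" "g e = g f"
    have "es i ! e = es i ! f"
      using e(3) endp[OF e(1)] endp[OF e(2)] in_es[OF e(1)] in_es[OF e(2)]
      by (cases "es i ! e"; cases "es i ! f") (auto simp: g_def set_item_edges split: if_splits)
    then show "e = f" using e by (simp add: S_def nth_eq_iff_index_eq)
  qed
  moreover have "g ` S \<subseteq> {v. v < n \<and> lab v = i}"
  proof
    fix y assume "y \<in> g ` S"
    then obtain e where e: "e \<in> S" "y = g e" by auto
    obtain u v where uv: "es i ! e = (u, v)" by fastforce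
    have m: "(u, v) \<in> set (es i)" using in_es[OF e(1)] uv by simp
    then have "u < n" "v < n" by (auto simp: set_item_edges)
    then show "y \<in> {v. v < n \<and> lab v = i}"
      using endp[OF e(1)] uv e(2) item_endpoint[OF m] assms by (auto simp: g_def)
  qed
  ultimately have "card S \<le> card {v. v < n \<and> lab v = i}" by (intro card_inj_on_le) auto
  then show ?thesis using card_lab[of i] by (simp add: load_at_def S_def)
qed

lemma card_pairs_split:
  "card {uv \<in> pairs. P uv} = (\<Sum>i<n+1. card {uv \<in> set (es i). P uv})"
proof -
  have "{uv \<in> pairs. P uv} = (\<Union>i\<in>{..<n+1}. {uv \<in> set (es i). P uv})"
    using item_le by (fastforce simp: set_es)
  then show ?thesis
    by (simp only:) (rule card_UN_disjoint, simp, simp, auto simp: set_es)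
qed

lemma load_other_item:
  assumes "v \<notin> X" "i \<noteq> lab v"
  shows "{uv \<in> set (es i). fst uv = v \<or> snd uv = v} = {}"
  using assms item_endpoint by force

lemma load_at_other_item: "v \<notin> X \<Longrightarrow> i \<noteq> lab v \<Longrightarrow> load_at (es i) a v = 0"
proof -
  assume v: "v \<notin> X" "i \<noteq> lab v"
  have "target (es i ! e) (digit3 a e) \<noteq> Some v" if "e < length (es i)" for e
    using load_other_item[OF v] nth_mem[OF that] target_cases[of "fst (es i ! e)" "snd (es i ! e)"] by force
  then show ?thesis by (simp add: load_at_def)
qed

text \<open>Capacity 0 on the vertices of \<open>X\<close> guessed to lie outside the cover turns
  the guess into an ordinary load constraint.\<close>

definition mask_cap :: "nat set \<Rightarrow> (nat \<Rightarrow> nat) \<Rightarrow> nat \<Rightarrow> nat" where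
  "mask_cap mk c x = (if x \<in> mk then c x else 0)"

text \<open>Digit 1 or 2 of an option copies the endpoint chosen by \<open>f\<close>. No penalty
  arises, so the item costs count used vertices outside \<open>X\<close>. A vertex outside
  \<open>X\<close> is loaded by the item of its label only, hence is counted once.\<close>

lemma cover_imp_choice:
  assumes f: "\<forall>e\<in>E. f e \<in> e" and cap: "\<forall>v. card {e \<in> E. f e = v} \<le> c v"
    and mk: "mk = X \<inter> f ` E"
  shows "\<exists>z. (\<forall>i<n+1. z i < 3 ^ (4 * p * p)) \<and>
    (\<forall>x\<in>X. (\<Sum>i<n+1. load_at (es i) (z i) x) \<le> mask_cap mk c x) \<and>
    (\<Sum>i<n+1. item_cost n X c (es i) (z i)) + card mk \<le> card (f ` E)"
proof -
  define F where "F uv = f {fst uv, snd uv}" for uv :: "nat \<times> nat"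
  have Fe: "F (u, v) = u \<or> F (u, v) = v" if "(u, v) \<in> pairs" for u v
    using f that by (auto simp: F_def pairs_def)
  have "\<exists>a<3 ^ length (es i). \<forall>e<length (es i). digit3 a e = (if F (es i ! e) = fst (es i ! e) then 1 else 2)" for i
    unfolding digit3_def
    by (rule ex_number_with_digits[where d = "\<lambda>e. if F (es i ! e) = fst (es i ! e) then 1 else 2"]) auto
  then obtain z where z: "\<And>i. z i < 3 ^ length (es i)"
    "\<And>i e. e < length (es i) \<Longrightarrow> digit3 (z i) e = (if F (es i ! e) = fst (es i ! e) then 1 else 2)" by metis
  have zlt: "z i < 3 ^ (4 * p * p)" for i
    using z(1)[of i] power_increasing[OF length_es[of i], of "3 :: nat"] by linarith
  have tg: "Some (F (es i ! e)) = target (es i ! e) (digit3 (z i) e)" if "e < length (es i)" for i e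
  proof -
    obtain u v where uv: "es i ! e = (u, v)" by fastforce
    then have "(u, v) \<in> pairs" using nth_mem[OF that] by (simp add: set_es)
    from Fe[OF this] show ?thesis using z(2)[OF that] uv by (auto simp: target_def)
  qed
  have ld: "load_at (es i) (z i) v = card {uv \<in> set (es i). F uv = v}" for i v
    using load_at_eq[of i "\<lambda>uv. Some (F uv)" "z i" v] tg by simp
  have tot: "(\<Sum>i<n+1. load_at (es i) (z i) v) = card {e \<in> E. f e = v}" for v
  proof -
    have "(\<Sum>i<n+1. load_at (es i) (z i) v) = card {uv \<in> pairs. F uv = v}"
      unfolding ld card_pairs_split ..
    also have "\<dots> = card {e \<in> E. f e = v}" by (rule card_pairs_edges) (simp add: F_def)
    finally show ?thesis .
  qed
  have finE: "finite E" using bij_betw_finite[OF bij_pairs] finite_pairs by simp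
  have le: "load_at (es i) (z i) v \<le> c v" if "i < n + 1" for i v
  proof -
    have "load_at (es i) (z i) v \<le> (\<Sum>i<n+1. load_at (es i) (z i) v)"
      using that by (intro member_le_sum) auto
    then show ?thesis using tot[of v] spec[OF cap, of v] by linarith
  qed
  have cst: "item_cost n X c (es i) (z i) = card {v. v < n \<and> v \<notin> X \<and> 0 < load_at (es i) (z i) v}"
    if i: "i < n + 1" for i
  proof -
    have "{e. e < length (es i) \<and> digit3 (z i) e = 0} = {}" using z(2) by auto
    moreover have "{v. v < n \<and> v \<notin> X \<and> c v < load_at (es i) (z i) v} = {}" using le[OF i] by (auto simp: not_less)
    ultimately show ?thesis unfolding item_cost_def by (simp only: card.empty)
  qed
  have "(\<Sum>i<n+1. item_cost n X c (es i) (z i)) = (\<Sum>i<n+1. card {v. v < n \<and> v \<notin> X \<and> 0 < load_at (es i) (z i) v})"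
    using cst by (intro sum.cong) auto
  also have "\<dots> = card (\<Union>i\<in>{..<n+1}. {v. v < n \<and> v \<notin> X \<and> 0 < load_at (es i) (z i) v})"
  proof (intro card_UN_disjoint[symmetric] ballI impI)
    fix i j :: nat assume ij: "i \<noteq> j"
    show "{v. v < n \<and> v \<notin> X \<and> 0 < load_at (es i) (z i) v} \<inter> {v. v < n \<and> v \<notin> X \<and> 0 < load_at (es j) (z j) v} = {}"
    proof (rule ccontr)
      assume "\<not> ?thesis"
      then obtain v where v: "v \<notin> X" "0 < load_at (es i) (z i) v" "0 < load_at (es j) (z j) v" by auto
      then have "i = lab v" "j = lab v"
        using load_at_other_item[of v i] load_at_other_item[of v j] by (metis less_irrefl)+
      with ij show False by simp
    qed
  qed auto
  also have "\<dots> \<le> card (f ` E - X)"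
  proof (rule card_mono)
    show "(\<Union>i\<in>{..<n+1}. {v. v < n \<and> v \<notin> X \<and> 0 < load_at (es i) (z i) v}) \<subseteq> f ` E - X"
    proof
      fix v assume "v \<in> (\<Union>i\<in>{..<n+1}. {v. v < n \<and> v \<notin> X \<and> 0 < load_at (es i) (z i) v})"
      then obtain i where i: "i < n + 1" "v \<notin> X" "0 < load_at (es i) (z i) v" by auto
      then have "0 < (\<Sum>i<n+1. load_at (es i) (z i) v)"
        using member_le_sum[of i "{..<n+1}" "\<lambda>i. load_at (es i) (z i) v"] by auto
      then have "{e \<in> E. f e = v} \<noteq> {}" unfolding tot by (metis card.empty less_irrefl)
      then show "v \<in> f ` E - X" using i by auto
    qed
  qed (use finE in auto)
  finally have "(\<Sum>i<n+1. item_cost n X c (es i) (z i)) + card mk \<le> card (f ` E - X) + card (X \<inter> f ` E)"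
    by (simp add: mk)
  also have "\<dots> = card (f ` E)"
    using finE by (subst card_Un_disjoint[symmetric]) (auto intro!: arg_cong[of _ _ card])
  finally have "(\<Sum>i<n+1. item_cost n X c (es i) (z i)) + card mk \<le> card (f ` E)" .
  moreover have "(\<Sum>i<n+1. load_at (es i) (z i) x) \<le> mask_cap mk c x" if "x \<in> X" for x
  proof (cases "x \<in> mk")
    case False
    then have "{e \<in> E. f e = x} = {}" using mk that by auto
    then have "card {e \<in> E. f e = x} = 0" by (simp only: card.empty)
    then show ?thesis unfolding tot by linarith
  next
    case True
    then show ?thesis unfolding tot mask_cap_def using cap by simp
  qed
  ultimately show ?thesis using zlt by blast
qed

text \<open>A cost of at most \<open>n\<close> leaves no room for a penalty, so the digits define an
  assignment. Its image is the cover: the part outside \<open>X\<close> is paid for by the item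
  costs, and the part inside \<open>X\<close> lies in \<open>mk\<close>, since other vertices of
  \<open>X\<close> admit no load.\<close>

lemma choice_imp_cover:
  assumes mk: "mk \<subseteq> X"
    and ld: "\<forall>x\<in>X. (\<Sum>i<n+1. load_at (es i) (z i) x) \<le> mask_cap mk c x"
    and cst: "(\<Sum>i<n+1. item_cost n X c (es i) (z i)) \<le> n"
      "int ((\<Sum>i<n+1. item_cost n X c (es i) (z i)) + card mk) \<le> k"
  shows "capacitated_vertex_cover {..<n} E c k"
proof -
  have each: "item_cost n X c (es i) (z i) \<le> n" if "i < n + 1" for i
  proof -
    have "item_cost n X c (es i) (z i) \<le> (\<Sum>i<n+1. item_cost n X c (es i) (z i))"
      using that by (intro member_le_sum) auto
    then show ?thesis using cst(1) by linarith
  qed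
  have no_unassigned: "digit3 (z i) e \<noteq> 0" if "i < n + 1" "e < length (es i)" for i e
  proof
    assume "digit3 (z i) e = 0"
    then have "e \<in> {e. e < length (es i) \<and> digit3 (z i) e = 0}" using that by simp
    then have "1 \<le> card {e. e < length (es i) \<and> digit3 (z i) e = 0}" unfolding One_nat_def Suc_le_eq card_gt_0_iff by (intro conjI) auto
    then have "n + 1 \<le> item_cost n X c (es i) (z i)"
      unfolding item_cost_def by (rule le_multiple_add(1))
    then show False using each[OF that(1)] by simp
  qed
  have no_overload: "load_at (es i) (z i) v \<le> c v" if "i < n + 1" "v < n" "v \<notin> X" for i v
  proof (rule ccontr)
    assume "\<not> load_at (es i) (z i) v \<le> c v"
    then have "v \<in> {v. v < n \<and> v \<notin> X \<and> c v < load_at (es i) (z i) v}" using that by simp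
    then have "1 \<le> card {v. v < n \<and> v \<notin> X \<and> c v < load_at (es i) (z i) v}" unfolding One_nat_def Suc_le_eq card_gt_0_iff by (intro conjI) auto
    then have "n + 1 \<le> item_cost n X c (es i) (z i)"
      unfolding item_cost_def by (rule le_multiple_add(2))
    then show False using each[OF that(1)] by simp
  qed
  define idx where "idx i uv = (THE e. e < length (es i) \<and> es i ! e = uv)" for i uv
  have idx: "idx i (es i ! e) = e" if "e < length (es i)" for i e
    unfolding idx_def using that by (intro the_equality) (auto simp: nth_eq_iff_index_eq)
  \<comment> \<open>A pair reads the digit at its own position in the list of its own item; no digit
    is 0, so \<open>the\<close> is applied to a proper value.\<close>
  define F where "F uv = the (target uv (digit3 (z (item_of X lab (fst uv) (snd uv)))
      (idx (item_of X lab (fst uv) (snd uv)) uv)))" for uv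
  have F: "Some (F (es i ! e)) = target (es i ! e) (digit3 (z i) e)" if "i < n + 1" "e < length (es i)" for i e
  proof -
    have "item_of X lab (fst (es i ! e)) (snd (es i ! e)) = i" using nth_mem[OF that(2)] by (simp add: set_es)
    then show ?thesis using no_unassigned[OF that] idx[OF that(2)] by (simp add: F_def target_def)
  qed
  have ldF: "load_at (es i) (z i) v = card {uv \<in> set (es i). F uv = v}" if "i < n + 1" for i v
    using load_at_eq[of i "\<lambda>uv. Some (F uv)" "z i" v] F[OF that] by simp
  have Fin: "F uv = fst uv \<or> F uv = snd uv" if "uv \<in> pairs" for uv
  proof -
    define i where "i = item_of X lab (fst uv) (snd uv)"
    have "uv \<in> set (es i)" "i < n + 1" using that item_le[of "fst uv" "snd uv"] by (auto simp: set_es i_def)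
    then obtain e where "e < length (es i)" "es i ! e = uv" by (auto simp: in_set_conv_nth)
    then show ?thesis using F[of i e] \<open>i < n + 1\<close> target_cases[of "fst uv" "snd uv"] by auto
  qed
  define f where "f e = F (the_inv_into pairs (\<lambda>(u, v). {u, v}) e)" for e
  have fF: "f {u, v} = F (u, v)" if "(u, v) \<in> pairs" for u v
    using the_inv_into_f_f[OF bij_betw_imp_inj_on[OF bij_pairs] that] by (simp add: f_def)
  have finE: "finite E" using bij_betw_finite[OF bij_pairs] finite_pairs by simp
  have tot: "(\<Sum>i<n+1. load_at (es i) (z i) v) = card {e \<in> E. f e = v}" for v
  proof -
    have "(\<Sum>i<n+1. load_at (es i) (z i) v) = (\<Sum>i<n+1. card {uv \<in> set (es i). F uv = v})"
      using ldF by (intro sum.cong) auto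
    also have "\<dots> = card {uv \<in> pairs. F uv = v}" unfolding card_pairs_split ..
    also have "\<dots> = card {e \<in> E. f e = v}" by (rule card_pairs_edges) (rule fF)
    finally show ?thesis .
  qed
  define S where "S = f ` E"
  have fe: "f e \<in> e" if "e \<in> E" for e
    using edge_cases[OF that] fF Fin by (metis fst_conv insert_iff snd_conv)
  have SV: "S \<subseteq> {..<n}" using fe graph by (auto simp: S_def simple_graph_def)
  have pos: "0 < (\<Sum>i<n+1. load_at (es i) (z i) v)" if "v \<in> S" for v
  proof -
    have "{e \<in> E. f e = v} \<noteq> {}" using that by (auto simp: S_def)
    then show ?thesis unfolding tot using finE by (simp add: card_gt_0_iff)
  qed
  have capS: "card {e \<in> E. f e = v} \<le> c v" if "v \<in> S" for v
  proof (cases "v \<in> X")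
    case True
    then show ?thesis using ld tot[of v] by (auto simp: mask_cap_def split: if_splits)
  next
    case False
    have vn: "v < n" using that SV by auto
    have "(\<Sum>i<n+1. load_at (es i) (z i) v) = (\<Sum>i\<in>{lab v}. load_at (es i) (z i) v)"
      using lab_less[OF vn False] load_at_other_item[OF False] by (intro sum.mono_neutral_right) auto
    then show ?thesis using no_overload[of "lab v" v] lab_less[OF vn False] vn False tot[of v] by simp
  qed
  have "S - X \<subseteq> (\<Union>i\<in>{..<n+1}. {v. v < n \<and> v \<notin> X \<and> 0 < load_at (es i) (z i) v})"
  proof
    fix v assume v: "v \<in> S - X"
    then have "0 < (\<Sum>i<n+1. load_at (es i) (z i) v)" using pos by blast
    then have "\<exists>i<n+1. 0 < load_at (es i) (z i) v"
      by (metis (mono_tags, lifting) gr0I lessThan_iff less_irrefl sum.neutral)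
    then show "v \<in> (\<Union>i\<in>{..<n+1}. {v. v < n \<and> v \<notin> X \<and> 0 < load_at (es i) (z i) v})"
      using v SV by auto
  qed
  then have "card (S - X) \<le> card (\<Union>i\<in>{..<n+1}. {v. v < n \<and> v \<notin> X \<and> 0 < load_at (es i) (z i) v})"
    by (intro card_mono) auto
  also have "\<dots> \<le> (\<Sum>i<n+1. card {v. v < n \<and> v \<notin> X \<and> 0 < load_at (es i) (z i) v})"
    by (rule card_UN_le) simp
  also have "\<dots> \<le> (\<Sum>i<n+1. item_cost n X c (es i) (z i))"
    by (intro sum_mono) (simp add: item_cost_def)
  finally have c1: "card (S - X) \<le> (\<Sum>i<n+1. item_cost n X c (es i) (z i))" .
  have "S \<inter> X \<subseteq> mk"
  proof
    fix x assume x: "x \<in> S \<inter> X"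
    then have "0 < mask_cap mk c x" using pos[of x] ld by force
    then show "x \<in> mk" by (simp add: mask_cap_def split: if_splits)
  qed
  then have c2: "card (S \<inter> X) \<le> card mk" using mk finX finite_subset by (intro card_mono) auto
  have "card S = card (S - X) + card (S \<inter> X)"
    using finE by (subst card_Un_disjoint[symmetric]) (auto simp: S_def intro!: arg_cong[of _ _ card])
  then have "int (card S) \<le> k" using c1 c2 cst(2) by linarith
  then show ?thesis unfolding capacitated_vertex_cover_def
    using SV fe capS by (intro exI[of _ S] conjI exI[of _ f]) (auto simp: S_def)
qed

end

text \<open>Discarding the vertices of the cover that receive no edge keeps all conditions, so the
  cover can be taken to be the image of the assignment.\<close>

lemma cvc_iff:
  assumes "simple_graph V E"
  shows "capacitated_vertex_cover V E c k \<longleftrightarrow>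
    (\<exists>f. (\<forall>e\<in>E. f e \<in> e) \<and> (\<forall>v. card {e \<in> E. f e = v} \<le> c v) \<and> int (card (f ` E)) \<le> k)"
proof
  assume "capacitated_vertex_cover V E c k"
  then obtain S f where S: "S \<subseteq> V" "int (card S) \<le> k" "\<forall>e\<in>E. f e \<in> e \<inter> S"
    "\<forall>v\<in>S. card {e \<in> E. f e = v} \<le> c v" by (auto simp: capacitated_vertex_cover_def)
  have "finite S" using S(1) assms finite_subset by (auto simp: simple_graph_def)
  then have "card (f ` E) \<le> card S" using S(3) by (intro card_mono) auto
  moreover have "card {e \<in> E. f e = v} \<le> c v" for v
  proof (cases "v \<in> S")
    case False
    then have "{e \<in> E. f e = v} = {}" using S(3) by auto
    then show ?thesis by (metis card.empty le0)
  qed (use S in auto)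
  ultimately show "\<exists>f. (\<forall>e\<in>E. f e \<in> e) \<and> (\<forall>v. card {e \<in> E. f e = v} \<le> c v) \<and> int (card (f ` E)) \<le> k"
    using S(2,3) by (intro exI[of _ f]) auto
next
  assume "\<exists>f. (\<forall>e\<in>E. f e \<in> e) \<and> (\<forall>v. card {e \<in> E. f e = v} \<le> c v) \<and> int (card (f ` E)) \<le> k"
  then obtain f where f: "\<forall>e\<in>E. f e \<in> e" "\<forall>v. card {e \<in> E. f e = v} \<le> c v" "int (card (f ` E)) \<le> k" by auto
  then have "f ` E \<subseteq> V" using assms by (auto simp: simple_graph_def)
  then show "capacitated_vertex_cover V E c k"
    unfolding capacitated_vertex_cover_def using f by (intro exI[of _ "f ` E"] conjI exI[of _ f]) auto
qed

section \<open>Separators by branching\<close>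

text \<open>Connectedness through closed sets instead of paths: no proper nonempty part of
  \<open>C\<close> is closed under adjacency within \<open>C\<close>. Label classes are closed sets,
  which makes the comparison with them direct. The empty set counts as connected.\<close>

definition conn :: "'a set set \<Rightarrow> 'a set \<Rightarrow> bool" where
  "conn E C \<longleftrightarrow> (\<forall>K. (\<forall>a\<in>K \<inter> C. \<forall>b\<in>C. {a, b} \<in> E \<longrightarrow> b \<in> K) \<longrightarrow> C \<inter> K \<noteq> {} \<longrightarrow> C \<subseteq> K)"

text \<open>In contrast to vertex integrity, \<open>X\<close> and the connected sets avoiding it are
  bounded by \<open>p\<close> separately and not in sum; this weaker form is what branching can
  find. Bounding all connected sets avoids speaking of maximal ones.\<close>

definition separator :: "nat \<Rightarrow> nat set set \<Rightarrow> nat \<Rightarrow> nat set \<Rightarrow> bool" where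
  "separator n E p X \<longleftrightarrow> X \<subseteq> {..<n} \<and> card X \<le> p \<and> (\<forall>C. C \<subseteq> {..<n} - X \<longrightarrow> conn E C \<longrightarrow> card C \<le> p)"

lemma connD:
  "conn E C \<Longrightarrow> (\<And>a b. a \<in> K \<Longrightarrow> a \<in> C \<Longrightarrow> b \<in> C \<Longrightarrow> {a, b} \<in> E \<Longrightarrow> b \<in> K) \<Longrightarrow> x \<in> C \<Longrightarrow> x \<in> K \<Longrightarrow> C \<subseteq> K"
  unfolding conn_def by (metis IntE IntI empty_iff)

lemma conn_union:
  assumes "conn E A" "conn E B" "u \<in> A" "v \<in> B" "{u, v} \<in> E"
  shows "conn E (A \<union> B)"
  unfolding conn_def
proof (intro allI impI)
  fix K assume K: "\<forall>a\<in>K \<inter> (A \<union> B). \<forall>b\<in>A \<union> B. {a, b} \<in> E \<longrightarrow> b \<in> K" and ne: "(A \<union> B) \<inter> K \<noteq> {}"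
  have A: "A \<subseteq> K" if "x \<in> A" "x \<in> K" for x by (rule connD[OF assms(1) _ that]) (use K in auto)
  have B: "B \<subseteq> K" if "x \<in> B" "x \<in> K" for x by (rule connD[OF assms(2) _ that]) (use K in auto)
  have "{v, u} \<in> E" using assms(5) by (simp only: insert_commute)
  then have uv: "u \<in> K \<longleftrightarrow> v \<in> K" using K assms(3-5) by blast
  from ne obtain x where "x \<in> A \<and> x \<in> K \<or> x \<in> B \<and> x \<in> K" by auto
  then show "A \<union> B \<subseteq> K" using A B uv assms(3,4) by blast
qed

lemma vertex_integrity_witness:
  assumes "simple_graph V E"
  obtains X where "X \<subseteq> V" "card X \<le> vertex_integrity V E"
    "\<forall>D\<in>components (V - X) E. card D \<le> vertex_integrity V E - card X"
proof -
  have "\<exists>X\<subseteq>V. card X \<le> card V \<and> (\<forall>D\<in>components (V - X) E. card D \<le> card V - card X)"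
    by (intro exI[of _ V]) (simp add: components_def)
  from LeastI[of "\<lambda>p. \<exists>X\<subseteq>V. card X \<le> p \<and> (\<forall>D\<in>components (V - X) E. card D \<le> p - card X)", OF this]
  show thesis using that unfolding vertex_integrity_def by blast
qed

lemma finite_component:
  assumes "finite W" "D \<in> components W E"
  shows "finite D" "D \<noteq> {}"
proof -
  from assms(2) obtain v where v: "v \<in> W" "D = {u. (v, u) \<in> {(x, y). x \<in> W \<and> y \<in> W \<and> {x, y} \<in> E}\<^sup>*}"
    by (auto simp: components_def)
  have "u \<in> W" if "(v, u) \<in> {(x, y). x \<in> W \<and> y \<in> W \<and> {x, y} \<in> E}\<^sup>*" for u
    using that v(1) by (induction rule: rtrancl_induct) auto
  then have "D \<subseteq> W" unfolding v(2) by blast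
  from finite_subset[OF this assms(1)] show "finite D" .
  have "v \<in> D" unfolding v(2) by simp
  then show "D \<noteq> {}" by blast
qed

lemma vertex_integrity_pos:
  assumes "simple_graph V E" "V \<noteq> {}"
  shows "1 \<le> vertex_integrity V E"
proof (rule ccontr)
  assume "\<not> ?thesis"
  then have vi: "vertex_integrity V E = 0" by simp
  obtain X where X: "X \<subseteq> V" "card X \<le> 0" "\<forall>D\<in>components (V - X) E. card D \<le> 0"
    using vertex_integrity_witness[OF assms(1)] vi by (metis diff_le_self le_0_eq)
  have finV: "finite V" using assms by (simp add: simple_graph_def)
  then have "X = {}" using X finite_subset by fastforce
  moreover obtain D where "D \<in> components V E" using assms(2) by (auto simp: components_def)
  ultimately show False using X(3) finite_component[OF finV, of D] by auto
qed

text \<open>A connected set that avoids \<open>X\<close> lies in the component of any of its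
  vertices.\<close>

lemma ex_separator:
  assumes g: "simple_graph {..<n} E" and p: "vertex_integrity {..<n} E \<le> p"
  shows "\<exists>X. separator n E p X"
proof -
  obtain X where X: "X \<subseteq> {..<n}" "card X \<le> vertex_integrity {..<n} E"
    "\<forall>D\<in>components ({..<n} - X) E. card D \<le> vertex_integrity {..<n} E - card X"
    using vertex_integrity_witness[OF g] by blast
  have "card C \<le> p" if C: "C \<subseteq> {..<n} - X" "conn E C" for C
  proof (cases "C = {}")
    case False
    then obtain v where v: "v \<in> C" by auto
    define r where "r = {(x, y). x \<in> {..<n} - X \<and> y \<in> {..<n} - X \<and> {x, y} \<in> E}"
    define D where "D = {u. (v, u) \<in> r\<^sup>*}"
    have D: "D \<in> components ({..<n} - X) E" using v C unfolding components_def D_def r_def by blast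
    have "C \<subseteq> D"
    proof (rule connD[OF C(2) _ v])
      fix a b assume "a \<in> D" "a \<in> C" "b \<in> C" "{a, b} \<in> E"
      moreover from this have "(a, b) \<in> r" using C(1) by (auto simp: r_def)
      ultimately show "b \<in> D" unfolding D_def by (auto intro: rtrancl_into_rtrancl)
    qed (simp add: D_def)
    then have "card C \<le> card D" using finite_component[OF _ D] by (intro card_mono) auto
    then show ?thesis using X(3) D p by fastforce
  qed simp
  then show ?thesis using X p unfolding separator_def by (intro exI[of _ X]) auto
qed

text \<open>The state consists of the labels, a flag for a class with more than \<open>p\<close>
  vertices, and the label of that class. Merging stops at the first such class. As it arises from
  two classes of at most \<open>p\<close> vertices, it has at most \<open>2 * p\<close>, which
  bounds the branching.\<close>

definition merge :: "nat \<Rightarrow> nat \<Rightarrow> nat set set \<Rightarrow> nat set \<Rightarrow> nat \<times> nat \<Rightarrow>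
    (nat \<Rightarrow> nat) \<times> bool \<times> nat \<Rightarrow> (nat \<Rightarrow> nat) \<times> bool \<times> nat" where
  "merge n p E X uv st = (case (uv, st) of ((u, v), (lab, big, l)) \<Rightarrow>
     if \<not> big \<and> {u, v} \<in> E \<and> u \<notin> X \<and> v \<notin> X \<and> lab u \<noteq> lab v then
       let lab' = (\<lambda>w. if lab w = lab v then lab u else lab w) in
       if p < card {w. w < n \<and> lab' w = lab u} then (lab', True, lab u) else (lab', False, l)
     else st)"

definition labels :: "nat \<Rightarrow> nat \<Rightarrow> nat set set \<Rightarrow> nat set \<Rightarrow> (nat \<Rightarrow> nat) \<times> bool \<times> nat" where
  "labels n p E X = fold (merge n p E X) (pair_list n) ((\<lambda>v. if v \<in> X then n else v), False, 0)"

text \<open>\<open>S\<close> is the set of pairs processed so far. Agreement of labels along its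
  edges is claimed only while no class is too large, because merging stops then.\<close>

definition labels_inv :: "nat \<Rightarrow> nat \<Rightarrow> nat set set \<Rightarrow> nat set \<Rightarrow> (nat \<times> nat) set \<Rightarrow> (nat \<Rightarrow> nat) \<times> bool \<times> nat \<Rightarrow> bool" where
  "labels_inv n p E X S st \<longleftrightarrow> (case st of (lab, big, l) \<Rightarrow>
     (\<forall>v\<in>X. lab v = n) \<and> (\<forall>v<n. v \<notin> X \<longrightarrow> lab v < n) \<and>
     (\<forall>i<n. conn E {v. v < n \<and> lab v = i}) \<and>
     (\<not> big \<longrightarrow> (\<forall>i<n. card {v. v < n \<and> lab v = i} \<le> p) \<and>
       (\<forall>(u, v)\<in>S. {u, v} \<in> E \<longrightarrow> u \<notin> X \<longrightarrow> v \<notin> X \<longrightarrow> lab u = lab v)) \<and>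
     (big \<longrightarrow> l < n \<and> p < card {v. v < n \<and> lab v = l} \<and> card {v. v < n \<and> lab v = l} \<le> 2 * p))"

lemma labels_inv_merge:
  assumes inv: "labels_inv n p E X S st" and XV: "X \<subseteq> {..<n}" and uv: "u < n" "v < n"
  shows "labels_inv n p E X (insert (u, v) S) (merge n p E X (u, v) st)"
proof -
  obtain lab big l where st: "st = (lab, big, l)" by (cases st)
  show ?thesis
  proof (cases "\<not> big \<and> {u, v} \<in> E \<and> u \<notin> X \<and> v \<notin> X \<and> lab u \<noteq> lab v")
    case False
    then show ?thesis using inv unfolding st merge_def labels_inv_def by auto
  next
    case True
    define lab' where "lab' w = (if lab w = lab v then lab u else lab w)" for w
    have I: "\<forall>v\<in>X. lab v = n" "\<forall>v<n. v \<notin> X \<longrightarrow> lab v < n" "\<forall>i<n. conn E {v. v < n \<and> lab v = i}"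
      "\<forall>i<n. card {v. v < n \<and> lab v = i} \<le> p"
      "\<forall>(u, v)\<in>S. {u, v} \<in> E \<longrightarrow> u \<notin> X \<longrightarrow> v \<notin> X \<longrightarrow> lab u = lab v"
      using inv True unfolding st labels_inv_def by auto
    have lt: "lab u < n" "lab v < n" using I(2) True uv by auto
    have cls: "{w. w < n \<and> lab' w = i} = (if i = lab u then {w. w < n \<and> lab w = lab u} \<union> {w. w < n \<and> lab w = lab v}
        else if i = lab v then {} else {w. w < n \<and> lab w = i})" for i
      using True by (auto simp: lab'_def)
    have "conn E ({w. w < n \<and> lab w = lab u} \<union> {w. w < n \<and> lab w = lab v})"
      using I(3) lt uv True by (intro conn_union[of E _ _ u v]) auto
    then have c: "\<forall>i<n. conn E {w. w < n \<and> lab' w = i}"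
      using I(3) unfolding cls by (auto simp: conn_def)
    have "card {w. w < n \<and> lab' w = lab u} \<le> card {w. w < n \<and> lab w = lab u} + card {w. w < n \<and> lab w = lab v}"
      unfolding cls by (simp add: card_Un_le)
    also have "\<dots> \<le> p + p" using I(4) lt by (intro add_mono) auto
    finally have c2: "card {w. w < n \<and> lab' w = lab u} \<le> 2 * p" by simp
    have c3: "card {w. w < n \<and> lab' w = i} \<le> p" if "card {w. w < n \<and> lab' w = lab u} \<le> p" "i < n" for i
      using that I(4) unfolding cls by auto
    have lx: "\<forall>v\<in>X. lab' v = n" "\<forall>v<n. v \<notin> X \<longrightarrow> lab' v < n" using I(1,2) lt by (auto simp: lab'_def)
    have pr: "\<forall>(u, v)\<in>insert (u, v) S. {u, v} \<in> E \<longrightarrow> u \<notin> X \<longrightarrow> v \<notin> X \<longrightarrow> lab' u = lab' v"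
      using I(5) by (auto simp: lab'_def)
    have "merge n p E X (u, v) st = (if p < card {w. w < n \<and> lab' w = lab u} then (lab', True, lab u) else (lab', False, l))"
      using True unfolding st merge_def lab'_def[abs_def] Let_def by simp
    then show ?thesis using c c2 c3 lx pr lt unfolding labels_inv_def by auto
  qed
qed

lemma labels_inv_labels:
  assumes "X \<subseteq> {..<n}" "1 \<le> p"
  shows "labels_inv n p E X ({..<n} \<times> {..<n}) (labels n p E X)"
proof -
  have step: "labels_inv n p E X S st \<Longrightarrow> set xs \<subseteq> {..<n} \<times> {..<n} \<Longrightarrow>
    labels_inv n p E X (S \<union> set xs) (fold (merge n p E X) xs st)" for xs S st
  proof (induction xs arbitrary: S st)
    case (Cons uv xs)
    obtain u v where uv: "uv = (u, v)" by (cases uv)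
    have "labels_inv n p E X (insert (u, v) S) (merge n p E X (u, v) st)"
      using Cons.prems uv assms(1) by (intro labels_inv_merge) auto
    from Cons.IH[OF this] Cons.prems(2) show ?case by (simp add: uv)
  qed simp
  have "labels_inv n p E X {} ((\<lambda>v. if v \<in> X then n else v), False, 0)"
  proof -
    have "{v. v < n \<and> (if v \<in> X then n else v) = i} = (if i \<in> X then {} else {i})" if "i < n" for i
      using that by auto
    note cls = this
    have c1: "conn E {}" "conn E {i}" for i :: nat unfolding conn_def by blast+
    have "conn E {v. v < n \<and> (if v \<in> X then n else v) = i}" if "i < n" for i
      unfolding cls[OF that] using c1 by simp
    moreover have "card {v. v < n \<and> (if v \<in> X then n else v) = i} \<le> p" if "i < n" for i
      unfolding cls[OF that] using assms(2) by simp
    ultimately show ?thesis unfolding labels_inv_def prod.case by simp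
  qed
  from step[OF this, of "pair_list n"] show ?thesis by (simp add: labels_def)
qed

text \<open>A digit below \<open>2 * p\<close> is the rank of a vertex in the oversized class
  \<open>l\<close>; adding \<open>2 * p\<close> to it means that the vertex is also guessed to be in
  the cover. As the class has at most \<open>2 * p\<close> vertices, base \<open>4 * p\<close>
  suffices.\<close>

definition pick :: "nat \<Rightarrow> nat \<Rightarrow> (nat \<Rightarrow> nat) \<Rightarrow> nat \<Rightarrow> nat \<Rightarrow> nat set \<times> nat set \<Rightarrow> nat set \<times> nat set" where
  "pick n p lab l d XM = (
     fst XM \<union> {v. v < n \<and> lab v = l \<and> (card {w. w < v \<and> lab w = l} = d \<or> card {w. w < v \<and> lab w = l} + 2 * p = d)},
     snd XM \<union> {v. v < n \<and> lab v = l \<and> card {w. w < v \<and> lab w = l} + 2 * p = d})"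

definition search_step :: "nat \<Rightarrow> nat \<Rightarrow> nat set set \<Rightarrow> nat \<Rightarrow> nat set \<times> nat set \<Rightarrow> nat set \<times> nat set" where
  "search_step n p E d XM = (case labels n p E (fst XM) of (lab, big, l) \<Rightarrow>
     if big then pick n p lab l d XM else XM)"

definition search :: "nat \<Rightarrow> nat \<Rightarrow> nat set set \<Rightarrow> (nat \<Rightarrow> nat) \<Rightarrow> nat \<Rightarrow> nat set \<times> nat set" where
  "search n p E d m = fold (\<lambda>j. search_step n p E (d j)) [0..<m] ({}, {})"

definition oversized :: "nat \<Rightarrow> nat \<Rightarrow> nat set set \<Rightarrow> nat set \<Rightarrow> bool" where
  "oversized n p E X = fst (snd (labels n p E X))"

lemma search_Suc: "search n p E d (Suc m) = search_step n p E (d m) (search n p E d m)"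
  by (simp add: search_def)

lemma search_cong: "(\<And>j. j < m \<Longrightarrow> d j = d' j) \<Longrightarrow> search n p E d m = search n p E d' m"
  unfolding search_def by (rule fold_cong) auto

lemma rank_inj:
  fixes lab :: "nat \<Rightarrow> nat"
  assumes "lab v = l" "lab w = l" "card {x. x < v \<and> lab x = l} = card {x. x < w \<and> lab x = l}"
  shows "v = w"
proof -
  have less: "card {x. x < v \<and> lab x = l} < card {x. x < w \<and> lab x = l}" if "v < w" "lab v = l" for v w
  proof (rule psubset_card_mono)
    show "{x. x < v \<and> lab x = l} \<subset> {x. x < w \<and> lab x = l}" using that by auto
  qed simp
  show ?thesis using less[of v w] less[of w v] assms by (metis less_irrefl nat_neq_iff)
qed

lemma rank_less:
  fixes lab :: "nat \<Rightarrow> nat"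
  assumes "lab v = l" "v < n"
  shows "card {x. x < v \<and> lab x = l} < card {x. x < n \<and> lab x = l}"
proof (rule psubset_card_mono)
  show "{x. x < v \<and> lab x = l} \<subset> {x. x < n \<and> lab x = l}" using assms by auto
qed simp

lemma search_step_bounds:
  assumes X: "X \<subseteq> {..<n}" and p: "1 \<le> p" and s: "search_step n p E d (X, mk) = (X', mk')" and mk: "mk \<subseteq> X"
  shows "X' \<subseteq> {..<n}" "mk' \<subseteq> X'" "card X' \<le> Suc (card X)"
proof -
  obtain lab big l where l: "labels n p E X = (lab, big, l)" by (metis prod_cases3)
  have inv: "labels_inv n p E X ({..<n} \<times> {..<n}) (lab, big, l)"
    using labels_inv_labels[OF X p, of E] l by simp
  define N where "N = {v. v < n \<and> lab v = l \<and> (card {w. w < v \<and> lab w = l} = d \<or> card {w. w < v \<and> lab w = l} + 2 * p = d)}"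
  have X': "X' = (if big then X \<union> N else X)" "mk' \<subseteq> X'"
    using s l mk by (auto simp: search_step_def pick_def N_def split: if_splits)
  then show "X' \<subseteq> {..<n}" "mk' \<subseteq> X'" using X by (auto simp: N_def)
  have "card N \<le> 1" if big
  proof -
    have c2: "card {v. v < n \<and> lab v = l} \<le> 2 * p" using inv that by (simp add: labels_inv_def)
    \<comment> \<open>All ranks are below \<open>2 * p\<close>, so the two ways to match
      \<open>d\<close> exclude each other and \<open>d\<close> determines the rank.\<close>
    have eq: "v = w" if "v \<in> N" "w \<in> N" for v w
    proof (rule rank_inj[of lab v l w])
      show "lab v = l" "lab w = l" using that by (auto simp: N_def)
      have "card {x. x < v \<and> lab x = l} < 2 * p" "card {x. x < w \<and> lab x = l} < 2 * p"
        using that rank_less[of lab v l n] rank_less[of lab w l n] c2 by (auto simp: N_def)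
      then show "card {x. x < v \<and> lab x = l} = card {x. x < w \<and> lab x = l}"
        using that by (auto simp: N_def)
    qed
    have "finite N" by (simp add: N_def)
    from card_le_Suc0_iff_eq[OF this] show ?thesis using eq unfolding One_nat_def by blast
  qed
  then show "card X' \<le> Suc (card X)"
    using X'(1) card_Un_le[of X N] by (auto split: if_splits)
qed

lemma search_bounds:
  assumes "1 \<le> p"
  shows "fst (search n p E d m) \<subseteq> {..<n} \<and> snd (search n p E d m) \<subseteq> fst (search n p E d m)
    \<and> card (fst (search n p E d m)) \<le> m"
proof (induction m)
  case 0
  show ?case by (simp add: search_def)
next
  case (Suc m)
  obtain X mk where XM: "search n p E d m = (X, mk)" by (cases "search n p E d m")
  obtain X' mk' where XM': "search_step n p E (d m) (X, mk) = (X', mk')" by (cases "search_step n p E (d m) (X, mk)")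
  show ?case using Suc search_step_bounds[OF _ assms XM'] by (auto simp: search_Suc XM XM')
qed

text \<open>If merging was never stopped, labels agree along all edges outside \<open>X\<close>, so
  a connected set avoiding \<open>X\<close> stays within one class, and all classes are
  small.\<close>

lemma separator_if_not_oversized:
  assumes X: "X \<subseteq> {..<n}" and p: "1 \<le> p" and c: "card X \<le> p" and s: "\<not> oversized n p E X"
  shows "separator n E p X"
  unfolding separator_def
proof (intro conjI allI impI X c)
  fix C assume C: "C \<subseteq> {..<n} - X" "conn E C"
  obtain lab l where l: "labels n p E X = (lab, False, l)" using s by (cases "labels n p E X") (auto simp: oversized_def)
  have inv: "labels_inv n p E X ({..<n} \<times> {..<n}) (lab, False, l)"
    using labels_inv_labels[OF X p, of E] l by simp
  show "card C \<le> p"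
  proof (cases "C = {}")
    case False
    then obtain v where v: "v \<in> C" by auto
    have "C \<subseteq> {w. lab w = lab v}"
    proof (rule connD[OF C(2) _ v])
      fix a b assume ab: "a \<in> {w. lab w = lab v}" "a \<in> C" "b \<in> C" "{a, b} \<in> E"
      then have "(a, b) \<in> {..<n} \<times> {..<n}" "a \<notin> X" "b \<notin> X" using C(1) by auto
      then show "b \<in> {w. lab w = lab v}" using inv ab unfolding labels_inv_def by fastforce
    qed simp
    then have "C \<subseteq> {w. w < n \<and> lab w = lab v}" using C(1) by auto
    then have "card C \<le> card {w. w < n \<and> lab w = lab v}" by (intro card_mono) auto
    also have "\<dots> \<le> p" using inv C(1) v by (auto simp: labels_inv_def)
    finally show ?thesis .
  qed simp
qed

lemma separation_if_not_oversized:
  assumes g: "simple_graph {..<n} E" and X: "X \<subseteq> {..<n}" and p: "1 \<le> p" and c: "card X \<le> p"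
    and l: "labels n p E X = (lab, False, l)"
  shows "separation n E X lab p"
proof
  have inv: "labels_inv n p E X ({..<n} \<times> {..<n}) (lab, False, l)"
    using labels_inv_labels[OF X p, of E] l by simp
  show "lab v = n" if "v \<in> X" for v using inv that by (simp add: labels_inv_def)
  show "lab v < n" if "v < n" "v \<notin> X" for v using inv that by (simp add: labels_inv_def)
  show "lab u = lab v" if "{u, v} \<in> E" "u \<notin> X" "v \<notin> X" for u v
  proof -
    have "{u, v} \<subseteq> {..<n}" using g that(1) by (auto simp: simple_graph_def)
    then have "(u, v) \<in> {..<n} \<times> {..<n}" by auto
    then show ?thesis using inv that unfolding labels_inv_def by fastforce
  qed
  show "card {v. v < n \<and> lab v = i} \<le> p" for i
  proof (cases "i < n")
    case True
    then show ?thesis using inv by (simp add: labels_inv_def)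
  next
    case False
    then have "{v. v < n \<and> lab v = i} \<subseteq> X" using inv by (auto simp: labels_inv_def)
    then have "card {v. v < n \<and> lab v = i} \<le> card X" using finite_subset[OF X] by (intro card_mono) auto
    then show ?thesis using c by simp
  qed
qed fact+

text \<open>The digits always pick a vertex of \<open>Y\<close> in the oversized class, which exists
  because the class is connected, and record whether it lies in \<open>S\<close>. As long as a class
  is oversized, each step adds a new vertex of \<open>Y\<close>; after \<open>p\<close> such steps
  \<open>X\<close> equals \<open>Y\<close>, and then no class can be oversized. \<open>S\<close> is
  arbitrary, so that any cover can be recorded.\<close>

lemma search_complete:
  assumes sep: "separator n E p Y" and p: "1 \<le> p"
  shows "\<exists>d. (\<forall>j. d j < 4 * p) \<and> \<not> oversized n p E (fst (search n p E d p)) \<and>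
    snd (search n p E d p) = fst (search n p E d p) \<inter> S"
proof -
  have finY: "finite Y" using sep finite_subset[of Y "{..<n}"] by (simp add: separator_def)
  have hit: "\<exists>v\<in>Y. v < n \<and> lab v = l" if "X \<subseteq> {..<n}" "labels n p E X = (lab, True, l)" for X lab l
  proof (rule ccontr)
    assume no: "\<not> ?thesis"
    have "labels_inv n p E X ({..<n} \<times> {..<n}) (lab, True, l)"
      using labels_inv_labels[OF that(1) p, of E] that(2) by simp
    then have c: "conn E {v. v < n \<and> lab v = l}" "p < card {v. v < n \<and> lab v = l}"
      unfolding labels_inv_def prod.case by simp_all
    moreover have "{v. v < n \<and> lab v = l} \<subseteq> {..<n} - Y" using no by auto
    moreover have "\<And>C. C \<subseteq> {..<n} - Y \<Longrightarrow> conn E C \<Longrightarrow> card C \<le> p"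
      using sep unfolding separator_def by simp
    ultimately have "card {v. v < n \<and> lab v = l} \<le> p" by simp
    then show False using c(2) by simp
  qed
  have "\<exists>d. (\<forall>j. d j < 4 * p) \<and> fst (search n p E d m) \<subseteq> Y \<and> snd (search n p E d m) = fst (search n p E d m) \<inter> S \<and>
    (card (fst (search n p E d m)) = m \<or> \<not> oversized n p E (fst (search n p E d m)))" for m
  proof (induction m)
    case 0
    show ?case using p by (intro exI[of _ "\<lambda>_. 0"]) (simp add: search_def)
  next
    case (Suc m)
    then obtain d where d: "\<forall>j. d j < 4 * p" "fst (search n p E d m) \<subseteq> Y"
      "snd (search n p E d m) = fst (search n p E d m) \<inter> S"
      "card (fst (search n p E d m)) = m \<or> \<not> oversized n p E (fst (search n p E d m))" by blast
    obtain X mk where XM: "search n p E d m = (X, mk)" by (cases "search n p E d m")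
    obtain lab big l where l: "labels n p E X = (lab, big, l)" by (metis prod_cases3)
    have Xn: "X \<subseteq> {..<n}" using search_bounds[OF p, of n E d m] XM by simp
    show ?case
    proof (cases big)
      case False
      then show ?thesis using d l XM
        by (intro exI[of _ d]) (simp add: search_Suc search_step_def oversized_def)
    next
      case True
      have inv: "labels_inv n p E X ({..<n} \<times> {..<n}) (lab, big, l)"
        using labels_inv_labels[OF Xn p, of E] l by simp
      from hit[OF Xn] l True obtain v where v: "v \<in> Y" "v < n" "lab v = l" by auto
      define r where "r = card {w. w < v \<and> lab w = l}"
      have r: "r < 2 * p" using rank_less[of lab v l n] v inv True by (auto simp: labels_inv_def r_def)
      define d' where "d' = d(m := if v \<in> S then r + 2 * p else r)"
      have sd': "search n p E d' m = (X, mk)" using search_cong[of m d' d n p E] XM by (simp add: d'_def)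
      have dm: "d' m = (if v \<in> S then r + 2 * p else r)" by (simp add: d'_def)
      have c2: "card {v. v < n \<and> lab v = l} \<le> 2 * p" using inv True unfolding labels_inv_def prod.case by simp
      have iff: "w < n \<and> lab w = l \<and> card {x. x < w \<and> lab x = l} = r \<longleftrightarrow> w = v" for w
        using rank_inj[of lab w l v] v unfolding r_def by blast
      have rl: "card {x. x < w \<and> lab x = l} < 2 * p" if "w < n" "lab w = l" for w
        using rank_less[of lab w l n] that c2 by simp
      have new_set: "{w. w < n \<and> lab w = l \<and> (card {x. x < w \<and> lab x = l} = d' m \<or> card {x. x < w \<and> lab x = l} + 2 * p = d' m)} = {v}"
      proof (intro set_eqI)
        fix w
        have "card {x. x < w \<and> lab x = l} = d' m \<or> card {x. x < w \<and> lab x = l} + 2 * p = d' m \<longleftrightarrow>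
          card {x. x < w \<and> lab x = l} = r" if "w < n" "lab w = l"
          using rl[OF that] r unfolding dm by (cases "v \<in> S") simp_all
        then show "w \<in> {w. w < n \<and> lab w = l \<and> (card {x. x < w \<and> lab x = l} = d' m \<or> card {x. x < w \<and> lab x = l} + 2 * p = d' m)} \<longleftrightarrow> w \<in> {v}"
          using iff[of w] by blast
      qed
      have new_mask: "{w. w < n \<and> lab w = l \<and> card {x. x < w \<and> lab x = l} + 2 * p = d' m} = {v} \<inter> S"
      proof (intro set_eqI)
        fix w
        have "card {x. x < w \<and> lab x = l} + 2 * p = d' m \<longleftrightarrow>
          card {x. x < w \<and> lab x = l} = r \<and> v \<in> S" if "w < n" "lab w = l"
          using rl[OF that] r unfolding dm by (cases "v \<in> S") simp_all
        then show "w \<in> {w. w < n \<and> lab w = l \<and> card {x. x < w \<and> lab x = l} + 2 * p = d' m} \<longleftrightarrow> w \<in> {v} \<inter> S"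
          using iff[of w] by blast
      qed
      have s: "search n p E d' (Suc m) = (insert v X, mk \<union> ({v} \<inter> S))"
        using True l by (simp add: search_Suc sd' search_step_def pick_def new_set new_mask)
      have "v \<notin> X" using inv True v by (auto simp: labels_inv_def)
      moreover have "card X = m" using d(4) XM l True by (simp add: oversized_def)
      moreover have "finite X" using finite_subset[OF Xn] by simp
      ultimately have "card (insert v X) = Suc m" by simp
      moreover have "\<forall>j. d' j < 4 * p" using d(1) r by (simp add: d'_def)
      moreover have "insert v X \<subseteq> Y" "mk \<union> ({v} \<inter> S) = insert v X \<inter> S" using d(2,3) XM v by auto
      ultimately show ?thesis unfolding s[symmetric] by (intro exI[of _ d']) (simp add: s)
    qed
  qed
  from this[of p] obtain d where d: "\<forall>j. d j < 4 * p" "fst (search n p E d p) \<subseteq> Y"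
    "snd (search n p E d p) = fst (search n p E d p) \<inter> S"
    "card (fst (search n p E d p)) = p \<or> \<not> oversized n p E (fst (search n p E d p))" by blast
  have "\<not> oversized n p E (fst (search n p E d p))"
  proof
    assume o: "oversized n p E (fst (search n p E d p))"
    then have "card (fst (search n p E d p)) = p" using d by simp
    then have Y: "fst (search n p E d p) = Y"
      using d(2) sep finY card_subset_eq[OF finY d(2)] card_mono[OF finY d(2)] by (simp add: separator_def)
    obtain lab l where l: "labels n p E Y = (lab, True, l)"
      using o unfolding Y by (cases "labels n p E Y") (auto simp: oversized_def)
    have YV: "Y \<subseteq> {..<n}" using sep by (simp add: separator_def)
    from hit[OF YV l] obtain v where v: "v \<in> Y" "lab v = l" by auto
    have "labels_inv n p E Y ({..<n} \<times> {..<n}) (lab, True, l)"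
      using labels_inv_labels[OF YV p, of E] l by simp
    then show False using v by (auto simp: labels_inv_def)
  qed
  with d show ?thesis by blast
qed

section \<open>Dynamic programming over the items\<close>

text \<open>There are \<open>N\<close> items with \<open>A\<close> options each;
  \<open>u i a x\<close> is the load that option \<open>a\<close> of item \<open>i\<close> puts on
  \<open>x\<close>, and \<open>w i a\<close> is its cost.\<close>

locale choice_dp =
  fixes N A p :: nat and X :: "nat set" and u :: "nat \<Rightarrow> nat \<Rightarrow> nat \<Rightarrow> nat"
    and w :: "nat \<Rightarrow> nat \<Rightarrow> nat" and cap :: "nat \<Rightarrow> nat"
  assumes finX: "finite X" and cardX: "card X \<le> p" and p1: "1 \<le> p"
    and u_le: "\<And>i a x. i < N \<Longrightarrow> a < A \<Longrightarrow> x \<in> X \<Longrightarrow> u i a x \<le> p"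
begin

text \<open>The bound of \<open>exists_small_improvement\<close> with both \<open>q\<close> and
  \<open>card X\<close> replaced by \<open>p\<close>.\<close>

definition L :: int where "L = (4 * int p * int p + 1) ^ p"
text \<open>Two changes of at most \<open>2 * (L + 2)\<close> and \<open>L\<close> items have to be
  distinguished by their codes. Their load changes differ by at most \<open>p * (3 * L + 4)\<close>
  in each coordinate, which is at most \<open>B - 1\<close>.\<close>

definition B :: int where "B = 4 * int p * (L + 2) + 1"
text \<open>Larger than the absolute value of every number with at most \<open>p\<close> digits of
  absolute value below \<open>B\<close>.\<close>

definition Q :: int where "Q = B ^ p"
text \<open>An index is the start \<open>Q\<close>, plus \<open>Q\<close> for each of at most
  \<open>L\<close> changes, plus a code less than \<open>Q\<close> in absolute value.\<close>

definition T :: int where "T = (L + 2) * Q"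

text \<open>The exponent is the rank of \<open>x\<close> within \<open>X\<close> and not
  \<open>x\<close> itself; this keeps the codes below \<open>B ^ p\<close> independently of
  \<open>n\<close>.\<close>

definition pw :: "nat \<Rightarrow> int" where
  "pw x = (if x \<in> X then B ^ card (X \<inter> {..<x}) else 0)"

definition code :: "nat \<Rightarrow> nat \<Rightarrow> int" where
  "code i a = (\<Sum>x\<in>X. int (u i a x) * pw x)"

text \<open>Adding \<open>Q\<close> makes every shift positive, so that the final index bounds the
  number of steps taken.\<close>

definition sh :: "(nat \<Rightarrow> nat) \<Rightarrow> nat \<Rightarrow> nat \<Rightarrow> int" where
  "sh z i a = Q + code i a - code i (z i)"

definition wd :: "(nat \<Rightarrow> nat) \<Rightarrow> nat \<Rightarrow> nat \<Rightarrow> int" where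
  "wd z i a = int (w i a) - int (w i (z i))"

definition feasible :: "(nat \<Rightarrow> nat) \<Rightarrow> bool" where
  "feasible z \<longleftrightarrow> (\<forall>i<N. z i < A) \<and> (\<forall>x\<in>X. (\<Sum>i<N. u i (z i) x) \<le> cap x)"

definition cost :: "(nat \<Rightarrow> nat) \<Rightarrow> nat" where
  "cost z = (\<Sum>i<N. w i (z i))"

definition optimal :: "(nat \<Rightarrow> nat) \<Rightarrow> bool" where
  "optimal z \<longleftrightarrow> (\<forall>y. feasible y \<longrightarrow> cost z \<le> cost y)"

lemma one_le_L: "1 \<le> L" unfolding L_def by (simp add: one_le_power)

lemma one_le_pL: "1 \<le> int p * L"
  using mult_mono[of 1 "int p" 1 L] p1 one_le_L by simp

text \<open>The last three bounds serve \<open>sh_ge\<close>, \<open>table_complete\<close> and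
  \<open>table_finds_improvement\<close>, in this order.\<close>

lemma B_bounds: "1 < B" "2 * int p \<le> B - 1" "int p * L \<le> B - 1" "int p * (2 * (L + 2) + L) \<le> B - 1"
proof -
  have e: "B - 1 = 4 * (int p * L) + 8 * int p" by (simp add: B_def algebra_simps)
  show "1 < B" "2 * int p \<le> B - 1" "int p * L \<le> B - 1"
    using e one_le_pL p1 by linarith+
  have "int p * (2 * (L + 2) + L) = 3 * (int p * L) + 4 * int p" by (simp add: algebra_simps)
  then show "int p * (2 * (L + 2) + L) \<le> B - 1" using e one_le_pL p1 by linarith
qed

lemma Q_pos: "0 < Q" unfolding Q_def using B_bounds(1) by simp

lemma pw_nonneg: "0 \<le> pw x" unfolding pw_def using B_bounds(1) by simp

lemma sum_digits: "(\<Sum>x\<in>X \<inter> {..<m}. (B - 1) * pw x) = B ^ card (X \<inter> {..<m}) - 1"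
proof (induction m)
  case (Suc m)
  have fin: "finite (X \<inter> {..<m})" by simp
  show ?case
  proof (cases "m \<in> X")
    case True
    then have "X \<inter> {..<Suc m} = insert m (X \<inter> {..<m})" by auto
    then show ?thesis using Suc True fin by (simp add: pw_def algebra_simps)
  next
    case False
    then have "X \<inter> {..<Suc m} = X \<inter> {..<m}" by (auto simp: less_Suc_eq)
    then show ?thesis using Suc by simp
  qed
qed simp

text \<open>The factor \<open>c\<close> allows a bound by half of the range, needed with
  \<open>c = 2\<close> for \<open>sh_ge\<close>.\<close>

lemma digits_less:
  assumes "\<And>x. x \<in> X \<Longrightarrow> c * \<bar>d x\<bar> \<le> B - 1" "0 \<le> c"
  shows "c * \<bar>\<Sum>x\<in>X \<inter> {..<m}. d x * pw x\<bar> \<le> B ^ card (X \<inter> {..<m}) - 1"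
proof -
  have "c * \<bar>\<Sum>x\<in>X \<inter> {..<m}. d x * pw x\<bar> \<le> c * (\<Sum>x\<in>X \<inter> {..<m}. \<bar>d x * pw x\<bar>)"
    using assms(2) by (intro mult_left_mono sum_abs)
  also have "\<dots> = (\<Sum>x\<in>X \<inter> {..<m}. c * \<bar>d x\<bar> * pw x)"
    using pw_nonneg by (simp add: sum_distrib_left abs_mult mult.assoc)
  also have "\<dots> \<le> (\<Sum>x\<in>X \<inter> {..<m}. (B - 1) * pw x)"
    using assms(1) pw_nonneg by (intro sum_mono mult_right_mono) auto
  finally show ?thesis by (simp add: sum_digits)
qed

lemma X_bounded: obtains m where "X \<inter> {..<m} = X"
proof -
  have "X \<subseteq> {..<Suc (Max X)}" using finX by (auto simp: less_Suc_eq_le)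
  then show thesis using that by blast
qed

lemma code_less:
  assumes "\<And>x. x \<in> X \<Longrightarrow> c * \<bar>d x\<bar> \<le> B - 1" "0 \<le> c"
  shows "c * \<bar>\<Sum>x\<in>X. d x * pw x\<bar> < Q"
proof -
  obtain m where m: "X \<inter> {..<m} = X" by (rule X_bounded)
  have "B ^ card X \<le> Q" unfolding Q_def using B_bounds(1) cardX by (intro power_increasing) auto
  with digits_less[of c d m, OF assms] m show ?thesis by simp
qed

text \<open>A leading nonzero digit outweighs all lower digits, which may have either sign. The
  multiple of \<open>Q\<close> accounts for changes of different size; it vanishes because the code
  is smaller than \<open>Q\<close>.\<close>

lemma code_inj:
  assumes d: "\<And>x. x \<in> X \<Longrightarrow> \<bar>d x\<bar> \<le> B - 1" and eq: "(\<Sum>x\<in>X. d x * pw x) = r * Q"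
  shows "\<forall>x\<in>X. d x = 0"
proof -
  have "\<bar>r * Q\<bar> < 1 * Q" using code_less[of 1 d] d eq by simp
  then have "r = 0" using Q_pos by (simp add: abs_mult)
  then have zero: "(\<Sum>x\<in>X. d x * pw x) = 0" using eq by simp
  have "(\<Sum>x\<in>X \<inter> {..<m}. d x * pw x) = 0 \<Longrightarrow> \<forall>x\<in>X \<inter> {..<m}. d x = 0" for m
  proof (induction m)
    case (Suc m)
    show ?case
    proof (cases "m \<in> X")
      case True
      then have ins: "X \<inter> {..<Suc m} = insert m (X \<inter> {..<m})" by auto
      define c where "c = card (X \<inter> {..<m})"
      have s: "d m * B ^ c + (\<Sum>x\<in>X \<inter> {..<m}. d x * pw x) = 0"
        using Suc.prems ins True by (simp add: pw_def c_def)
      have l: "\<bar>\<Sum>x\<in>X \<inter> {..<m}. d x * pw x\<bar> \<le> B ^ c - 1"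
        using digits_less[of 1 d m] d by (simp add: c_def)
      have "d m = 0"
      proof (rule ccontr)
        assume "d m \<noteq> 0"
        then have "1 * B ^ c \<le> \<bar>d m\<bar> * B ^ c" using B_bounds(1) by (intro mult_right_mono) auto
        then have "B ^ c \<le> \<bar>d m * B ^ c\<bar>" using B_bounds(1) by (simp add: abs_mult)
        then show False using s l by linarith
      qed
      then show ?thesis using s Suc.IH ins by auto
    next
      case False
      then have "X \<inter> {..<Suc m} = X \<inter> {..<m}" by (auto simp: less_Suc_eq)
      then show ?thesis using Suc by simp
    qed
  qed simp
  moreover obtain m where "X \<inter> {..<m} = X" by (rule X_bounded)
  ultimately show ?thesis using zero by metis
qed

text \<open>This limits the steps of a path through the table: an index below \<open>T\<close>
  leaves room for fewer than \<open>2 * (L + 2)\<close> shifts of more than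
  \<open>Q / 2\<close>.\<close>

lemma sh_ge:
  assumes "i < N" "a < A" "z i < A"
  shows "Q < 2 * sh z i a"
proof -
  have "code i a - code i (z i) = (\<Sum>x\<in>X. (int (u i a x) - int (u i (z i) x)) * pw x)"
    by (simp add: code_def sum_subtractf left_diff_distrib)
  moreover have "2 * \<bar>int (u i a x) - int (u i (z i) x)\<bar> \<le> B - 1" if "x \<in> X" for x
  proof -
    have "int (u i a x) \<le> int p" "int (u i (z i) x) \<le> int p"
      using u_le[OF assms(1,2) that] u_le[OF assms(1,3) that] by auto
    then have "\<bar>int (u i a x) - int (u i (z i) x)\<bar> \<le> int p" by linarith
    from mult_left_mono[OF this, of 2] show ?thesis using B_bounds(2) by simp
  qed
  ultimately have "2 * \<bar>code i a - code i (z i)\<bar> < Q"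
    using code_less[of 2 "\<lambda>x. int (u i a x) - int (u i (z i) x)"] by simp
  moreover have "2 * - (code i a - code i (z i)) \<le> 2 * \<bar>code i a - code i (z i)\<bar>"
    by (intro mult_left_mono abs_ge_minus_self) simp
  ultimately have "2 * - (code i a - code i (z i)) < Q" by (rule le_less_trans[rotated])
  then show ?thesis by (simp add: sh_def algebra_simps)
qed

lemma sum_sh:
  "(\<Sum>i\<in>J. sh z i (y i)) = int (card J) * Q + (\<Sum>x\<in>X. (\<Sum>i\<in>J. int (u i (y i) x) - int (u i (z i) x)) * pw x)"
proof -
  have "(\<Sum>i\<in>J. sh z i (y i)) = int (card J) * Q + (\<Sum>i\<in>J. code i (y i) - code i (z i))"
    by (simp add: sh_def sum.distrib sum_subtractf)
  also have "(\<Sum>i\<in>J. code i (y i) - code i (z i))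
    = (\<Sum>i\<in>J. \<Sum>x\<in>X. (int (u i (y i) x) - int (u i (z i) x)) * pw x)"
    by (simp add: code_def sum_subtractf left_diff_distrib)
  also have "\<dots> = (\<Sum>x\<in>X. \<Sum>i\<in>J. (int (u i (y i) x) - int (u i (z i) x)) * pw x)"
    by (rule sum.swap)
  finally show ?thesis by (simp add: sum_distrib_right)
qed

lemma sum_diff_le:
  assumes "J \<subseteq> {..<N}" "\<And>i. i \<in> J \<Longrightarrow> y i < A" "\<And>i. i < N \<Longrightarrow> z i < A" "x \<in> X"
  shows "\<bar>\<Sum>i\<in>J. int (u i (y i) x) - int (u i (z i) x)\<bar> \<le> int p * int (card J)"
proof -
  have "\<bar>\<Sum>i\<in>J. int (u i (y i) x) - int (u i (z i) x)\<bar>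
    \<le> (\<Sum>i\<in>J. \<bar>int (u i (y i) x) - int (u i (z i) x)\<bar>)" by (rule sum_abs)
  also have "\<dots> \<le> (\<Sum>i\<in>J. int p)"
  proof (intro sum_mono)
    fix i assume "i \<in> J"
    then have "i < N" "y i < A" "z i < A" using assms by auto
    then show "\<bar>int (u i (y i) x) - int (u i (z i) x)\<bar> \<le> int p"
      using of_nat_mono[where 'a = int, OF u_le[of i "y i" x]]
        of_nat_mono[where 'a = int, OF u_le[of i "z i" x]] assms(4) by linarith
  qed
  finally show ?thesis by (simp add: mult.commute)
qed

text \<open>The load change of \<open>J\<close> lies between no change and the full change from
  \<open>z\<close> to \<open>y\<close>, so the new load is at most the larger of the loads of
  \<open>z\<close> and \<open>y\<close>, both within the capacity.\<close>

lemma small_improving_set: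
  assumes z: "feasible z" and y: "feasible y" "cost y < cost z"
  obtains J where "J \<subseteq> {..<N}" "int (card J) \<le> L" "(\<Sum>i\<in>J. wd z i (y i)) < 0"
    "\<And>x. x \<in> X \<Longrightarrow> (\<Sum>i<N. int (u i (z i) x)) + (\<Sum>i\<in>J. int (u i (y i) x) - int (u i (z i) x)) \<le> int (cap x)"
proof -
  have bd: "\<bar>int (u i (y i) x) - int (u i (z i) x)\<bar> \<le> int p" if "i \<in> {..<N}" "x \<in> X" for i x
    using sum_diff_le[of "{i}" y z x] that z y(1) unfolding feasible_def by simp
  have neg: "(\<Sum>i<N. wd z i (y i)) < 0"
    using y(2) by (simp add: wd_def sum_subtractf cost_def flip: of_nat_sum)
  have "\<exists>J\<subseteq>{..<N}. card J \<le> (4 * p * card X + 1) ^ card X \<and> (\<Sum>i\<in>J. wd z i (y i)) < 0 \<and>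
    (\<forall>x\<in>X. min 0 (\<Sum>i<N. int (u i (y i) x) - int (u i (z i) x))
        \<le> (\<Sum>i\<in>J. int (u i (y i) x) - int (u i (z i) x)) \<and>
      (\<Sum>i\<in>J. int (u i (y i) x) - int (u i (z i) x))
        \<le> max 0 (\<Sum>i<N. int (u i (y i) x) - int (u i (z i) x)))"
    by (rule exists_small_improvement[OF finite_lessThan finX _ neg]) (rule bd)
  then obtain J where J: "J \<subseteq> {..<N}"
    "card J \<le> (4 * p * card X + 1) ^ card X" "(\<Sum>i\<in>J. wd z i (y i)) < 0"
    and bnds: "\<forall>x\<in>X. min 0 (\<Sum>i<N. int (u i (y i) x) - int (u i (z i) x))
        \<le> (\<Sum>i\<in>J. int (u i (y i) x) - int (u i (z i) x)) \<and>
      (\<Sum>i\<in>J. int (u i (y i) x) - int (u i (z i) x))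
        \<le> max 0 (\<Sum>i<N. int (u i (y i) x) - int (u i (z i) x))"
    by (elim exE conjE)
  have "(4 * p * card X + 1) ^ card X \<le> (4 * p * p + 1) ^ card X"
    using cardX by (intro power_mono) auto
  also have "\<dots> \<le> (4 * p * p + 1) ^ p" using cardX by (intro power_increasing) auto
  finally have "card J \<le> (4 * p * p + 1) ^ p" using J(2) by simp
  then have "int (card J) \<le> int ((4 * p * p + 1) ^ p)" by (simp only: of_nat_le_iff)
  also have "int ((4 * p * p + 1) ^ p) = L" by (simp add: L_def add.commute)
  finally have cJ: "int (card J) \<le> L" .
  show thesis
  proof (rule that[OF J(1) cJ J(3)])
    fix x assume x: "x \<in> X"
    have "(\<Sum>i<N. int (u i (z i) x)) \<le> int (cap x)" "(\<Sum>i<N. int (u i (y i) x)) \<le> int (cap x)"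
      using z y(1) x by (simp_all add: feasible_def flip: of_nat_sum)
    then show "(\<Sum>i<N. int (u i (z i) x)) + (\<Sum>i\<in>J. int (u i (y i) x) - int (u i (z i) x)) \<le> int (cap x)"
      using bspec[OF bnds x] unfolding sum_subtractf by linarith
  qed
qed

text \<open>
  Row \<open>i\<close> of the table \<open>D\<close> holds, for every index, the least cost of changing the choices of the
  first \<open>i\<close> items of \<open>z\<close> with that index as total shift; \<open>CH\<close> and \<open>PJ\<close> are the back pointers. The
  start value \<open>big\<close> only has to exceed every possible gain.
\<close>

definition table :: "(nat \<Rightarrow> nat) \<Rightarrow> int \<Rightarrow> (nat \<Rightarrow> int \<Rightarrow> int) \<Rightarrow> (nat \<Rightarrow> int \<Rightarrow> int) \<Rightarrow> (nat \<Rightarrow> int \<Rightarrow> int) \<Rightarrow> nat \<Rightarrow> bool"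
  where "table z big D CH PJ m \<longleftrightarrow>
    (\<forall>j. 0 \<le> j \<and> j < T \<longrightarrow> D 0 j = (if j = Q then 0 else big)) \<and>
    (\<forall>i j. i < m \<and> 0 \<le> j \<and> j < T \<longrightarrow>
      0 \<le> PJ (Suc i) j \<and> PJ (Suc i) j < T \<and> 0 \<le> CH (Suc i) j \<and> CH (Suc i) j < int A \<and>
      D (Suc i) j = D i (PJ (Suc i) j) + wd z i (nat (CH (Suc i) j)) \<and>
      (PJ (Suc i) j = j \<and> CH (Suc i) j = int (z i) \<or> j = PJ (Suc i) j + sh z i (nat (CH (Suc i) j)))) \<and>
    (\<forall>i j. i < m \<and> 0 \<le> j \<and> j < T \<longrightarrow> D (Suc i) j \<le> D i j) \<and>
    (\<forall>i a j. i < m \<and> a < A \<and> 0 \<le> j \<and> j < T \<and> 0 \<le> j + sh z i a \<and> j + sh z i a < T \<longrightarrow>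
      D (Suc i) (j + sh z i a) \<le> D i j + wd z i a)"

text \<open>The index reached by tracing the last \<open>m\<close> items back, from row
  \<open>N\<close> to row \<open>N - m\<close>.\<close>

primrec bidx :: "(nat \<Rightarrow> int \<Rightarrow> int) \<Rightarrow> int \<Rightarrow> nat \<Rightarrow> int" where
  "bidx PJ j 0 = j"
| "bidx PJ j (Suc m) = PJ (N - m) (bidx PJ j m)"

definition backtrack :: "(nat \<Rightarrow> int \<Rightarrow> int) \<Rightarrow> (nat \<Rightarrow> int \<Rightarrow> int) \<Rightarrow> int \<Rightarrow> nat \<Rightarrow> nat" where
  "backtrack CH PJ j i = nat (CH (Suc i) (bidx PJ j (N - Suc i)))"

text \<open>\<open>C\<close> collects the items at which a step was taken. Such a step may select
  the old option again; it still shifts the index by \<open>Q\<close>, so \<open>C\<close> may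
  contain unchanged items.\<close>

lemma backtrack_invariant:
  assumes tab: "table z big D CH PJ N" and j: "0 \<le> j" "j < T" and "m \<le> N"
  shows "\<exists>C. C \<subseteq> {N-m..<N} \<and> 0 \<le> bidx PJ j m \<and> bidx PJ j m < T
    \<and> j = bidx PJ j m + (\<Sum>i\<in>C. sh z i (backtrack CH PJ j i))
    \<and> (\<forall>i\<in>{N-m..<N} - C. backtrack CH PJ j i = z i)
    \<and> (\<forall>i\<in>{N-m..<N}. backtrack CH PJ j i < A)
    \<and> D N j = D (N - m) (bidx PJ j m) + (\<Sum>i\<in>{N-m..<N}. wd z i (backtrack CH PJ j i))"
  using \<open>m \<le> N\<close>
proof (induction m)
  case 0
  then show ?case using j by (intro exI[of _ "{}"]) simp
next
  case (Suc m)
  then obtain C where C: "C \<subseteq> {N-m..<N}" "0 \<le> bidx PJ j m" "bidx PJ j m < T"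
    "j = bidx PJ j m + (\<Sum>i\<in>C. sh z i (backtrack CH PJ j i))"
    "\<forall>i\<in>{N-m..<N} - C. backtrack CH PJ j i = z i"
    "\<forall>i\<in>{N-m..<N}. backtrack CH PJ j i < A"
    "D N j = D (N - m) (bidx PJ j m) + (\<Sum>i\<in>{N-m..<N}. wd z i (backtrack CH PJ j i))"
    by auto
  define k where "k = N - Suc m"
  have k: "Suc k = N - m" "k < N" "N - Suc k = m" using Suc.prems by (auto simp: k_def)
  have set: "{N - Suc m..<N} = insert k {N-m..<N}" "k \<notin> {N-m..<N}"
    using k by (auto simp: k_def)
  define b where "b = bidx PJ j m"
  have bt: "backtrack CH PJ j k = nat (CH (Suc k) b)" using k by (simp add: backtrack_def b_def)
  have bS: "bidx PJ j (Suc m) = PJ (Suc k) b" using k by (simp add: b_def)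
  have t: "0 \<le> PJ (Suc k) b \<and> PJ (Suc k) b < T \<and> 0 \<le> CH (Suc k) b \<and> CH (Suc k) b < int A \<and>
      D (Suc k) b = D k (PJ (Suc k) b) + wd z k (nat (CH (Suc k) b)) \<and>
      (PJ (Suc k) b = b \<and> CH (Suc k) b = int (z k) \<or> b = PJ (Suc k) b + sh z k (nat (CH (Suc k) b)))"
    using tab C(2,3) k(2) unfolding table_def b_def by blast
  have finC: "finite C" "k \<notin> C" using C(1) set(2) finite_subset by auto
  have Dk: "D N j = D k (bidx PJ j (Suc m)) + (\<Sum>i\<in>{N-Suc m..<N}. wd z i (backtrack CH PJ j i))"
    using C(7) t set bt bS k by (simp add: b_def[symmetric])
  have A': "\<forall>i\<in>{N-Suc m..<N}. backtrack CH PJ j i < A" using C(6) t bt set by auto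
  from t consider (stay) "PJ (Suc k) b = b" "CH (Suc k) b = int (z k)"
    | (move) "b = PJ (Suc k) b + sh z k (nat (CH (Suc k) b))" by blast
  then show ?case
  proof cases
    case stay
    show ?thesis
      by (rule exI[of _ C], intro conjI)
        (use C set stay bt bS t Dk A' in \<open>auto simp: b_def[symmetric] k_def[symmetric] simp del: bidx.simps\<close>)
  next
    case move
    have "j = bidx PJ j (Suc m) + (\<Sum>i\<in>insert k C. sh z i (backtrack CH PJ j i))"
      using C(4) finC bt bS move by (simp add: b_def[symmetric])
    then show ?thesis
      by (intro exI[of _ "insert k C"] conjI)
        (use C set bt bS t Dk A' in \<open>auto simp: b_def[symmetric] k_def[symmetric] simp del: bidx.simps\<close>)
  qed
qed

text \<open>A path starting at an index other than \<open>Q\<close> has value at least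
  \<open>big - cost z\<close>, which is not negative. A negative entry therefore stems from index
  \<open>Q\<close>, and its value is the difference of the costs.\<close>

lemma backtrack_sound:
  assumes tab: "table z big D CH PJ N" and j: "0 \<le> j" "j < T" and neg: "D N j < 0"
    and z: "\<forall>i<N. z i < A" and big: "int (cost z) \<le> big"
  obtains C where "C \<subseteq> {..<N}" "j = Q + (\<Sum>i\<in>C. sh z i (backtrack CH PJ j i))"
    "\<And>i. i < N \<Longrightarrow> i \<notin> C \<Longrightarrow> backtrack CH PJ j i = z i"
    "\<And>i. i < N \<Longrightarrow> backtrack CH PJ j i < A" "cost (backtrack CH PJ j) < cost z"
proof -
  define y where "y = backtrack CH PJ j"
  from backtrack_invariant[OF tab j, of N] obtain C where C: "C \<subseteq> {..<N}"
    "0 \<le> bidx PJ j N" "bidx PJ j N < T"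
    "j = bidx PJ j N + (\<Sum>i\<in>C. sh z i (y i))"
    "\<forall>i\<in>{..<N} - C. y i = z i"
    "\<forall>i\<in>{..<N}. y i < A"
    "D N j = D 0 (bidx PJ j N) + (\<Sum>i<N. wd z i (y i))"
    by (auto simp: y_def lessThan_atLeast0)
  have "(\<Sum>i<N. wd z i (y i)) = int (cost y) - int (cost z)"
    by (simp add: wd_def sum_subtractf cost_def)
  with C(7) neg have less: "D 0 (bidx PJ j N) + int (cost y) < int (cost z)" by simp
  have D0: "D 0 (bidx PJ j N) = (if bidx PJ j N = Q then 0 else big)"
    using tab C(2,3) unfolding table_def by blast
  with less big have "bidx PJ j N = Q" by (auto split: if_splits)
  with C D0 less that[of C] show thesis by (auto simp: y_def)
qed

text \<open>The changes of \<open>J\<close> are applied in the order of the items. Every partial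
  index is in range, because each subset of \<open>J\<close> has at most \<open>L\<close> elements
  too.\<close>

lemma table_complete:
  assumes tab: "table z big D CH PJ N" and z: "\<forall>i<N. z i < A"
    and J: "J \<subseteq> {..<N}" "int (card J) \<le> L" "\<And>i. i \<in> J \<Longrightarrow> y i < A"
  shows "0 \<le> Q + (\<Sum>i\<in>J. sh z i (y i))" "Q + (\<Sum>i\<in>J. sh z i (y i)) < T"
    "D N (Q + (\<Sum>i\<in>J. sh z i (y i))) \<le> (\<Sum>i\<in>J. wd z i (y i))"
proof -
  have finJ: "finite J" by (rule finite_subset[OF J(1)]) simp
  have range: "0 \<le> Q + (\<Sum>i\<in>J'. sh z i (y i)) \<and> Q + (\<Sum>i\<in>J'. sh z i (y i)) < T" if "J' \<subseteq> J" for J'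
  proof -
    have c: "int (card J') \<le> L" using card_mono[OF finJ that] J(2) by simp
    have "int p * int (card J') \<le> int p * L" using c by (intro mult_left_mono) auto
    then have "\<bar>\<Sum>i\<in>J'. int (u i (y i) x) - int (u i (z i) x)\<bar> \<le> B - 1" if "x \<in> X" for x
      using sum_diff_le[of J' y z x] \<open>J' \<subseteq> J\<close> J z that B_bounds(3) by fastforce
    then have "\<bar>\<Sum>x\<in>X. (\<Sum>i\<in>J'. int (u i (y i) x) - int (u i (z i) x)) * pw x\<bar> < Q"
      using code_less[of 1 "\<lambda>x. \<Sum>i\<in>J'. int (u i (y i) x) - int (u i (z i) x)"] by simp
    moreover have "0 \<le> int (card J') * Q" "int (card J') * Q \<le> L * Q" using c Q_pos by (auto intro: mult_right_mono)
    moreover have "T = L * Q + 2 * Q" by (simp add: T_def algebra_simps)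
    ultimately show ?thesis unfolding sum_sh by linarith
  qed
  show "0 \<le> Q + (\<Sum>i\<in>J. sh z i (y i))" "Q + (\<Sum>i\<in>J. sh z i (y i)) < T" using range[of J] by auto
  have "m \<le> N \<Longrightarrow> D m (Q + (\<Sum>i\<in>J \<inter> {..<m}. sh z i (y i))) \<le> (\<Sum>i\<in>J \<inter> {..<m}. wd z i (y i))" for m
  proof (induction m)
    case 0
    have "D 0 Q = 0" using tab range[of "{}"] unfolding table_def by simp
    then show ?case by simp
  next
    case (Suc m)
    define j where "j = Q + (\<Sum>i\<in>J \<inter> {..<m}. sh z i (y i))"
    have j: "0 \<le> j" "j < T" using range[of "J \<inter> {..<m}"] by (auto simp: j_def)
    show ?case
    proof (cases "m \<in> J")
      case True
      then have ins: "J \<inter> {..<Suc m} = insert m (J \<inter> {..<m})" by auto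
      have e: "Q + (\<Sum>i\<in>J \<inter> {..<Suc m}. sh z i (y i)) = j + sh z m (y m)"
        unfolding ins by (simp add: j_def)
      have "D (Suc m) (j + sh z m (y m)) \<le> D m j + wd z m (y m)"
        using tab j range[of "J \<inter> {..<Suc m}"] e J(3)[OF True] Suc.prems unfolding table_def by auto
      moreover have "(\<Sum>i\<in>J \<inter> {..<Suc m}. wd z i (y i)) = wd z m (y m) + (\<Sum>i\<in>J \<inter> {..<m}. wd z i (y i))"
        unfolding ins by simp
      moreover have "D m j \<le> (\<Sum>i\<in>J \<inter> {..<m}. wd z i (y i))"
        using Suc unfolding j_def by simp
      ultimately show ?thesis unfolding e by linarith
    next
      case False
      then have "J \<inter> {..<Suc m} = J \<inter> {..<m}" by (auto simp: less_Suc_eq)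
      moreover have "D (Suc m) j \<le> D m j" using tab j Suc.prems unfolding table_def by auto
      ultimately show ?thesis using Suc by (simp add: j_def)
    qed
  qed
  from this[of N] show "D N (Q + (\<Sum>i\<in>J. sh z i (y i))) \<le> (\<Sum>i\<in>J. wd z i (y i))"
    using J(1) by (simp add: Int_absorb2)
qed

text \<open>The entry at the index \<open>j\<close> of a small improving \<open>J\<close> is
  negative, but backtracking from it may yield a different set \<open>C\<close> of steps. Both have
  the same index, so \<open>code_inj\<close> makes their load changes equal, and the capacities hold
  for the backtracked choice because they hold after changing \<open>J\<close>.\<close>

lemma table_finds_improvement:
  assumes tab: "table z big D CH PJ N" and z: "feasible z" and nopt: "\<not> optimal z"
    and big: "int (cost z) \<le> big"
  shows "\<exists>j. 0 \<le> j \<and> j < T \<and> D N j < 0 \<and> feasible (backtrack CH PJ j)"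
proof -
  have zA: "\<forall>i<N. z i < A" using z by (simp add: feasible_def)
  from nopt obtain y where y: "feasible y" "cost y < cost z" by (auto simp: optimal_def not_le)
  then have yA: "y i < A" if "i < N" for i using that by (simp add: feasible_def)
  obtain J where J: "J \<subseteq> {..<N}" "int (card J) \<le> L" "(\<Sum>i\<in>J. wd z i (y i)) < 0"
    "\<And>x. x \<in> X \<Longrightarrow> (\<Sum>i<N. int (u i (z i) x)) + (\<Sum>i\<in>J. int (u i (y i) x) - int (u i (z i) x)) \<le> int (cap x)"
    using small_improving_set[OF z y] by blast
  define j where "j = Q + (\<Sum>i\<in>J. sh z i (y i))"
  have j: "0 \<le> j" "j < T" "D N j < 0"
  proof -
    have yJ: "\<And>i. i \<in> J \<Longrightarrow> y i < A" using yA J(1) by auto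
    show "0 \<le> j" "j < T" "D N j < 0"
      using table_complete[where y = y, OF tab zA J(1,2) yJ] J(3) by (auto simp: j_def)
  qed
  define v where "v = backtrack CH PJ j"
  obtain C where C: "C \<subseteq> {..<N}"
    "j = Q + (\<Sum>i\<in>C. sh z i (v i))" "\<And>i. i < N \<Longrightarrow> i \<notin> C \<Longrightarrow> v i = z i" "\<And>i. i < N \<Longrightarrow> v i < A"
    by (rule backtrack_sound[OF tab j zA big, folded v_def], rule that, assumption+)
  have finC: "finite C" by (rule finite_subset[OF C(1)]) simp
  \<comment> \<open>Every step moves the index by more than \<open>Q / 2\<close> and the final index
    is below \<open>T\<close>; this bounds the size of \<open>C\<close>.\<close>
  have "(\<Sum>i\<in>C. Q) \<le> (\<Sum>i\<in>C. 2 * sh z i (v i))"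
  proof (rule sum_mono)
    fix i assume "i \<in> C"
    then have "i < N" using C(1) by auto
    then show "Q \<le> 2 * sh z i (v i)" using sh_ge[of i "v i" z] C(4) zA by auto
  qed
  then have "int (card C) * Q \<le> (\<Sum>i\<in>C. 2 * sh z i (v i))" by simp
  also have "\<dots> < 2 * T" using C(2) j(2) Q_pos by (simp add: sum_distrib_left[symmetric])
  finally have "int (card C) * Q < (2 * (L + 2)) * Q" unfolding T_def mult.assoc .
  then have cC: "int (card C) \<le> 2 * (L + 2)" using Q_pos by (simp add: mult_less_cancel_right)
  define dC where "dC x = (\<Sum>i\<in>C. int (u i (v i) x) - int (u i (z i) x))" for x
  define dJ where "dJ x = (\<Sum>i\<in>J. int (u i (y i) x) - int (u i (z i) x))" for x
  have "(\<Sum>i\<in>C. sh z i (v i)) = (\<Sum>i\<in>J. sh z i (y i))" using C(2) by (simp add: j_def)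
  then have sum_eq: "(\<Sum>x\<in>X. (dC x - dJ x) * pw x) = (int (card J) - int (card C)) * Q"
    unfolding sum_sh by (simp add: dC_def dJ_def left_diff_distrib sum_subtractf)
  have d: "\<bar>dC x - dJ x\<bar> \<le> B - 1" if "x \<in> X" for x
  proof -
    have "\<bar>dC x\<bar> \<le> int p * int (card C)" unfolding dC_def
      using C zA that by (intro sum_diff_le) auto
    moreover have "\<bar>dJ x\<bar> \<le> int p * int (card J)" unfolding dJ_def
      using J(1) yA zA that by (intro sum_diff_le) auto
    moreover have "int p * int (card C) \<le> int p * (2 * (L + 2))" "int p * int (card J) \<le> int p * L"
      using cC J(2) by (auto intro: mult_left_mono)
    moreover have "int p * (2 * (L + 2)) + int p * L \<le> B - 1"
      using B_bounds(4) by (simp only: distrib_left)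
    ultimately show ?thesis by linarith
  qed
  have "\<forall>x\<in>X. dC x - dJ x = 0" by (rule code_inj[OF _ sum_eq]) (rule d)
  then have eq: "dC x = dJ x" if "x \<in> X" for x using that by simp
  have "feasible v"
    unfolding feasible_def
  proof (intro conjI ballI allI impI)
    fix x assume x: "x \<in> X"
    have "(\<Sum>i<N. int (u i (v i) x)) = (\<Sum>i<N. int (u i (z i) x)) + (\<Sum>i<N. int (u i (v i) x) - int (u i (z i) x))"
      by (simp add: sum_subtractf)
    also have "(\<Sum>i<N. int (u i (v i) x) - int (u i (z i) x)) = dC x"
      unfolding dC_def using C(1,3) by (intro sum.mono_neutral_right) auto
    also have "(\<Sum>i<N. int (u i (z i) x)) + dC x \<le> int (cap x)" using J(4)[OF x] eq[OF x] by (simp add: dJ_def)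
    finally show "(\<Sum>i<N. u i (v i) x) \<le> cap x" by (simp flip: of_nat_sum)
  qed (use C in auto)
  with j show ?thesis unfolding v_def by blast
qed

end

section \<open>Programs with bounded loops\<close>

text \<open>
  Programs are written with bounded loops only, so that their meaning is a total function. The
  limit of a loop is a register that its body does not change.
\<close>

datatype fcom =
    Nop
  | Asg nat aexp
  | Sto nat aexp aexp
  | Sq fcom fcom (infixr \<open>;;\<close> 60)
  | Ite bexp fcom fcom
  | For nat nat fcom

text \<open>Up to 32 arrays are interleaved on the negative addresses, so that writing at
  nonnegative array indices leaves the input untouched. The factor 32 is five doublings, as the
  machine can only add and subtract.\<close>

definition enc :: "nat \<Rightarrow> int \<Rightarrow> int" where
  "enc k i = - 1 - int k - 32 * i"

definition dbl :: "aexp \<Rightarrow> aexp" where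
  "dbl e = Add e e"

definition encA :: "nat \<Rightarrow> aexp \<Rightarrow> aexp" where
  "encA k e = Sub (Lit (- 1 - int k)) (dbl (dbl (dbl (dbl (dbl e)))))"

definition AR :: "nat \<Rightarrow> aexp \<Rightarrow> aexp" where
  "AR k e = Mem (encA k e)"

definition rg :: "state \<Rightarrow> nat \<Rightarrow> int" where
  "rg s r = fst s r"

definition ar :: "state \<Rightarrow> nat \<Rightarrow> int \<Rightarrow> int" where
  "ar s k i = snd s (enc k i)"

definition setr :: "nat \<Rightarrow> int \<Rightarrow> state \<Rightarrow> state" where
  "setr r v s = ((fst s)(r := v), snd s)"

definition seta :: "nat \<Rightarrow> int \<Rightarrow> int \<Rightarrow> state \<Rightarrow> state" where
  "seta k i v s = (fst s, (snd s)(enc k i := v))"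

lemma enc_eq_iff: "k < 32 \<Longrightarrow> k' < 32 \<Longrightarrow> enc k i = enc k' j \<longleftrightarrow> k = k' \<and> i = j"
proof
  assume k: "k < 32" "k' < 32" "enc k i = enc k' j"
  then have eq: "int k + 32 * i = int k' + 32 * j" by (simp add: enc_def)
  have "int k = (int k + 32 * i) mod 32" using k by simp
  also have "\<dots> = int k'" unfolding eq using k by simp
  finally show "k = k' \<and> i = j" using eq by simp
qed simp

lemma enc_neg: "0 \<le> i \<Longrightarrow> enc k i < 0"
  unfolding enc_def by simp

lemma aval_encA [simp]: "aval (encA k e) s = enc k (aval e s)"
  by (simp add: encA_def dbl_def enc_def)

lemma aval_AR [simp]: "aval (AR k e) s = ar s k (aval e s)"
  by (simp add: AR_def ar_def)

lemma aval_Reg [simp]: "aval (Reg r) s = rg s r"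
  by (simp add: rg_def)

declare aval.simps(2) [simp del]

lemma rg_setr [simp]: "rg (setr r v s) r' = (if r' = r then v else rg s r')"
  by (simp add: rg_def setr_def)

lemma rg_seta [simp]: "rg (seta k i v s) r = rg s r"
  by (simp add: rg_def seta_def)

lemma ar_setr [simp]: "ar (setr r v s) = ar s"
  by (simp add: ar_def setr_def fun_eq_iff)

lemma ar_seta [simp]:
  "k < 32 \<Longrightarrow> k' < 32 \<Longrightarrow> ar (seta k i v s) k' = (if k' = k then (ar s k)(i := v) else ar s k')"
  by (auto simp: ar_def seta_def fun_eq_iff enc_eq_iff)

lemma snd_setr [simp]: "snd (setr r v s) = snd s"
  by (simp add: setr_def)

lemma snd_seta [simp]: "0 \<le> i \<Longrightarrow> 0 \<le> a \<Longrightarrow> snd (seta k i v s) a = snd s a"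
  using enc_neg[of i k] by (auto simp: seta_def)

text \<open>\<open>For\<close> reads its limit once and leaves the counter at the limit. The
  compiled \<open>While\<close> does the same because \<open>wf\<close> forbids the body to write
  either register.\<close>

primrec sem :: "fcom \<Rightarrow> state \<Rightarrow> state" where
  "sem Nop s = s"
| "sem (Asg r e) s = setr r (aval e s) s"
| "sem (Sto k i e) s = seta k (aval i s) (aval e s) s"
| "sem (Sq p q) s = sem q (sem p s)"
| "sem (Ite b p q) s = (if bval b s then sem p s else sem q s)"
| "sem (For r l p) s = setr r (int (nat (rg s l)))
     (fold (\<lambda>i t. sem p (setr r (int i) t)) [0..<nat (rg s l)] s)"

primrec written_regs :: "fcom \<Rightarrow> nat set" where
  "written_regs Nop = {}"
| "written_regs (Asg r e) = {r}"
| "written_regs (Sto k i e) = {}"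
| "written_regs (Sq p q) = written_regs p \<union> written_regs q"
| "written_regs (Ite b p q) = written_regs p \<union> written_regs q"
| "written_regs (For r l p) = insert r (written_regs p)"

primrec written_arrays :: "fcom \<Rightarrow> nat set" where
  "written_arrays Nop = {}"
| "written_arrays (Asg r e) = {}"
| "written_arrays (Sto k i e) = {k}"
| "written_arrays (Sq p q) = written_arrays p \<union> written_arrays q"
| "written_arrays (Ite b p q) = written_arrays p \<union> written_arrays q"
| "written_arrays (For r l p) = written_arrays p"

primrec limit_regs :: "fcom \<Rightarrow> nat set" where
  "limit_regs Nop = {}"
| "limit_regs (Asg r e) = {}"
| "limit_regs (Sto k i e) = {}"
| "limit_regs (Sq p q) = limit_regs p \<union> limit_regs q"
| "limit_regs (Ite b p q) = limit_regs p \<union> limit_regs q"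
| "limit_regs (For r l p) = insert l (limit_regs p)"

primrec wf :: "fcom \<Rightarrow> bool" where
  "wf Nop \<longleftrightarrow> True"
| "wf (Asg r e) \<longleftrightarrow> True"
| "wf (Sto k i e) \<longleftrightarrow> k < 32"
| "wf (Sq p q) \<longleftrightarrow> wf p \<and> wf q"
| "wf (Ite b p q) \<longleftrightarrow> wf p \<and> wf q"
| "wf (For r l p) \<longleftrightarrow> r \<noteq> l \<and> r \<notin> written_regs p \<and> l \<notin> written_regs p \<and> wf p"

primrec compile :: "fcom \<Rightarrow> com" where
  "compile Nop = Skip"
| "compile (Asg r e) = Assign r e"
| "compile (Sto k i e) = Store (encA k i) e"
| "compile (Sq p q) = Seq (compile p) (compile q)"
| "compile (Ite b p q) = Cond b (compile p) (compile q)"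
| "compile (For r l p) = Seq (Assign r (Lit 0))
     (While (Less (Reg r) (Reg l)) (Seq (compile p) (Assign r (Add (Reg r) (Lit 1)))))"

primrec depth :: "fcom \<Rightarrow> nat" where
  "depth Nop = 0"
| "depth (Asg r e) = 0"
| "depth (Sto k i e) = 0"
| "depth (Sq p q) = max (depth p) (depth q)"
| "depth (Ite b p q) = max (depth p) (depth q)"
| "depth (For r l p) = Suc (depth p)"

text \<open>The 14 for a loop consists of 8 steps per pass for test and increment and 6 steps for
  initialisation and the final test.\<close>

primrec step_factor :: "fcom \<Rightarrow> nat" where
  "step_factor Nop = 1"
| "step_factor (Asg r e) = 1 + acost e"
| "step_factor (Sto k i e) = 1 + acost (encA k i) + acost e"
| "step_factor (Sq p q) = step_factor p + step_factor q"
| "step_factor (Ite b p q) = 1 + bcost b + step_factor p + step_factor q"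
| "step_factor (For r l p) = 14 + step_factor p"

text \<open>\<open>Y\<close> bounds the loop limits actually met during the run. A bound on the
  initial registers alone would not do, since \<open>MAIN\<close> computes its limits.\<close>

primrec limits_bounded :: "fcom \<Rightarrow> state \<Rightarrow> nat \<Rightarrow> bool" where
  "limits_bounded Nop s Y \<longleftrightarrow> True"
| "limits_bounded (Asg r e) s Y \<longleftrightarrow> True"
| "limits_bounded (Sto k i e) s Y \<longleftrightarrow> True"
| "limits_bounded (Sq p q) s Y \<longleftrightarrow> limits_bounded p s Y \<and> limits_bounded q (sem p s) Y"
| "limits_bounded (Ite b p q) s Y \<longleftrightarrow> (if bval b s then limits_bounded p s Y else limits_bounded q s Y)"
| "limits_bounded (For r l p) s Y \<longleftrightarrow> nat (rg s l) \<le> Y \<and> (\<forall>i<nat (rg s l).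
     limits_bounded p (setr r (int i) (fold (\<lambda>i t. sem p (setr r (int i) t)) [0..<i] s)) Y)"

definition frame :: "fcom \<Rightarrow> state \<Rightarrow> state \<Rightarrow> bool" where
  "frame p s t \<longleftrightarrow> (\<forall>r. r \<notin> written_regs p \<longrightarrow> rg t r = rg s r) \<and> (\<forall>k. k < 32 \<longrightarrow> k \<notin> written_arrays p \<longrightarrow> ar t k = ar s k)"

lemma frame_sem: "wf p \<Longrightarrow> frame p s (sem p s)"
proof (induction p arbitrary: s)
  case (For r l p)
  have "frame (For r l p) s (fold (\<lambda>i t. sem p (setr r (int i) t)) [0..<N] s)" for N
  proof (induction N)
    case 0
    then show ?case by (simp add: frame_def)
  next
    case (Suc N)
    then show ?case
      using For.IH[of "setr r (int N) (fold (\<lambda>i t. sem p (setr r (int i) t)) [0..<N] s)"] For.prems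
      by (simp add: frame_def)
  qed
  from this[of "nat (rg s l)"] show ?case by (simp add: frame_def)
next
  case (Sq p q)
  then show ?case using Sq.IH(1)[of s] Sq.IH(2)[of "sem p s"] by (simp add: frame_def)
next
  case (Ite b p q)
  then show ?case using Ite.IH(1)[of s] Ite.IH(2)[of s] by (simp add: frame_def)
qed (auto simp: frame_def)

lemma rg_sem: "wf p \<Longrightarrow> r \<notin> written_regs p \<Longrightarrow> rg (sem p s) r = rg s r"
  using frame_sem by (simp add: frame_def)

lemma ar_sem: "wf p \<Longrightarrow> k < 32 \<Longrightarrow> k \<notin> written_arrays p \<Longrightarrow> ar (sem p s) k = ar s k"
  using frame_sem by (simp add: frame_def)

lemma frame_rg: "frame p s t \<Longrightarrow> r \<notin> written_regs p \<Longrightarrow> rg t r = rg s r"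
  by (simp add: frame_def)

lemma sem_For_invariant:
  assumes "wf (For r l p)" and "Inv 0 s"
    and "\<And>i t. i < nat (rg s l) \<Longrightarrow> frame (For r l p) s t \<Longrightarrow> Inv i t \<Longrightarrow> Inv (Suc i) (sem p (setr r (int i) t))"
  obtains t where "frame (For r l p) s t" "Inv (nat (rg s l)) t"
    "sem (For r l p) s = setr r (int (nat (rg s l))) t"
proof -
  define F where "F N = fold (\<lambda>i t. sem p (setr r (int i) t)) [0..<N] s" for N
  have "N \<le> nat (rg s l) \<Longrightarrow> frame (For r l p) s (F N) \<and> Inv N (F N)" for N
  proof (induction N)
    case 0
    then show ?case using assms by (simp add: frame_def F_def)
  next
    case (Suc N)
    then have IH: "frame (For r l p) s (F N)" "Inv N (F N)" by auto
    have "F (Suc N) = sem p (setr r (int N) (F N))" by (simp add: F_def)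
    then show ?case
      using IH assms(3)[OF _ IH] Suc.prems assms(1) frame_sem[of p "setr r (int N) (F N)"]
      by (simp add: frame_def)
  qed
  then show thesis using that[of "F (nat (rg s l))"] by (simp add: F_def)
qed

text \<open>If no limit register is ever written, the limits keep their initial values.\<close>

lemma limits_bounded_static:
  assumes "wf p" "limit_regs p \<inter> written_regs p = {}" "\<And>l. l \<in> limit_regs p \<Longrightarrow> nat (rg s l) \<le> Y"
  shows "limits_bounded p s Y"
  using assms
proof (induction p arbitrary: s)
  case (Sq p q)
  have "nat (rg (sem p s) l) \<le> Y" if "l \<in> limit_regs q" for l
  proof -
    have "l \<notin> written_regs p" using that Sq.prems by auto
    then show ?thesis using that Sq.prems rg_sem[of p l s] by simp
  qed
  moreover have "limit_regs p \<inter> written_regs p = {}" "limit_regs q \<inter> written_regs q = {}" using Sq.prems by auto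
  ultimately show ?case using Sq by auto
next
  case (Ite b p q)
  moreover have "limit_regs p \<inter> written_regs p = {}" "limit_regs q \<inter> written_regs q = {}" using Ite.prems by auto
  ultimately show ?case by auto
next
  case (For r l p)
  define F where "F N = fold (\<lambda>i t. sem p (setr r (int i) t)) [0..<N] s" for N
  have fr: "frame (For r l p) s (F N)" for N
  proof (induction N)
    case 0
    then show ?case by (simp add: frame_def F_def)
  next
    case (Suc N)
    then show ?case using For.prems frame_sem[of p "setr r (int N) (F N)"]
      by (simp add: F_def frame_def)
  qed
  have "limits_bounded p (setr r (int i) (F i)) Y" for i
  proof (rule For.IH)
    fix l' assume l': "l' \<in> limit_regs p"
    then have "l' \<noteq> r" "l' \<notin> written_regs p" using For.prems by auto
    then show "nat (rg (setr r (int i) (F i)) l') \<le> Y"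
      using fr[of i] For.prems(3)[of l'] l' by (simp add: frame_def)
  qed (use For.prems in auto)
  then show ?case using For.prems by (simp add: F_def)
qed auto

lemma power_mono_depth: "d \<le> e \<Longrightarrow> k * (Y + 1) ^ d \<le> k * (Y + 1 :: nat) ^ e"
  by (simp add: power_increasing)

text \<open>Each nesting level multiplies the running time by at most \<open>Y + 1\<close> up to a
  constant, so time is polynomial in the largest limit, with a degree fixed by the program.\<close>

lemma exec_compile:
  "wf p \<Longrightarrow> limits_bounded p s Y \<Longrightarrow> \<exists>t. exec (compile p) s t (sem p s) \<and> t \<le> step_factor p * (Y + 1) ^ depth p"
proof (induction p arbitrary: s)
  case Nop
  show ?case using exec.Skip[of s] by auto
next
  case (Asg r e)
  show ?case using exec.Assign[of r e s] by (auto simp: setr_def)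
next
  case (Sto k i e)
  show ?case using exec.Store[of "encA k i" e s] by (auto simp: seta_def)
next
  case (Sq p q)
  from Sq.IH(1)[of s] Sq.IH(2)[of "sem p s"] Sq.prems obtain t1 t2 where t: "exec (compile p) s t1 (sem p s)" "t1 \<le> step_factor p * (Y + 1) ^ depth p"
    "exec (compile q) (sem p s) t2 (sem q (sem p s))" "t2 \<le> step_factor q * (Y + 1) ^ depth q"
    by auto
  have "t1 + t2 \<le> step_factor p * (Y + 1) ^ max (depth p) (depth q) + step_factor q * (Y + 1) ^ max (depth p) (depth q)"
    using t(2,4) power_mono_depth[of "depth p" "max (depth p) (depth q)" "step_factor p" Y]
      power_mono_depth[of "depth q" "max (depth p) (depth q)" "step_factor q" Y] by linarith
  then show ?case using exec.Seq[OF t(1,3)] by (auto simp: algebra_simps)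
next
  case (Ite b p q)
  define D where "D = max (depth p) (depth q)"
  have one: "1 \<le> (Y + 1) ^ D" by simp
  have K: "step_factor (Ite b p q) * (Y + 1) ^ depth (Ite b p q)
      = (1 + bcost b) * (Y + 1) ^ D + step_factor p * (Y + 1) ^ D + step_factor q * (Y + 1) ^ D"
    by (simp add: D_def add_mult_distrib)
  have bc: "1 + bcost b \<le> (1 + bcost b) * (Y + 1) ^ D" using mult_le_mono2[OF one, of "1 + bcost b"] by simp
  show ?case
  proof (cases "bval b s")
    case True
    with Ite.IH(1)[of s] Ite.prems obtain t
      where t: "exec (compile p) s t (sem p s)" "t \<le> step_factor p * (Y + 1) ^ depth p" by auto
    have "step_factor p * (Y + 1) ^ depth p \<le> step_factor p * (Y + 1) ^ D"
      by (rule power_mono_depth) (simp add: D_def)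
    with t(2) bc K have "1 + bcost b + t \<le> step_factor (Ite b p q) * (Y + 1) ^ depth (Ite b p q)"
      by linarith
    moreover have "exec (compile (Ite b p q)) s (1 + bcost b + t) (sem (Ite b p q) s)"
      using exec.CondTrue[OF True t(1)] True by simp
    ultimately show ?thesis by blast
  next
    case False
    with Ite.IH(2)[of s] Ite.prems obtain t
      where t: "exec (compile q) s t (sem q s)" "t \<le> step_factor q * (Y + 1) ^ depth q" by auto
    have "step_factor q * (Y + 1) ^ depth q \<le> step_factor q * (Y + 1) ^ D"
      by (rule power_mono_depth) (simp add: D_def)
    with t(2) bc K have "1 + bcost b + t \<le> step_factor (Ite b p q) * (Y + 1) ^ depth (Ite b p q)"
      by linarith
    moreover have "exec (compile (Ite b p q)) s (1 + bcost b + t) (sem (Ite b p q) s)"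
      using exec.CondFalse[OF False t(1)] False by simp
    ultimately show ?thesis by blast
  qed
next
  case (For r l p)
  define F where "F N = fold (\<lambda>i t. sem p (setr r (int i) t)) [0..<N] s" for N
  define N where "N = nat (rg s l)"
  define W where "W = While (Less (Reg r) (Reg l)) (Seq (compile p) (Assign r (Add (Reg r) (Lit 1))))"
  define X where "X = step_factor p * (Y + 1) ^ depth p"
  have wf: "r \<noteq> l" "r \<notin> written_regs p" "l \<notin> written_regs p" "wf p" using For.prems by auto
  have fl: "rg (F i) l = rg s l" for i
  proof (induction i)
    case (Suc i)
    then show ?case using wf by (simp add: F_def rg_sem)
  qed (simp add: F_def)
  have "\<exists>t. exec W (setr r (int i) (F i)) t (setr r (int N) (F N)) \<and> t \<le> (N - i) * (X + 8) + 4"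
    if "i \<le> N" for i
    using that
  proof (induction "N - i" arbitrary: i)
    case 0
    then have "i = N" by simp
    have nb: "\<not> bval (Less (Reg r) (Reg l)) (setr r (int N) (F N))"
      using wf fl by (simp add: N_def)
    have e4: "1 + bcost (Less (Reg r) (Reg l)) = 4" by simp
    from exec.WhileFalse[OF nb] have "exec W (setr r (int N) (F N)) 4 (setr r (int N) (F N))"
      unfolding W_def e4 .
    with \<open>i = N\<close> show ?case by (intro exI[of _ 4]) simp
  next
    case (Suc m)
    then have i: "i < N" by simp
    then have "limits_bounded p (setr r (int i) (F i)) Y" using For.prems by (simp add: F_def N_def)
    from For.IH[OF wf(4) this] obtain t
      where t: "exec (compile p) (setr r (int i) (F i)) t (F (Suc i))" "t \<le> X"
      unfolding X_def by (auto simp: F_def)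
    have rr: "rg (F (Suc i)) r = int i" using wf by (simp add: F_def rg_sem)
    have c4: "1 + acost (Add (Reg r) (Lit 1)) = 4" by simp
    have st: "((fst (F (Suc i)))(r := aval (Add (Reg r) (Lit 1)) (F (Suc i))), snd (F (Suc i)))
      = setr r (int (Suc i)) (F (Suc i))" using rr by (simp add: setr_def add.commute)
    have "exec (Assign r (Add (Reg r) (Lit 1))) (F (Suc i)) 4 (setr r (int (Suc i)) (F (Suc i)))"
      using exec.Assign[of r "Add (Reg r) (Lit 1)" "F (Suc i)"] unfolding c4 st .
    from exec.Seq[OF t(1) this] have body: "exec (Seq (compile p) (Assign r (Add (Reg r) (Lit 1))))
      (setr r (int i) (F i)) (t + 4) (setr r (int (Suc i)) (F (Suc i)))" .
    have b: "bval (Less (Reg r) (Reg l)) (setr r (int i) (F i))"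
      using i wf fl by (simp add: N_def)
    have "m = N - Suc i" "Suc i \<le> N" using Suc.hyps(2) i by auto
    from Suc.hyps(1)[OF this] obtain u where
      u: "exec W (setr r (int (Suc i)) (F (Suc i))) u (setr r (int N) (F N))"
      "u \<le> (N - Suc i) * (X + 8) + 4" by blast
    have c8: "1 + bcost (Less (Reg r) (Reg l)) + (t + 4) + u = 8 + t + u" by simp
    have "exec W (setr r (int i) (F i)) (8 + t + u) (setr r (int N) (F N))"
      using exec.WhileTrue[OF b body u(1)[unfolded W_def]] unfolding c8 W_def .
    moreover have "N - i = Suc (N - Suc i)" using i by simp
    then have "(N - i) * (X + 8) = (X + 8) + (N - Suc i) * (X + 8)" by simp
    ultimately show ?case using t(2) u(2) by (intro exI[of _ "8 + t + u"] conjI) linarith+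
  qed
  from this[of 0] obtain t where t: "exec W (setr r 0 s) t (setr r (int N) (F N))"
    "t \<le> N * (X + 8) + 4" by (auto simp: F_def)
  have c2: "1 + acost (Lit 0) = 2" by simp
  have "exec (Assign r (Lit 0)) s 2 (setr r 0 s)"
    using exec.Assign[of r "Lit 0" s] unfolding c2 setr_def aval.simps(1) .
  from exec.Seq[OF this t(1)] have e: "exec (compile (For r l p)) s (2 + t) (sem (For r l p) s)"
    by (simp add: W_def N_def F_def)
  have NY: "N \<le> Y" using For.prems by (simp add: N_def)
  have "1 \<le> (Y + 1) ^ depth p" by simp
  then have "2 + t \<le> Y * (X + 8 * (Y + 1) ^ depth p) + 6 * (Y + 1) ^ depth p"
    using t(2) mult_le_mono[OF NY, of "X + 8" "X + 8 * (Y + 1) ^ depth p"] by linarith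
  also have "\<dots> \<le> (14 + step_factor p) * ((Y + 1) * (Y + 1) ^ depth p)"
    unfolding X_def by (simp add: add_mult_distrib add_mult_distrib2 mult.left_commute)
  also have "\<dots> = step_factor (For r l p) * (Y + 1) ^ depth (For r l p)" by simp
  finally show ?case using e by blast
qed

section \<open>The program\<close>

abbreviation R :: "nat \<Rightarrow> aexp" where "R \<equiv> Reg"
abbreviation K :: "int \<Rightarrow> aexp" where "K \<equiv> Lit"

definition Le :: "aexp \<Rightarrow> aexp \<Rightarrow> bexp" where "Le a b = Neg (Less b a)"
definition Eq :: "aexp \<Rightarrow> aexp \<Rightarrow> bexp" where "Eq a b = Conj (Neg (Less a b)) (Neg (Less b a))"

lemma bval_Le [simp]: "bval (Le a b) s \<longleftrightarrow> aval a s \<le> aval b s"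
  by (simp add: Le_def not_less)

lemma bval_Eq [simp]: "bval (Eq a b) s \<longleftrightarrow> aval a s = aval b s"
  by (auto simp: Eq_def)

abbreviation inc :: "nat \<Rightarrow> fcom" where "inc r \<equiv> Asg r (Add (R r) (K 1))"
abbreviation when_com :: "bexp \<Rightarrow> fcom \<Rightarrow> fcom" where "when_com b p \<equiv> Ite b p Nop"

abbreviation ADJ :: "nat \<Rightarrow> nat \<Rightarrow> aexp" where "ADJ u v \<equiv> AR 0 (Add (AR 1 (R u)) (R v))"
abbreviation CAPA :: "nat \<Rightarrow> aexp" where "CAPA v \<equiv> AR 0 (Add (R v) (K 2))"

text \<open>
  Constant during an attempt are the registers 1 (\<open>n\<close>), 2 (\<open>k\<close>), 3 (\<open>n + 1\<close>, which also is the
  cost of an unassigned edge or an overloaded vertex), 5 (\<open>p\<close>), 6 (number of guesses), 8 (digits of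
  an option), 9 (number of options), 11 (base of the load code), 12 (shift of the table index per
  changed item), 13 (length of a table row), 14 (number of rounds), 19 (\<open>p + 1\<close>), 35 (\<open>4p\<close>), 36 (the number 3), 38 (\<open>n + 2\<close>).
  Register 0 is the answer, 7 the current guess, 15 and 16 say whether a suitable \<open>p\<close> and \<open>X\<close> have
  been found, 17 and 18 report a component that is too large, 40 is the current item, 41 its number
  of edges, 43 and 44 are the load code and the cost of the option evaluated last.

  The arrays are 0 (copy of the input), 1 (start of the rows of the adjacency matrix), 2 (guess),
  3 (\<open>X\<close>), 4 (guessed part of the cover in \<open>X\<close>), 5 (component labels, \<open>n\<close> on \<open>X\<close>), 6 and 7
  (endpoints of the edges of the current item), 8 (digits of an option), 9 (load of an option),
  10 (weights of the load code), 11 and 12 (current and tentative choice), 13 to 15 (table and back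
  pointers), 16 (start of the rows of the table), 17 (total load).
\<close>

definition DECODE :: "nat \<Rightarrow> nat \<Rightarrow> nat \<Rightarrow> nat \<Rightarrow> fcom" where
  "DECODE k rb rl rlim = For 31 rl (
     Asg 33 (K 0);; Asg 34 (R 30);;
     For 32 rlim (Ite (Less (R 34) (R rb)) Nop (Asg 34 (Sub (R 34) (R rb));; inc 33));;
     Sto k (R 31) (R 34);; Asg 30 (R 33))"

definition RELABEL :: fcom where
  "RELABEL = For 22 1 (
     when_com (Eq (AR 5 (R 22)) (R 24)) (Sto 5 (R 22) (R 23));;
     when_com (Eq (AR 5 (R 22)) (R 23)) (inc 25))"

definition MERGE :: fcom where
  "MERGE = Asg 23 (AR 5 (R 20));; Asg 24 (AR 5 (R 21));; Asg 25 (K 0);; RELABEL;;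
     when_com (Less (R 5) (R 25)) (Asg 17 (K 1);; Asg 18 (R 23))"

definition LABEL :: fcom where
  "LABEL = For 20 1 (Ite (Less (K 0) (AR 3 (R 20))) (Sto 5 (R 20) (R 1)) (Sto 5 (R 20) (R 20)));;
     Asg 17 (K 0);; Asg 18 (K 0);;
     For 20 1 (For 21 1 (when_com
       (Conj (Less (R 17) (K 1)) (Conj (Less (K 0) (ADJ 20 21)) (Conj (Less (AR 3 (R 20)) (K 1))
         (Conj (Less (AR 3 (R 21)) (K 1)) (Neg (Eq (AR 5 (R 20)) (AR 5 (R 21))))))))
       MERGE))"

definition PICK :: fcom where
  "PICK = Asg 25 (K 0);; For 20 1 (when_com (Eq (AR 5 (R 20)) (R 18)) (
     when_com (Eq (R 25) (AR 2 (R 27))) (Sto 3 (R 20) (K 1));;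
     when_com (Eq (Add (R 25) (Add (R 5) (R 5))) (AR 2 (R 27))) (Sto 3 (R 20) (K 1);; Sto 4 (R 20) (K 1));;
     inc 25))"

text \<open>There are \<open>p + 1\<close> passes because the last one only labels anew, to see
  whether \<open>p\<close> picks were enough. Should a class still be too large, the additional pick
  does no harm: the guess has failed anyway.\<close>

definition SEARCH :: fcom where
  "SEARCH = Asg 30 (R 7);; DECODE 2 35 5 6;;
     For 20 1 (Sto 3 (R 20) (K 0);; Sto 4 (R 20) (K 0));;
     For 27 19 (LABEL;; when_com (Less (K 0) (R 17)) PICK)"

definition EDGES :: fcom where
  "EDGES = Asg 41 (K 0);; For 20 1 (For 21 1 (when_com (Conj (Less (R 21) (R 20)) (Less (K 0) (ADJ 20 21))) (
     Ite (Less (K 0) (AR 3 (R 20))) (Asg 42 (AR 5 (R 21))) (Asg 42 (AR 5 (R 20)));;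
     when_com (Eq (R 42) (R 40)) (Sto 6 (R 41) (R 20);; Sto 7 (R 41) (R 21);; inc 41))))"

definition ASSIGN :: "nat \<Rightarrow> fcom" where
  "ASSIGN k = Sto 9 (AR k (R 45)) (Add (AR 9 (AR k (R 45))) (K 1));;
     Asg 43 (Add (R 43) (AR 10 (AR k (R 45))))"

text \<open>The loop over the edges runs to register 8 and tests against register 41, so that the
  limits of all loops in \<open>ATTEMPT\<close> are registers that \<open>ATTEMPT\<close> does not
  write, as \<open>limits_bounded_static\<close> requires.\<close>

definition EVAL :: fcom where
  "EVAL = DECODE 8 36 8 9;; For 20 1 (Sto 9 (R 20) (K 0));; Asg 43 (K 0);; Asg 44 (K 0);;
     For 45 8 (when_com (Less (R 45) (R 41)) (
       Ite (Eq (AR 8 (R 45)) (K 0)) (Asg 44 (Add (R 44) (R 3)))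
         (Ite (Eq (AR 8 (R 45)) (K 1)) (ASSIGN 6) (ASSIGN 7))));;
     For 20 1 (when_com (Less (AR 3 (R 20)) (K 1)) (
       when_com (Less (K 0) (AR 9 (R 20))) (inc 44);;
       when_com (Less (CAPA 20) (AR 9 (R 20))) (Asg 44 (Add (R 44) (R 3)))))"

abbreviation CELL :: "nat \<Rightarrow> aexp \<Rightarrow> aexp \<Rightarrow> aexp" where "CELL k i j \<equiv> AR k (Add (AR 16 i) j)"
abbreviation PUT :: "nat \<Rightarrow> aexp \<Rightarrow> aexp \<Rightarrow> aexp \<Rightarrow> fcom" where "PUT k i j e \<equiv> Sto k (Add (AR 16 i) j) e"
abbreviation NEXT :: aexp where "NEXT \<equiv> Add (R 40) (K 1)"

definition UPDATE :: fcom where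
  "UPDATE = For 46 13 (Asg 51 (Add (R 46) (R 54));;
     when_com (Conj (Le (K 0) (R 51)) (Conj (Less (R 51) (R 13))
         (Less (Add (CELL 13 (R 40) (R 46)) (R 55)) (CELL 13 NEXT (R 51)))))
       (PUT 13 NEXT (R 51) (Add (CELL 13 (R 40) (R 46)) (R 55));;
        PUT 14 NEXT (R 51) (R 48);; PUT 15 NEXT (R 51) (R 46)))"

definition DPITEM :: fcom where
  "DPITEM = EDGES;; Asg 30 (AR 11 (R 40));; EVAL;; Asg 52 (R 43);; Asg 53 (R 44);;
     For 46 13 (PUT 13 NEXT (R 46) (CELL 13 (R 40) (R 46));; PUT 14 NEXT (R 46) (AR 11 (R 40));;
       PUT 15 NEXT (R 46) (R 46));;
     For 48 9 (Asg 30 (R 48);; EVAL;; Asg 54 (Sub (Add (R 12) (R 43)) (R 52));; Asg 55 (Sub (R 44) (R 53));; UPDATE)"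

definition DPTABLE :: fcom where
  "DPTABLE = For 46 13 (Sto 13 (R 46) (R 14));; Sto 13 (R 12) (K 0);; For 40 3 DPITEM"

definition BACKTRACK :: fcom where
  "BACKTRACK = Asg 51 (R 63);; For 49 3 (Asg 50 (Sub (R 1) (R 49));;
     Sto 12 (R 50) (CELL 14 (Add (R 50) (K 1)) (R 51));;
     Asg 51 (CELL 15 (Add (R 50) (K 1)) (R 51)))"

definition CHECK :: fcom where
  "CHECK = For 20 1 (Sto 17 (R 20) (K 0));;
     For 40 3 (EDGES;; Asg 30 (AR 12 (R 40));; EVAL;;
       For 20 1 (Sto 17 (R 20) (Add (AR 17 (R 20)) (AR 9 (R 20)))));;
     Asg 56 (K 1);;
     For 20 1 (when_com (Less (K 0) (AR 3 (R 20))) (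
       Ite (Less (K 0) (AR 4 (R 20)))
         (when_com (Less (CAPA 20) (AR 17 (R 20))) (Asg 56 (K 0)))
         (when_com (Less (K 0) (AR 17 (R 20))) (Asg 56 (K 0)))))"

text \<open>A negative entry guarantees a smaller cost, but not that the capacities hold. Hence the
  choice behind each negative entry is checked, and the first that passes is adopted.\<close>

definition ROUND :: fcom where
  "ROUND = DPTABLE;; Asg 57 (K 0);;
     For 63 13 (when_com (Conj (Less (R 57) (K 1)) (Less (CELL 13 (R 3) (R 63)) (K 0))) (
       BACKTRACK;; CHECK;;
       when_com (Less (K 0) (R 56)) (For 40 3 (Sto 11 (R 40) (AR 12 (R 40)));; Asg 57 (K 1))))"

definition WEIGHTS :: fcom where
  "WEIGHTS = Asg 60 (K 1);; For 20 1 (Sto 10 (R 20) (K 0);; when_com (Less (K 0) (AR 3 (R 20))) (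
     Sto 10 (R 20) (R 60);; Asg 61 (K 0);; For 62 11 (Asg 61 (Add (R 61) (R 60)));; Asg 60 (R 61)))"

definition SOLVE :: fcom where
  "SOLVE = WEIGHTS;;
     For 40 3 (Sto 11 (R 40) (K 0));;
     For 58 14 ROUND;;
     Asg 59 (K 0);;
     For 40 3 (EDGES;; Asg 30 (AR 11 (R 40));; EVAL;; Asg 59 (Add (R 59) (R 44)));;
     Asg 61 (R 59);;
     For 20 1 (when_com (Less (K 0) (AR 4 (R 20))) (inc 61));;
     when_com (Conj (Less (R 59) (R 3)) (Le (R 61) (R 2))) (Asg 0 (K 1))"

definition MUL :: "nat \<Rightarrow> nat \<Rightarrow> nat \<Rightarrow> fcom" where
  "MUL r a b = Asg r (K 0);; For 62 a (Asg r (Add (R r) (R b)))"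

definition POW :: "nat \<Rightarrow> nat \<Rightarrow> nat \<Rightarrow> fcom" where
  "POW r b e = Asg r (K 1);; For 61 e (Asg 60 (K 0);; For 62 b (Asg 60 (Add (R 60) (R r)));; Asg r (R 60))"

text \<open>Registers 10 to 13 receive \<open>L + 2\<close>, \<open>B\<close>, \<open>Q\<close> and
  \<open>T\<close> of the dynamic program.\<close>

definition PARAMS :: fcom where
  "PARAMS = Asg 5 (Add (R 4) (K 1));; Asg 19 (Add (R 5) (K 1));;
     Asg 35 (Add (Add (R 5) (R 5)) (Add (R 5) (R 5)));; POW 6 35 5;;
     MUL 8 35 5;; POW 9 36 8;; Asg 37 (Add (R 8) (K 1));; POW 10 37 5;; Asg 10 (Add (R 10) (K 2));;
     MUL 11 35 10;; Asg 11 (Add (R 11) (K 1));; POW 12 11 5;; MUL 13 10 12"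

definition ROWS :: fcom where
  "ROWS = Asg 61 (K 0);; For 40 38 (Sto 16 (R 40) (R 61);; Asg 61 (Add (R 61) (R 13)))"

definition ATTEMPT :: fcom where
  "ATTEMPT = ROWS;; Asg 16 (K 0);;
     For 7 6 (SEARCH;; when_com (Less (R 17) (K 1)) (Asg 16 (K 1);; SOLVE))"

definition INIT :: fcom where
  "INIT = Asg 1 (Mem (K 0));; Asg 2 (Mem (K 1));; Asg 3 (Add (R 1) (K 1));; Asg 38 (Add (R 1) (K 2));;
     Asg 36 (K 3);; Asg 61 (K 0);; For 20 1 (Asg 61 (Add (R 61) (R 1)));; Asg 39 (Add (R 38) (R 61));;
     For 20 39 (Sto 0 (R 20) (Mem (R 20)));;
     Asg 61 (R 38);; For 20 1 (Sto 1 (R 20) (R 61);; Asg 61 (Add (R 61) (R 1)));;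
     MUL 60 3 3;; MUL 14 60 3"

text \<open>Here \<open>p\<close> is one more than register 4. The passes after the first success do
  nothing, so no parameters of a larger \<open>p\<close> are ever computed; this keeps the running
  time a function of the vertex integrity.\<close>

definition MAIN :: fcom where
  "MAIN = INIT;; Asg 15 (K 0);; Asg 0 (K 0);;
     For 4 3 (when_com (Less (R 15) (K 1)) (PARAMS;; ATTEMPT;; Asg 15 (R 16)))"

lemmas program_defs = DECODE_def RELABEL_def MERGE_def LABEL_def PICK_def SEARCH_def EDGES_def ASSIGN_def
  EVAL_def UPDATE_def DPITEM_def DPTABLE_def BACKTRACK_def CHECK_def ROUND_def WEIGHTS_def SOLVE_def
  MUL_def POW_def PARAMS_def ROWS_def ATTEMPT_def INIT_def MAIN_def

lemma wf_MAIN: "wf MAIN"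
  by (simp add: program_defs)

lemma static_ATTEMPT: "limit_regs ATTEMPT \<inter> written_regs ATTEMPT = {}"
  by (simp add: program_defs)

lemma limit_regs_ATTEMPT: "limit_regs ATTEMPT = {1, 3, 5, 6, 8, 9, 11, 13, 14, 19, 38}"
  by (auto simp: program_defs)

section \<open>Correctness of the program\<close>

declare rg_sem [simp] ar_sem [simp] sem.simps(6) [simp del]

text \<open>An invariant rule that also provides the frame: whatever the body does not write is
  known in every pass without being part of \<open>Inv\<close>.\<close>

lemma For_post:
  assumes "wf (For r l p)" "rg s l = int N" "Inv 0 s"
    and "\<And>i t. i < N \<Longrightarrow> frame (For r l p) s t \<Longrightarrow> Inv i t \<Longrightarrow> Inv (Suc i) (sem p (setr r (int i) t))"
    and "\<And>t. frame (For r l p) s t \<Longrightarrow> Inv N t \<Longrightarrow> Post (setr r (int N) t)"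
  shows "Post (sem (For r l p) s)"
proof -
  have N: "nat (rg s l) = N" using assms(2) by simp
  obtain t where "frame (For r l p) s t" "Inv (nat (rg s l)) t" "sem (For r l p) s = setr r (int (nat (rg s l))) t"
    by (rule sem_For_invariant[of r l p Inv s]) (use assms N in auto)
  then show ?thesis using assms(5) N by simp
qed

text \<open>Relates a loop to a \<open>fold\<close> over abstract states; applied twice, it matches
  a double loop with a \<open>fold\<close> over \<open>pair_list\<close>.\<close>

lemma For_fold:
  assumes "wf (For r l p)" "rg s l = int N" "Rel x s"
    and "\<And>i x t. i < N \<Longrightarrow> rg t l = int N \<Longrightarrow> Rel x t \<Longrightarrow> Rel (f i x) (sem p (setr r (int i) t))"
    and "\<And>x t. Rel x t \<Longrightarrow> Rel x (setr r (int N) t)"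
  shows "Rel (fold f [0..<N] x) (sem (For r l p) s)"
proof (rule For_post[where Inv = "\<lambda>i t. Rel (fold f [0..<i] x) t" and N = N])
  fix i t assume a: "i < N" "frame (For r l p) s t" "Rel (fold f [0..<i] x) t"
  have "rg t l = int N" using frame_rg[OF a(2), of l] assms(1,2) by simp
  then show "Rel (fold f [0..<Suc i] x) (sem p (setr r (int i) t))" using assms(4)[of i t] a by simp
qed (use assms in auto)

lemma fold_product: "fold f (List.product xs ys) x = fold (\<lambda>u. fold (\<lambda>v. f (u, v)) ys) xs x"
  by (induction xs arbitrary: x) (simp_all add: fold_map comp_def)

lemma fold_pair_list: "fold f (pair_list n) x = fold (\<lambda>u. fold (\<lambda>v. f (u, v)) [0..<n]) [0..<n] x"
  by (simp add: pair_list_def fold_product)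

lemma wf_procs [simp]: "wf RELABEL" "wf MERGE" "wf LABEL" "wf PICK" "wf SEARCH" "wf EDGES" "k < 32 \<Longrightarrow> wf (ASSIGN k)"
  "wf EVAL" "wf UPDATE" "wf DPITEM" "wf DPTABLE" "wf BACKTRACK" "wf CHECK" "wf ROUND" "wf WEIGHTS" "wf SOLVE"
  "wf PARAMS" "wf ROWS" "wf ATTEMPT" "wf INIT"
  by (simp_all add: program_defs)

lemma written_regs_procs [simp]:
  "written_regs (DECODE k rb rl rlim) = {30, 31, 32, 33, 34}"
  "written_regs RELABEL = {22, 25}"
  "written_regs MERGE = {17, 18, 22, 23, 24, 25}"
  "written_regs LABEL = {17, 18, 20, 21, 22, 23, 24, 25}"
  "written_regs PICK = {20, 25}"
  "written_regs SEARCH = {17, 18, 20, 21, 22, 23, 24, 25, 27, 30, 31, 32, 33, 34}"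
  "written_regs EDGES = {20, 21, 41, 42}"
  "written_regs (ASSIGN k) = {43}"
  "written_regs EVAL = {20, 30, 31, 32, 33, 34, 43, 44, 45}"
  "written_regs UPDATE = {46, 51}"
  "written_regs DPITEM = {20, 21, 30, 31, 32, 33, 34, 41, 42, 43, 44, 45, 46, 48, 51, 52, 53, 54, 55}"
  "written_regs DPTABLE = {20, 21, 30, 31, 32, 33, 34, 40, 41, 42, 43, 44, 45, 46, 48, 51, 52, 53, 54, 55}"
  "written_regs BACKTRACK = {49, 50, 51}"
  "written_regs CHECK = {20, 21, 30, 31, 32, 33, 34, 40, 41, 42, 43, 44, 45, 56}"
  "written_regs WEIGHTS = {20, 60, 61, 62}"
  "written_regs ROWS = {40, 61}"
  by (auto simp: program_defs)

lemma written_arrays_procs [simp]: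
  "written_arrays (DECODE k rb rl rlim) = {k}"
  "written_arrays RELABEL = {5}" "written_arrays MERGE = {5}" "written_arrays LABEL = {5}" "written_arrays PICK = {3, 4}" "written_arrays SEARCH = {2, 3, 4, 5}"
  "written_arrays EDGES = {6, 7}" "written_arrays (ASSIGN k) = {9}" "written_arrays EVAL = {8, 9}" "written_arrays UPDATE = {13, 14, 15}"
  "written_arrays DPITEM = {6, 7, 8, 9, 13, 14, 15}" "written_arrays DPTABLE = {6, 7, 8, 9, 13, 14, 15}"
  "written_arrays BACKTRACK = {12}" "written_arrays CHECK = {6, 7, 8, 9, 17}" "written_arrays WEIGHTS = {10}" "written_arrays ROWS = {16}"
  by (auto simp: program_defs)

lemma written_regs_ROUND [simp]: "written_regs ROUND = written_regs DPTABLE \<union> written_regs BACKTRACK \<union> written_regs CHECK \<union> {57, 63}"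
  by (auto simp: ROUND_def)

lemma written_arrays_ROUND [simp]: "written_arrays ROUND = {6, 7, 8, 9, 11, 12, 13, 14, 15, 17}"
  by (auto simp: ROUND_def)

lemma written_regs_SOLVE [simp]: "written_regs SOLVE = written_regs WEIGHTS \<union> written_regs ROUND \<union> written_regs EVAL \<union> written_regs EDGES \<union> {0, 40, 58, 59, 61}"
  by (auto simp: SOLVE_def)

lemma written_arrays_SOLVE [simp]: "written_arrays SOLVE = {6, 7, 8, 9, 10, 11, 12, 13, 14, 15, 17}"
  by (auto simp: SOLVE_def)

text \<open>The loop has a fixed number \<open>i\<close> of passes, at least the dividend. If it
  subtracts in all of them, then \<open>q = i\<close>, and with \<open>q * b \<le> a \<le> i\<close>
  nothing remains.\<close>

lemma div_mod_by_subtraction: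
  assumes "q * b + r = a" "q = i \<or> r < (b :: nat)" "a \<le> i" "1 \<le> b"
  shows "q = a div b" "r = a mod b"
proof -
  have "r < b"
  proof (rule ccontr)
    assume "\<not> r < b"
    then have "q = i" using assms by simp
    then have "i * b + r \<le> i" using assms by simp
    moreover have "i \<le> i * b" using mult_le_mono2[OF assms(4), of i] by simp
    ultimately have "r = 0" by linarith
    then show False using \<open>\<not> r < b\<close> assms(4) by simp
  qed
  then show "q = a div b" "r = a mod b" using assms(1) by auto
qed

lemma wf_DECODE [simp]:
  "k < 32 \<Longrightarrow> {rl, rlim} \<inter> {30, 31, 32, 33, 34} = {} \<Longrightarrow> wf (DECODE k rb rl rlim)"
  by (auto simp: DECODE_def)

lemma DECODE_spec:
  assumes k: "k < 32" and regs: "{rb, rl, rlim} \<inter> {30, 31, 32, 33, 34} = {}"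
    and b: "rg s rb = int b" "1 \<le> b" and l: "rg s rl = int l" and mx: "rg s rlim = int mx"
    and a: "rg s 30 = int a" "a \<le> mx"
  shows "\<forall>e<l. ar (sem (DECODE k rb rl rlim) s) k (int e) = int ((a div b ^ e) mod b)"
  unfolding DECODE_def
proof (rule For_post[where N = l and
      Inv = "\<lambda>i t. rg t 30 = int (a div b ^ i) \<and> (\<forall>e<i. ar t k (int e) = int ((a div b ^ e) mod b))"])
  show "rg s rl = int l" by fact
  show "rg s 30 = int (a div b ^ 0) \<and> (\<forall>e<0. ar s k (int e) = int ((a div b ^ e) mod b))" using a by simp
next
  fix i t
  let ?in = "For 32 rlim (Ite (Less (R 34) (R rb)) Nop (Asg 34 (Sub (R 34) (R rb));; inc 33))"
  let ?p = "Asg 33 (K 0);; Asg 34 (R 30);; ?in;; Sto k (R 31) (R 34);; Asg 30 (R 33)"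
  assume fr: "frame (For 31 rl ?p) s t"
    and inv: "rg t 30 = int (a div b ^ i) \<and> (\<forall>e<i. ar t k (int e) = int ((a div b ^ e) mod b))"
  define t' where "t' = setr 34 (int (a div b ^ i)) (setr 33 0 (setr 31 (int i) t))"
  have rt: "rg t rb = int b" "rg t rlim = int mx"
    using fr b mx regs by (auto simp: frame_def)
  have "rg (sem ?in t') 33 = int (a div b ^ i div b) \<and> rg (sem ?in t') 34 = int (a div b ^ i mod b) \<and> ar (sem ?in t') k = ar t k \<and> rg (sem ?in t') 31 = int i"
  proof (rule For_post[where N = mx and Inv = "\<lambda>j u. \<exists>q r. rg u 33 = int q \<and> rg u 34 = int r \<and> q * b + r = a div b ^ i \<and> (q = j \<or> r < b)"])
    show "rg t' rlim = int mx" using regs rt by (simp add: t'_def)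
    show "\<exists>q r. rg t' 33 = int q \<and> rg t' 34 = int r \<and> q * b + r = a div b ^ i \<and> (q = 0 \<or> r < b)"
      by (intro exI[of _ 0] exI[of _ "a div b ^ i"]) (simp add: t'_def)
  next
    fix j u
    assume fu: "frame ?in t' u" and "\<exists>q r. rg u 33 = int q \<and> rg u 34 = int r \<and> q * b + r = a div b ^ i \<and> (q = j \<or> r < b)"
    then obtain q r where qr: "rg u 33 = int q" "rg u 34 = int r" "q * b + r = a div b ^ i" "q = j \<or> r < b" by blast
    have rb: "rg u rb = int b" using fu regs rt by (auto simp: frame_def t'_def)
    show "\<exists>q r. rg (sem (Ite (Less (R 34) (R rb)) Nop (Asg 34 (Sub (R 34) (R rb));; inc 33)) (setr 32 (int j) u)) 33 = int q
      \<and> rg (sem (Ite (Less (R 34) (R rb)) Nop (Asg 34 (Sub (R 34) (R rb));; inc 33)) (setr 32 (int j) u)) 34 = int r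
      \<and> q * b + r = a div b ^ i \<and> (q = Suc j \<or> r < b)"
    proof (cases "r < b")
      case True
      then show ?thesis using qr rb regs by (intro exI[of _ q] exI[of _ r]) auto
    next
      case False
      then show ?thesis using qr rb regs by (intro exI[of _ "Suc q"] exI[of _ "r - b"]) (auto simp: of_nat_diff)
    qed
  next
    fix u assume fu: "frame ?in t' u" and "\<exists>q r. rg u 33 = int q \<and> rg u 34 = int r \<and> q * b + r = a div b ^ i \<and> (q = mx \<or> r < b)"
    then obtain q r where qr: "rg u 33 = int q" "rg u 34 = int r" "q * b + r = a div b ^ i" "q = mx \<or> r < b" by blast
    have "a div b ^ i \<le> mx" using a(2) div_le_dividend order_trans by blast
    then have "q = a div b ^ i div b" "r = a div b ^ i mod b" using div_mod_by_subtraction[OF qr(3,4)] b(2) by auto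
    moreover have "ar u k = ar t k" "rg u 31 = int i" using fu k by (auto simp: frame_def t'_def)
    ultimately show "rg (setr 32 (int mx) u) 33 = int (a div b ^ i div b) \<and> rg (setr 32 (int mx) u) 34 = int (a div b ^ i mod b) \<and> ar (setr 32 (int mx) u) k = ar t k \<and> rg (setr 32 (int mx) u) 31 = int i"
      using qr by simp
  qed (use regs in auto)
  then show "rg (sem ?p (setr 31 (int i) t)) 30 = int (a div b ^ Suc i) \<and>
    (\<forall>e<Suc i. ar (sem ?p (setr 31 (int i) t)) k (int e) = int ((a div b ^ e) mod b))"
    using inv k by (auto simp: t'_def less_Suc_eq div_mult2_eq[symmetric] mult.commute)
qed (use k regs in auto)

definition ctx :: "nat \<Rightarrow> nat set set \<Rightarrow> (nat \<Rightarrow> nat) \<Rightarrow> state \<Rightarrow> bool" where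
  "ctx n E c s \<longleftrightarrow> rg s 1 = int n \<and> rg s 3 = int n + 1 \<and> rg s 36 = 3 \<and>
     (\<forall>u<n. \<forall>v<n. ar s 0 (ar s 1 (int u) + int v) = of_bool ({u, v} \<in> E)) \<and>
     (\<forall>v<n. ar s 0 (int v + 2) = int (c v))"

lemma ctx_cong: "rg t 1 = rg s 1 \<Longrightarrow> rg t 3 = rg s 3 \<Longrightarrow> rg t 36 = rg s 36 \<Longrightarrow> ar t 0 = ar s 0 \<Longrightarrow> ar t 1 = ar s 1 \<Longrightarrow>
    ctx n E c t = ctx n E c s"
  by (simp add: ctx_def)

lemma ctx_setr [simp]: "r \<notin> {1, 3, 36} \<Longrightarrow> ctx n E c (setr r v s) = ctx n E c s"
  by (rule ctx_cong) auto

lemma ctx_sem [simp]: "wf p \<Longrightarrow> written_regs p \<inter> {1, 3, 36} = {} \<Longrightarrow> written_arrays p \<inter> {0, 1} = {} \<Longrightarrow> ctx n E c (sem p s) = ctx n E c s"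
  by (rule ctx_cong) (auto intro!: rg_sem ar_sem)

lemma ctx_frame: "frame p s t \<Longrightarrow> ctx n E c s \<Longrightarrow> written_regs p \<inter> {1, 3, 36} = {} \<Longrightarrow> written_arrays p \<inter> {0, 1} = {} \<Longrightarrow> ctx n E c t"
  by (subst ctx_cong[of t s]) (auto simp: frame_def)

definition has_set :: "nat \<Rightarrow> nat \<Rightarrow> nat set \<Rightarrow> state \<Rightarrow> bool" where
  "has_set n k X s \<longleftrightarrow> (\<forall>v<n. ar s k (int v) = of_bool (v \<in> X))"

definition has_fun :: "nat \<Rightarrow> nat \<Rightarrow> (nat \<Rightarrow> nat) \<Rightarrow> state \<Rightarrow> bool" where
  "has_fun n k f s \<longleftrightarrow> (\<forall>v<n. ar s k (int v) = int (f v))"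

lemma card_less_Suc: "card {w. w < Suc i \<and> P w} = card {w. w < i \<and> P w} + of_bool (P i)"
proof -
  have "{w. w < Suc i \<and> P w} = (if P i then insert i {w. w < i \<and> P w} else {w. w < i \<and> P w})"
    by (auto simp: less_Suc_eq)
  then show ?thesis by simp
qed

lemma RELABEL_spec:
  assumes "rg s 1 = int n" "has_fun n 5 lab s" "rg s 23 = int a" "rg s 24 = int b" "rg s 25 = 0"
  shows "has_fun n 5 (\<lambda>w. if lab w = b then a else lab w) (sem RELABEL s) \<and>
    rg (sem RELABEL s) 25 = int (card {w. w < n \<and> (if lab w = b then a else lab w) = a})"
  unfolding RELABEL_def
proof (rule For_post[where N = n and Inv = "\<lambda>i t.
    (\<forall>w<n. ar t 5 (int w) = int (if w < i \<and> lab w = b then a else lab w)) \<and>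
    rg t 25 = int (card {w. w < i \<and> (if lab w = b then a else lab w) = a})"])
  fix i t
  assume i: "i < n" and fr: "frame (For 22 1 (when_com (Eq (AR 5 (R 22)) (R 24)) (Sto 5 (R 22) (R 23));;
     when_com (Eq (AR 5 (R 22)) (R 23)) (inc 25))) s t"
    and inv: "(\<forall>w<n. ar t 5 (int w) = int (if w < i \<and> lab w = b then a else lab w)) \<and>
    rg t 25 = int (card {w. w < i \<and> (if lab w = b then a else lab w) = a})"
  have "rg t 23 = int a" "rg t 24 = int b" using fr assms by (auto simp: frame_def)
  then show "(\<forall>w<n. ar (sem (when_com (Eq (AR 5 (R 22)) (R 24)) (Sto 5 (R 22) (R 23));;
     when_com (Eq (AR 5 (R 22)) (R 23)) (inc 25)) (setr 22 (int i) t)) 5 (int w) = int (if w < Suc i \<and> lab w = b then a else lab w)) \<and>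
    rg (sem (when_com (Eq (AR 5 (R 22)) (R 24)) (Sto 5 (R 22) (R 23));;
     when_com (Eq (AR 5 (R 22)) (R 23)) (inc 25)) (setr 22 (int i) t)) 25 = int (card {w. w < Suc i \<and> (if lab w = b then a else lab w) = a})"
    using inv i unfolding card_less_Suc by (auto simp: less_Suc_eq)
qed (use assms in \<open>auto simp: has_fun_def\<close>)

section \<open>Correctness of the labelling and of the branching search\<close>

definition lab_rel :: "nat \<Rightarrow> nat set set \<Rightarrow> (nat \<Rightarrow> nat) \<Rightarrow> nat \<Rightarrow> nat set \<Rightarrow> (nat \<Rightarrow> nat) \<times> bool \<times> nat \<Rightarrow> state \<Rightarrow> bool" where
  "lab_rel n E c p X st s \<longleftrightarrow> ctx n E c s \<and> rg s 5 = int p \<and> has_set n 3 X s \<and>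
    has_fun n 5 (fst st) s \<and> rg s 17 = of_bool (fst (snd st)) \<and> rg s 18 = int (snd (snd st))"

lemma lab_rel_setr [simp]: "r \<notin> {1, 3, 36, 5, 17, 18} \<Longrightarrow> lab_rel n E c p X st (setr r v s) = lab_rel n E c p X st s"
  by (auto simp: lab_rel_def has_set_def has_fun_def)

lemma MERGE_spec:
  assumes rel: "lab_rel n E c p X (lab, False, l) s" and uv: "rg s 20 = int u" "rg s 21 = int v" "u < n" "v < n"
    and c: "{u, v} \<in> E" "u \<notin> X" "v \<notin> X" "lab u \<noteq> lab v"
  shows "lab_rel n E c p X (merge n p E X (u, v) (lab, False, l)) (sem MERGE s)"
proof -
  define lab' where "lab' w = (if lab w = lab v then lab u else lab w)" for w
  define s' where "s' = setr 25 0 (setr 24 (int (lab v)) (setr 23 (int (lab u)) s))"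
  have r: "has_fun n 5 lab' (sem RELABEL s') \<and> rg (sem RELABEL s') 25 = int (card {w. w < n \<and> lab' w = lab u})"
    unfolding lab'_def
    by (rule RELABEL_spec) (use rel in \<open>auto simp: s'_def lab_rel_def ctx_def has_fun_def\<close>)
  have m: "merge n p E X (u, v) (lab, False, l) = (if p < card {w. w < n \<and> lab' w = lab u} then (lab', True, lab u) else (lab', False, l))"
    using c unfolding merge_def lab'_def[abs_def] Let_def by simp
  have s: "sem MERGE s = sem (when_com (Less (R 5) (R 25)) (Asg 17 (K 1);; Asg 18 (R 23))) (sem RELABEL s')"
    using rel uv by (simp add: MERGE_def s'_def lab_rel_def has_fun_def)
  show ?thesis unfolding m s
    using r rel by (auto simp: lab_rel_def s'_def has_set_def has_fun_def)
qed

lemma LABEL_spec: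
  assumes ctx: "ctx n E c s" and p: "rg s 5 = int p" and X: "has_set n 3 X s"
  shows "lab_rel n E c p X (labels n p E X) (sem LABEL s)"
proof -
  let ?a = "For 20 1 (Ite (Less (K 0) (AR 3 (R 20))) (Sto 5 (R 20) (R 1)) (Sto 5 (R 20) (R 20)))"
  have n: "rg s 1 = int n" using ctx by (simp add: ctx_def)
  have 1: "has_fun n 5 (\<lambda>v. if v \<in> X then n else v) (sem ?a s)"
  proof (rule For_post[where N = n and Inv = "\<lambda>i t. \<forall>v<i. ar t 5 (int v) = int (if v \<in> X then n else v)"])
    fix i t assume i: "i < n" and fr: "frame ?a s t" and inv: "\<forall>v<i. ar t 5 (int v) = int (if v \<in> X then n else v)"
    have "ar t 3 = ar s 3" "rg t 1 = int n" using fr n by (auto simp: frame_def)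
    then show "\<forall>v<Suc i. ar (sem (Ite (Less (K 0) (AR 3 (R 20))) (Sto 5 (R 20) (R 1)) (Sto 5 (R 20) (R 20))) (setr 20 (int i) t)) 5 (int v) = int (if v \<in> X then n else v)"
      using inv i X by (auto simp: has_set_def less_Suc_eq)
  qed (use n in \<open>auto simp: has_fun_def\<close>)
  define s1 where "s1 = setr 18 0 (setr 17 0 (sem ?a s))"
  have init: "lab_rel n E c p X ((\<lambda>v. if v \<in> X then n else v), False, 0) s1"
    using 1 ctx p X unfolding lab_rel_def s1_def by (auto simp: has_fun_def has_set_def)
  let ?b = "when_com (Conj (Less (R 17) (K 1)) (Conj (Less (K 0) (ADJ 20 21)) (Conj (Less (AR 3 (R 20)) (K 1))
         (Conj (Less (AR 3 (R 21)) (K 1)) (Neg (Eq (AR 5 (R 20)) (AR 5 (R 21)))))))) MERGE"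
  have body: "lab_rel n E c p X (merge n p E X (u, v) st) (sem ?b t) \<and> rg (sem ?b t) 20 = int u"
    if "u < n" "v < n" "lab_rel n E c p X st t" "rg t 20 = int u" "rg t 21 = int v" for u v st t
  proof -
    obtain lab big l where st: "st = (lab, big, l)" by (cases st)
    show ?thesis
    proof (cases "\<not> big \<and> {u, v} \<in> E \<and> u \<notin> X \<and> v \<notin> X \<and> lab u \<noteq> lab v")
      case True
      then have "sem ?b t = sem MERGE t" using that st
        by (auto simp: lab_rel_def ctx_def has_set_def has_fun_def)
      then show ?thesis using MERGE_spec[of n E c p X lab l t u v] that st True by simp
    next
      case False
      then have "sem ?b t = t" using that st
        by (auto simp: lab_rel_def ctx_def has_set_def has_fun_def)
      moreover have "merge n p E X (u, v) st = st" using False by (auto simp: merge_def st)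
      ultimately show ?thesis using that by simp
    qed
  qed
  have inner: "lab_rel n E c p X (fold (\<lambda>v. merge n p E X (u, v)) [0..<n] st) (sem (For 21 1 ?b) (setr 20 (int u) t))"
    if "u < n" "lab_rel n E c p X st t" for u st t
  proof -
    have "(\<lambda>st t. lab_rel n E c p X st t \<and> rg t 20 = int u) (fold (\<lambda>v. merge n p E X (u, v)) [0..<n] st) (sem (For 21 1 ?b) (setr 20 (int u) t))"
    proof (rule For_fold)
      show "rg (setr 20 (int u) t) 1 = int n" using that by (auto simp: lab_rel_def ctx_def)
      fix v st' t' assume "v < n" "lab_rel n E c p X st' t' \<and> rg t' 20 = int u"
      then show "lab_rel n E c p X (merge n p E X (u, v) st') (sem ?b (setr 21 (int v) t')) \<and>
          rg (sem ?b (setr 21 (int v) t')) 20 = int u"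
        using body[of u v st' "setr 21 (int v) t'"] that(1) by (simp del: sem.simps)
    qed (use that in auto)
    then show ?thesis by simp
  qed
  have "lab_rel n E c p X (fold (\<lambda>u. fold (\<lambda>v. merge n p E X (u, v)) [0..<n]) [0..<n] ((\<lambda>v. if v \<in> X then n else v), False, 0))
      (sem (For 20 1 (For 21 1 ?b)) s1)"
  proof (rule For_fold[where Rel = "lab_rel n E c p X"])
    show "rg s1 1 = int n" using init by (simp add: lab_rel_def ctx_def)
  qed (use init inner in auto)
  then show ?thesis unfolding labels_def fold_pair_list LABEL_def s1_def by simp
qed

lemma has_set_setr [simp]: "has_set n k X (setr r v s) = has_set n k X s"
  by (simp add: has_set_def)

lemma has_fun_setr [simp]: "has_fun n k X (setr r v s) = has_fun n k X s"
  by (simp add: has_fun_def)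

lemma has_fun_seta [simp]: "k < 32 \<Longrightarrow> k' < 32 \<Longrightarrow> k \<noteq> k' \<Longrightarrow> has_fun n k X (seta k' i v s) = has_fun n k X s"
  by (simp add: has_fun_def)

lemma has_set_sem [simp]: "wf p \<Longrightarrow> k < 32 \<Longrightarrow> k \<notin> written_arrays p \<Longrightarrow> has_set n k X (sem p s) = has_set n k X s"
  by (simp add: has_set_def)

lemma has_fun_sem [simp]: "wf p \<Longrightarrow> k < 32 \<Longrightarrow> k \<notin> written_arrays p \<Longrightarrow> has_fun n k X (sem p s) = has_fun n k X s"
  by (simp add: has_fun_def)

lemma has_fun_frame: "frame p s t \<Longrightarrow> k < 32 \<Longrightarrow> k \<notin> written_arrays p \<Longrightarrow> has_fun n k X t = has_fun n k X s"
  by (simp add: has_fun_def frame_def)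

lemma PICK_spec:
  assumes n: "rg s 1 = int n" and p: "rg s 5 = int p" and X: "has_set n 3 (fst XM) s" and mk: "has_set n 4 (snd XM) s"
    and lab: "has_fun n 5 lab s" and l: "rg s 18 = int l" and d: "ar s 2 (rg s 27) = int d"
  shows "has_set n 3 (fst (pick n p lab l d XM)) (sem PICK s) \<and> has_set n 4 (snd (pick n p lab l d XM)) (sem PICK s)"
proof -
  define rk where "rk i = card {w. w < i \<and> lab w = l}" for i
  define body where "body = when_com (Eq (AR 5 (R 20)) (R 18)) (
     when_com (Eq (R 25) (AR 2 (R 27))) (Sto 3 (R 20) (K 1));;
     when_com (Eq (Add (R 25) (Add (R 5) (R 5))) (AR 2 (R 27))) (Sto 3 (R 20) (K 1);; Sto 4 (R 20) (K 1));;
     inc 25)"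
  have PICK: "PICK = Asg 25 (K 0);; For 20 1 body" by (simp add: PICK_def body_def)
  have wr: "wf body" "written_regs body = {25}" "written_arrays body = {3, 4}"
    by (auto simp: body_def)
  have "(\<lambda>t. has_set n 3 (fst (pick n p lab l d XM)) t \<and> has_set n 4 (snd (pick n p lab l d XM)) t) (sem (For 20 1 body) (setr 25 0 s))"
  proof (rule For_post[where N = n and Inv = "\<lambda>i t. rg t 25 = int (rk i) \<and>
      (\<forall>v<n. ar t 3 (int v) = of_bool (v \<in> fst XM \<or> v < i \<and> lab v = l \<and> (rk v = d \<or> rk v + 2 * p = d))) \<and>
      (\<forall>v<n. ar t 4 (int v) = of_bool (v \<in> snd XM \<or> v < i \<and> lab v = l \<and> rk v + 2 * p = d))"])
    fix i t assume i: "i < n" and fr: "frame (For 20 1 body) (setr 25 0 s) t"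
      and inv: "rg t 25 = int (rk i) \<and>
      (\<forall>v<n. ar t 3 (int v) = of_bool (v \<in> fst XM \<or> v < i \<and> lab v = l \<and> (rk v = d \<or> rk v + 2 * p = d))) \<and>
      (\<forall>v<n. ar t 4 (int v) = of_bool (v \<in> snd XM \<or> v < i \<and> lab v = l \<and> rk v + 2 * p = d))"
    have t: "rg t 18 = int l" "rg t 5 = int p" "ar t 2 (rg t 27) = int d" "\<forall>v<n. ar t 5 (int v) = int (lab v)"
      using fr wr(2,3) l p d lab by (auto simp: frame_def has_fun_def)
    have rS: "rk (Suc i) = rk i + of_bool (lab i = l)" unfolding rk_def by (rule card_less_Suc)
    have e: "(int (rk i) + (int p + int p) = int d) = (rk i + 2 * p = d)" by auto
    show "rg (sem body (setr 20 (int i) t)) 25 = int (rk (Suc i)) \<and>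
      (\<forall>v<n. ar (sem body (setr 20 (int i) t)) 3 (int v) = of_bool (v \<in> fst XM \<or> v < Suc i \<and> lab v = l \<and> (rk v = d \<or> rk v + 2 * p = d))) \<and>
      (\<forall>v<n. ar (sem body (setr 20 (int i) t)) 4 (int v) = of_bool (v \<in> snd XM \<or> v < Suc i \<and> lab v = l \<and> rk v + 2 * p = d))"
      using inv i t unfolding body_def rS by (auto simp: e less_Suc_eq)
  qed (use wr n X mk in \<open>auto simp: rk_def has_set_def pick_def\<close>)
  then show ?thesis by (simp add: PICK)
qed

text \<open>After a failed search nothing is claimed about the arrays, which the additional pick may
  have changed.\<close>

definition searched :: "nat \<Rightarrow> nat \<Rightarrow> nat set set \<Rightarrow> (nat \<Rightarrow> nat) \<Rightarrow> state \<Rightarrow> bool" where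
  "searched n p E d s \<longleftrightarrow> rg s 17 = of_bool (oversized n p E (fst (search n p E d p))) \<and>
     (\<not> oversized n p E (fst (search n p E d p)) \<longrightarrow>
       has_set n 3 (fst (search n p E d p)) s \<and> has_set n 4 (snd (search n p E d p)) s \<and>
       has_fun n 5 (fst (labels n p E (fst (search n p E d p)))) s)"

lemma searched_setr [simp]: "r \<noteq> 17 \<Longrightarrow> searched n p E d (setr r v s) = searched n p E d s"
  by (simp add: searched_def)

lemma SEARCH_spec:
  assumes ctx: "ctx n E c s" and p: "rg s 5 = int p" "1 \<le> p" and p4: "rg s 35 = int (4 * p)" and p1: "rg s 19 = int (Suc p)"
    and G: "rg s 6 = int G" and g: "rg s 7 = int g" "g \<le> G"
  shows "searched n p E (\<lambda>j. (g div (4 * p) ^ j) mod (4 * p)) (sem SEARCH s)"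
proof -
  define d where "d j = (g div (4 * p) ^ j) mod (4 * p)" for j
  define clear where "clear = For 20 1 (Sto 3 (R 20) (K 0);; Sto 4 (R 20) (K 0))"
  define body where "body = LABEL;; when_com (Less (K 0) (R 17)) PICK"
  define s1 where "s1 = sem (DECODE 2 35 5 6) (setr 30 (int g) s)"
  have D: "\<forall>e<p. ar s1 2 (int e) = int (d e)"
    unfolding s1_def d_def by (rule DECODE_spec[where mx = G]) (use p p4 G g in auto)
  have n: "rg s 1 = int n" using ctx by (simp add: ctx_def)
  have clr: "has_set n 3 {} (sem clear s1) \<and> has_set n 4 {} (sem clear s1)"
    unfolding clear_def
  proof (rule For_post[where N = n and Inv = "\<lambda>i t. \<forall>v<i. ar t 3 (int v) = 0 \<and> ar t 4 (int v) = 0"])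
    show "rg s1 1 = int n" using n by (simp add: s1_def)
  qed (auto simp: has_set_def less_Suc_eq)
  define s2 where "s2 = sem clear s1"
  have wc: "wf clear" "written_regs clear = {20}" "written_arrays clear = {3, 4}" by (auto simp: clear_def)
  have wb: "wf body" "written_regs body = {17, 18, 20, 21, 22, 23, 24, 25}" "written_arrays body = {3, 4, 5}"
    by (auto simp: body_def)
  have s2: "ctx n E c s2" "rg s2 5 = int p" "rg s2 19 = int (Suc p)" "ar s2 2 = ar s1 2"
    using ctx p p1 by (simp_all add: s2_def s1_def wc)
  have "searched n p E d (sem (For 27 19 body) s2)"
  \<comment> \<open>The invariant changes its form after pass \<open>p\<close>: the first
    \<open>p\<close> passes follow \<open>search\<close>, the last one only establishes
    \<open>searched\<close>.\<close>
  proof (rule For_post[where N = "Suc p" and Inv = "\<lambda>i t. if i \<le> p then has_set n 3 (fst (search n p E d i)) t \<and>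
      has_set n 4 (snd (search n p E d i)) t else searched n p E d t"])
    fix i t assume i: "i < Suc p" and fr: "frame (For 27 19 body) s2 t"
      and inv: "if i \<le> p then has_set n 3 (fst (search n p E d i)) t \<and>
      has_set n 4 (snd (search n p E d i)) t else searched n p E d t"
    define XM where "XM = search n p E d i"
    have X: "has_set n 3 (fst XM) t" "has_set n 4 (snd XM) t" using inv i by (auto simp: XM_def)
    have tc: "ctx n E c t" by (rule ctx_frame[OF fr s2(1)]) (simp_all add: wb)
    have tp: "rg t 5 = int p" "ar t 2 = ar s1 2" using fr s2 wb by (auto simp: frame_def)
    obtain lab big l where lb: "labels n p E (fst XM) = (lab, big, l)" by (metis prod_cases3)
    define t' where "t' = sem LABEL (setr 27 (int i) t)"
    have L: "lab_rel n E c p (fst XM) (lab, big, l) t'"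
      unfolding t'_def lb[symmetric] by (rule LABEL_spec) (use tc tp X in auto)
    have mk: "has_set n 4 (snd XM) t'" using X by (simp add: t'_def)
    have ov: "oversized n p E (fst XM) = big" by (simp add: oversized_def lb)
    have sS: "search n p E d (Suc i) = (if big then pick n p lab l (d i) XM else XM)"
      by (simp add: search_Suc search_step_def lb flip: XM_def)
    show "if Suc i \<le> p then has_set n 3 (fst (search n p E d (Suc i))) (sem body (setr 27 (int i) t)) \<and>
      has_set n 4 (snd (search n p E d (Suc i))) (sem body (setr 27 (int i) t)) else searched n p E d (sem body (setr 27 (int i) t))"
    proof (cases "Suc i \<le> p")
      case True
      have "has_set n 3 (fst (pick n p lab l (d i) XM)) (sem PICK t') \<and> has_set n 4 (snd (pick n p lab l (d i) XM)) (sem PICK t')"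
      proof (rule PICK_spec)
        show "ar t' 2 (rg t' 27) = int (d i)" using D True tp by (simp add: t'_def)
      qed (use L mk in \<open>auto simp: lab_rel_def ctx_def\<close>)
      then show ?thesis using True L mk by (auto simp: body_def sS t'_def[symmetric] lab_rel_def)
    next
      case False
      then have "i = p" using i by simp
      then have XM: "search n p E d p = XM" by (simp add: XM_def)
      show ?thesis using False L mk
        by (auto simp: searched_def XM ov lb body_def t'_def[symmetric] lab_rel_def)
    qed
  qed (use wb s2 clr in \<open>auto simp: search_def s2_def\<close>)
  moreover have "sem SEARCH s = sem (For 27 19 body) s2"
    using g by (simp add: SEARCH_def s2_def s1_def clear_def body_def)
  ultimately show ?thesis by (simp add: d_def[abs_def])
qed

section \<open>Correctness of collecting the edges of an item and evaluating an option\<close>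

definition edges_rel :: "(nat \<times> nat) list \<Rightarrow> state \<Rightarrow> bool" where
  "edges_rel es s \<longleftrightarrow> rg s 41 = int (length es) \<and>
     (\<forall>e<length es. ar s 6 (int e) = int (fst (es ! e)) \<and> ar s 7 (int e) = int (snd (es ! e)))"

lemma edges_rel_setr [simp]: "r \<noteq> 41 \<Longrightarrow> edges_rel es (setr r v s) = edges_rel es s"
  by (simp add: edges_rel_def)

lemma fold_filter_append: "fold (\<lambda>x ys. if P x then ys @ [x] else ys) xs ys = ys @ filter P xs"
  by (induction xs arbitrary: ys) auto

lemma EDGES_spec:
  assumes ctx: "ctx n E c s" and X: "has_set n 3 X s" and lab: "has_fun n 5 lab s" and i: "rg s 40 = int i"
  shows "edges_rel (item_edges n E X lab i) (sem EDGES s)"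
proof -
  define P where "P uv = (case uv of (u, v) \<Rightarrow> v < u \<and> {u, v} \<in> E \<and> item_of X lab u v = i)" for uv
  define f where "f uv xs = (if P uv then xs @ [uv] else xs)" for uv xs
  define body where "body = when_com (Conj (Less (R 21) (R 20)) (Less (K 0) (ADJ 20 21))) (
     Ite (Less (K 0) (AR 3 (R 20))) (Asg 42 (AR 5 (R 21))) (Asg 42 (AR 5 (R 20)));;
     when_com (Eq (R 42) (R 40)) (Sto 6 (R 41) (R 20);; Sto 7 (R 41) (R 21);; inc 41))"
  have E: "EDGES = Asg 41 (K 0);; For 20 1 (For 21 1 body)" by (simp add: EDGES_def body_def)
  define Rel where "Rel xs t \<longleftrightarrow> edges_rel xs t \<and> ctx n E c t \<and> has_set n 3 X t \<and> has_fun n 5 lab t \<and> rg t 40 = int i" for xs t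
  have wb: "wf body" "written_regs body = {41, 42}" "written_arrays body = {6, 7}" by (auto simp: body_def)
  have Rset: "Rel xs (setr r v t) = Rel xs t" if "r \<in> {20, 21}" for xs r v t
    using that by (auto simp: Rel_def)
  have body: "Rel (f (u, v) xs) (sem body t) \<and> rg (sem body t) 20 = int u"
    if uv: "u < n" "v < n" "Rel xs t" "rg t 20 = int u" "rg t 21 = int v" for u v xs t
  proof -
    have er: "edges_rel (f (u, v) xs) (sem body t)"
      using uv by (auto simp: body_def f_def P_def Rel_def ctx_def has_set_def has_fun_def item_of_def
          edges_rel_def nth_append less_Suc_eq)
    show ?thesis using uv er by (auto simp: Rel_def wb)
  qed
  have inner: "Rel (fold (\<lambda>v. f (u, v)) [0..<n] xs) (sem (For 21 1 body) (setr 20 (int u) t))"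
    if u: "u < n" "Rel xs t" for u xs t
  proof -
    have "(\<lambda>st t. Rel st t \<and> rg t 20 = int u) (fold (\<lambda>v. f (u, v)) [0..<n] xs) (sem (For 21 1 body) (setr 20 (int u) t))"
    proof (rule For_fold)
      show "wf (For 21 1 body)" by (simp add: wb)
      show "rg (setr 20 (int u) t) 1 = int n" using u by (auto simp: Rel_def ctx_def)
      show "Rel xs (setr 20 (int u) t) \<and> rg (setr 20 (int u) t) 20 = int u" using u Rset by simp
      fix v xs' t' assume "v < n" "Rel xs' t' \<and> rg t' 20 = int u"
      then show "Rel (f (u, v) xs') (sem body (setr 21 (int v) t')) \<and> rg (sem body (setr 21 (int v) t')) 20 = int u"
        using body[of u v xs' "setr 21 (int v) t'"] u(1) Rset by simp
    qed (use Rset in auto)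
    then show ?thesis by simp
  qed
  have "Rel (fold (\<lambda>u. fold (\<lambda>v. f (u, v)) [0..<n]) [0..<n] []) (sem (For 20 1 (For 21 1 body)) (setr 41 0 s))"
  proof (rule For_fold[where Rel = Rel])
    show "wf (For 20 1 (For 21 1 body))" by (simp add: wb)
    show "rg (setr 41 0 s) 1 = int n" using ctx by (simp add: ctx_def)
    show "Rel [] (setr 41 0 s)" using ctx X lab i by (simp add: Rel_def edges_rel_def)
  qed (use Rset inner in auto)
  moreover have "fold (\<lambda>u. fold (\<lambda>v. f (u, v)) [0..<n]) [0..<n] [] = fold f (pair_list n) []"
    by (simp only: fold_pair_list)
  moreover have "fold f (pair_list n) [] = item_edges n E X lab i"
    unfolding f_def[abs_def] fold_filter_append item_edges_def by (simp add: P_def[abs_def])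
  ultimately show ?thesis by (simp add: E Rel_def)
qed

lemma EVAL_spec:
  assumes ctx: "ctx n E c s" and X: "has_set n 3 X s" and es: "edges_rel es s" "set es \<subseteq> {..<n} \<times> {..<n}"
    and ME: "length es \<le> ME" "rg s 8 = int ME" and A: "rg s 9 = int A" and a: "rg s 30 = int a" "a \<le> A"
    and pw: "\<forall>v<n. ar s 10 (int v) = pw v"
  shows "rg (sem EVAL s) 43 = (\<Sum>v<n. int (load_at es a v) * pw v) \<and>
    rg (sem EVAL s) 44 = int (item_cost n X c es a) \<and> has_fun n 9 (load_at es a) (sem EVAL s)"
proof -
  define dec where "dec = DECODE 8 36 8 9"
  define clear where "clear = For 20 1 (Sto 9 (R 20) (K 0))"
  define b1 where "b1 = when_com (Less (R 45) (R 41)) (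
       Ite (Eq (AR 8 (R 45)) (K 0)) (Asg 44 (Add (R 44) (R 3)))
         (Ite (Eq (AR 8 (R 45)) (K 1)) (ASSIGN 6) (ASSIGN 7)))"
  define b2 where "b2 = when_com (Less (AR 3 (R 20)) (K 1)) (
       when_com (Less (K 0) (AR 9 (R 20))) (inc 44);;
       when_com (Less (CAPA 20) (AR 9 (R 20))) (Asg 44 (Add (R 44) (R 3))))"
  have EV: "EVAL = dec;; clear;; Asg 43 (K 0);; Asg 44 (K 0);; For 45 8 b1;; For 20 1 b2"
    by (simp add: EVAL_def dec_def clear_def b1_def b2_def)
  have wf: "wf dec" "written_regs dec = {30, 31, 32, 33, 34}" "written_arrays dec = {8}" "wf clear" "written_regs clear = {20}" "written_arrays clear = {9}"
    "wf b1" "written_regs b1 = {43, 44}" "written_arrays b1 = {9}" "wf b2" "written_regs b2 = {44}" "written_arrays b2 = {}"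
    by (auto simp: dec_def clear_def b1_def b2_def ASSIGN_def)
  have n: "rg s 1 = int n" and n3: "rg s 3 = int n + 1" "rg s 36 = 3" using ctx by (simp_all add: ctx_def)
  define s1 where "s1 = sem dec s"
  have D: "\<forall>e<ME. ar s1 8 (int e) = int (digit3 a e)"
    unfolding s1_def dec_def digit3_def by (rule DECODE_spec[where mx = A]) (use ME A a n3 in auto)
  define s2 where "s2 = sem clear s1"
  have c0: "has_fun n 9 (\<lambda>_. 0) s2"
    unfolding s2_def clear_def
  proof (rule For_post[where N = n and Inv = "\<lambda>i t. \<forall>v<i. ar t 9 (int v) = 0"])
    show "rg s1 1 = int n" using n by (simp add: s1_def wf)
  qed (auto simp: has_fun_def less_Suc_eq)
  define s3 where "s3 = setr 44 0 (setr 43 0 s2)"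
  \<comment> \<open>The counts are cut off at \<open>length es\<close> as well, in accordance with
    the loop that runs to \<open>ME\<close> and skips positions beyond the list; at
    \<open>ME\<close> they are the full counts.\<close>
  define ld where "ld i v = card {e. e < i \<and> (e < length es \<and> target (es ! e) (digit3 a e) = Some v)}" for i v
  define un where "un i = card {e. e < i \<and> (e < length es \<and> digit3 a e = 0)}" for i
  have ldS: "ld (Suc i) v = ld i v + of_bool (i < length es \<and> target (es ! i) (digit3 a i) = Some v)" for i v
    unfolding ld_def by (rule card_less_Suc)
  have unS: "un (Suc i) = un i + of_bool (i < length es \<and> digit3 a i = 0)" for i
    unfolding un_def by (rule card_less_Suc)
  have "{e. e < ME \<and> (e < length es \<and> Pr e)} = {e. e < length es \<and> Pr e}" for Pr using ME by auto
  then have ldM: "ld ME = load_at es a" and unM: "un ME = card {e. e < length es \<and> digit3 a e = 0}"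
    by (auto simp: ld_def[abs_def] load_at_def[abs_def] un_def)
  define s4 where "s4 = sem (For 45 8 b1) s3"
  have s3: "ctx n E c s3" "has_set n 3 X s3" "edges_rel es s3" "\<forall>e<ME. ar s3 8 (int e) = int (digit3 a e)"
    "\<forall>v<n. ar s3 10 (int v) = pw v" "rg s3 8 = int ME"
    using ctx X es D pw ME by (simp_all add: s3_def s2_def s1_def wf edges_rel_def)
  have "has_fun n 9 (ld ME) s4 \<and> rg s4 44 = (int n + 1) * int (un ME) \<and> rg s4 43 = (\<Sum>v<n. int (ld ME v) * pw v)"
    unfolding s4_def
  proof (rule For_post[where N = ME and Inv = "\<lambda>i t. has_fun n 9 (ld i) t \<and> rg t 44 = (int n + 1) * int (un i) \<and>
      rg t 43 = (\<Sum>v<n. int (ld i v) * pw v)"])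
    fix i t assume i: "i < ME" and fr: "frame (For 45 8 b1) s3 t" and inv: "has_fun n 9 (ld i) t \<and>
      rg t 44 = (int n + 1) * int (un i) \<and> rg t 43 = (\<Sum>v<n. int (ld i v) * pw v)"
    have t: "rg t 3 = int n + 1" "edges_rel es t" "ar t 8 (int i) = int (digit3 a i)" "\<forall>v<n. ar t 10 (int v) = pw v"
      using fr s3 i wf by (auto simp: frame_def ctx_def edges_rel_def)
    show "has_fun n 9 (ld (Suc i)) (sem b1 (setr 45 (int i) t)) \<and> rg (sem b1 (setr 45 (int i) t)) 44 = (int n + 1) * int (un (Suc i)) \<and>
      rg (sem b1 (setr 45 (int i) t)) 43 = (\<Sum>v<n. int (ld (Suc i) v) * pw v)"
    proof (cases "i < length es")
      case False
      then show ?thesis using inv t unfolding ldS unS b1_def by (simp add: edges_rel_def has_fun_def)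
    next
      case True
      obtain u v where uv: "es ! i = (u, v)" by fastforce
      have uvn: "u < n" "v < n" using nth_mem[OF True] uv es(2) by auto
      have a67: "ar t 6 (int i) = int u" "ar t 7 (int i) = int v" "rg t 41 = int (length es)"
        using t(2) True uv by (auto simp: edges_rel_def)
      have sum1: "(\<Sum>y<n. (int (ld i y) + of_bool (x = y)) * pw y) = (\<Sum>y<n. int (ld i y) * pw y) + pw x"
        if "x < n" for x
        using that by (simp add: distrib_right sum.distrib of_bool_def if_distrib[of "\<lambda>b. b * _"] sum.delta' cong: if_cong)
      have asg: "has_fun n 9 (\<lambda>y. ld i y + of_bool (x = y)) (sem (ASSIGN k) (setr 45 (int i) t)) \<and>
          rg (sem (ASSIGN k) (setr 45 (int i) t)) 43 = (\<Sum>y<n. (int (ld i y) + of_bool (x = y)) * pw y)"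
        if "k \<in> {6, 7}" "ar t k (int i) = int x" "x < n" for k x
        unfolding sum1[OF that(3)] using that inv t(4) by (auto simp: ASSIGN_def has_fun_def)
      have d3: "digit3 a i < 3" by (simp add: digit3_def)
      then consider "digit3 a i = 0" | "digit3 a i = 1" | "digit3 a i = 2" by linarith
      then show ?thesis
      proof cases
        case 1
        then show ?thesis using inv t a67 True unfolding ldS unS b1_def
          by (simp add: target_def has_fun_def distrib_left)
      next
        case 2
        then show ?thesis using inv t a67 True uv asg[of 6 u] uvn unfolding ldS unS b1_def
          by (simp add: target_def)
      next
        case 3
        then show ?thesis using inv t a67 True uv asg[of 7 v] uvn unfolding ldS unS b1_def
          by (simp add: target_def)
      qed
    qed
  next
    show "has_fun n 9 (ld 0) s3 \<and> rg s3 44 = (int n + 1) * int (un 0) \<and> rg s3 43 = (\<Sum>v<n. int (ld 0 v) * pw v)"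
      using c0 by (simp add: s3_def ld_def un_def has_fun_def)
  qed (use s3 wf in auto)
  then have s4: "has_fun n 9 (load_at es a) s4" "rg s4 44 = (int n + 1) * int (un ME)"
    "rg s4 43 = (\<Sum>v<n. int (load_at es a v) * pw v)" by (auto simp: ldM)
  have s4c: "ctx n E c s4" "has_set n 3 X s4" using s3 by (simp_all add: s4_def wf)
  have "rg (sem (For 20 1 b2) s4) 44 = int (item_cost n X c es a)"
  proof (rule For_post[where N = n and Inv = "\<lambda>i t. rg t 44 = (int n + 1) * int (un ME) +
      int (card {v. v < i \<and> (v \<notin> X \<and> 0 < load_at es a v)}) + (int n + 1) * int (card {v. v < i \<and> (v \<notin> X \<and> c v < load_at es a v)})"])
    show "rg s4 1 = int n" using s4c by (simp add: ctx_def)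
  next
    fix i t assume i: "i < n" and fr: "frame (For 20 1 b2) s4 t"
      and inv: "rg t 44 = (int n + 1) * int (un ME) +
      int (card {v. v < i \<and> (v \<notin> X \<and> 0 < load_at es a v)}) + (int n + 1) * int (card {v. v < i \<and> (v \<notin> X \<and> c v < load_at es a v)})"
    have t: "rg t 3 = int n + 1" "ar t 3 (int i) = of_bool (i \<in> X)" "ar t 9 (int i) = int (load_at es a i)" "ar t 0 (int i + 2) = int (c i)"
      using fr s4 s4c i wf by (auto simp: frame_def ctx_def has_set_def has_fun_def)
    show "rg (sem b2 (setr 20 (int i) t)) 44 = (int n + 1) * int (un ME) +
      int (card {v. v < Suc i \<and> (v \<notin> X \<and> 0 < load_at es a v)}) + (int n + 1) * int (card {v. v < Suc i \<and> (v \<notin> X \<and> c v < load_at es a v)})"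
      using inv t unfolding card_less_Suc b2_def by (simp add: algebra_simps)
  qed (use s4 wf in \<open>auto simp: item_cost_def unM algebra_simps\<close>)
  moreover have "sem EVAL s = sem (For 20 1 b2) s4"
    by (simp add: EV s4_def s3_def s2_def s1_def)
  ultimately show ?thesis using s4 wf by (simp add: has_fun_def)
qed

lemma WEIGHTS_spec:
  assumes n: "rg s 1 = int n" and X: "has_set n 3 X s" and B: "rg s 11 = B" "0 \<le> B"
  shows "\<forall>v<n. ar (sem WEIGHTS s) 10 (int v) = (if v \<in> X then B ^ card (X \<inter> {..<v}) else 0)"
proof -
  define mul where "mul = For 62 11 (Asg 61 (Add (R 61) (R 60)))"
  define body where "body = Sto 10 (R 20) (K 0);; when_com (Less (K 0) (AR 3 (R 20))) (
     Sto 10 (R 20) (R 60);; Asg 61 (K 0);; mul;; Asg 60 (R 61))"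
  have W: "WEIGHTS = Asg 60 (K 1);; For 20 1 body" by (simp add: WEIGHTS_def body_def mul_def)
  have wf: "wf mul" "written_regs mul = {61, 62}" "written_arrays mul = {}" by (auto simp: mul_def)
  have wb: "wf body" "written_regs body = {60, 61, 62}" "written_arrays body = {10}" by (auto simp: body_def wf)
  have mul: "rg (sem mul t) 61 = rg t 11 * rg t 60" if "rg t 61 = 0" "0 \<le> rg t 11" for t
    unfolding mul_def
  proof (rule For_post[where N = "nat (rg t 11)" and Inv = "\<lambda>j u. rg u 61 = int j * rg t 60"])
    fix j u assume "frame (For 62 11 (Asg 61 (Add (R 61) (R 60)))) t u" "rg u 61 = int j * rg t 60"
    then show "rg (sem (Asg 61 (Add (R 61) (R 60))) (setr 62 (int j) u)) 61 = int (Suc j) * rg t 60"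
      by (simp add: frame_def algebra_simps)
  qed (use that in auto)
  have "\<forall>v<n. ar (sem (For 20 1 body) (setr 60 1 s)) 10 (int v) = (if v \<in> X then B ^ card (X \<inter> {..<v}) else 0)"
  proof (rule For_post[where N = n and Inv = "\<lambda>i t. rg t 60 = B ^ card (X \<inter> {..<i}) \<and>
      (\<forall>v<i. ar t 10 (int v) = (if v \<in> X then B ^ card (X \<inter> {..<v}) else 0))"])
    fix i t assume i: "i < n" and fr: "frame (For 20 1 body) (setr 60 1 s) t"
      and inv: "rg t 60 = B ^ card (X \<inter> {..<i}) \<and>
      (\<forall>v<i. ar t 10 (int v) = (if v \<in> X then B ^ card (X \<inter> {..<v}) else 0))"
    have t: "rg t 11 = B" "ar t 3 (int i) = of_bool (i \<in> X)"
      using fr B X i wb by (auto simp: frame_def has_set_def)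
    have cS: "card (X \<inter> {..<Suc i}) = card (X \<inter> {..<i}) + of_bool (i \<in> X)"
    proof -
      have "X \<inter> {..<Suc i} = (if i \<in> X then insert i (X \<inter> {..<i}) else X \<inter> {..<i})" by (auto simp: less_Suc_eq)
      then show ?thesis by simp
    qed
    show "rg (sem body (setr 20 (int i) t)) 60 = B ^ card (X \<inter> {..<Suc i}) \<and>
      (\<forall>v<Suc i. ar (sem body (setr 20 (int i) t)) 10 (int v) = (if v \<in> X then B ^ card (X \<inter> {..<v}) else 0))"
      unfolding cS using inv t B by (auto simp: body_def wf mul less_Suc_eq)
  qed (use n wb in auto)
  then show ?thesis by (simp add: W)
qed

section \<open>Correctness of the table for a fixed separator and guess\<close>

locale solver = separation +
  fixes c :: "nat \<Rightarrow> nat" and mk :: "nat set" and big :: nat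
  assumes mkX: "mk \<subseteq> X"
begin

definition opts :: nat where "opts = 3 ^ (4 * p * p)"

text \<open>Each of the labels below \<open>n\<close> counts as an item, whether it occurs or not;
  item \<open>n\<close> has the edges inside \<open>X\<close>.\<close>

sublocale dp: choice_dp "n + 1" opts p X "\<lambda>i a x. load_at (es i) a x" "\<lambda>i a. item_cost n X c (es i) a" "mask_cap mk c"
  by unfold_locales (use finX cardX p1 load_at_le in auto)

text \<open>Register 14 serves twice: as the number of rounds and as the start value of the table.
  Both merely have to exceed the cost of the initial choice.\<close>

definition solver_state :: "state \<Rightarrow> bool" where
  "solver_state s \<longleftrightarrow> ctx n E c s \<and> has_set n 3 X s \<and> has_set n 4 mk s \<and> has_fun n 5 lab s \<and>
     rg s 8 = int (4 * p * p) \<and> rg s 9 = int opts \<and> rg s 12 = dp.Q \<and> rg s 13 = dp.T \<and> rg s 14 = int big \<and>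
     (\<forall>v<n. ar s 10 (int v) = dp.pw v) \<and> (\<forall>i\<le>n+1. ar s 16 (int i) = int i * dp.T)"

text \<open>\<open>SR\<close> and \<open>SA\<close> list what \<open>solver_state\<close> depends
  on, so that its preservation reduces to disjointness from what a program writes.\<close>

definition SR :: "nat set" where "SR = {1, 3, 36, 8, 9, 12, 13, 14}"
definition SA :: "nat set" where "SA = {0, 1, 3, 4, 5, 10, 16}"

lemma solver_state_cong: "(\<And>r. r \<in> SR \<Longrightarrow> rg t r = rg s r) \<Longrightarrow> (\<And>k. k \<in> SA \<Longrightarrow> ar t k = ar s k) \<Longrightarrow> solver_state t = solver_state s"
  by (simp add: solver_state_def SR_def SA_def ctx_def has_set_def has_fun_def)

lemma solver_state_setr [simp]: "r \<notin> SR \<Longrightarrow> solver_state (setr r v s) = solver_state s"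
  by (rule solver_state_cong) auto

lemma solver_state_seta [simp]: "k < 32 \<Longrightarrow> k \<notin> SA \<Longrightarrow> solver_state (seta k i v s) = solver_state s"
  by (rule solver_state_cong) (auto simp: SA_def)

lemma solver_state_sem [simp]: "wf q \<Longrightarrow> written_regs q \<inter> SR = {} \<Longrightarrow> written_arrays q \<inter> SA = {} \<Longrightarrow> solver_state (sem q s) = solver_state s"
  by (rule solver_state_cong; rule rg_sem ar_sem) (auto simp: SA_def)

lemma solver_state_frame: "frame q s t \<Longrightarrow> solver_state s \<Longrightarrow> written_regs q \<inter> SR = {} \<Longrightarrow> written_arrays q \<inter> SA = {} \<Longrightarrow> solver_state t"
  by (subst solver_state_cong[of t s]) (auto simp: frame_def SA_def)

lemma item_spec:
  assumes s: "solver_state s" and i: "rg s 40 = int i" and a: "aval e (sem EDGES s) = int a" "a < opts"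
  defines "t \<equiv> sem EVAL (sem (Asg 30 e) (sem EDGES s))"
  shows "rg t 43 = dp.code i a" "rg t 44 = int (item_cost n X c (es i) a)" "has_fun n 9 (load_at (es i) a) t"
proof -
  have "rg t 43 = (\<Sum>v<n. int (load_at (es i) a v) * dp.pw v) \<and>
    rg t 44 = int (item_cost n X c (es i) a) \<and> has_fun n 9 (load_at (es i) a) t"
    unfolding t_def
  proof (rule EVAL_spec)
    show "edges_rel (es i) (sem (Asg 30 e) (sem EDGES s))"
      using EDGES_spec[of n E c s X lab i] s i by (simp add: solver_state_def)
    show "length (es i) \<le> 4 * p * p" by (rule length_es)
    show "set (es i) \<subseteq> {..<n} \<times> {..<n}" by (auto simp: set_item_edges)
  qed (use s a in \<open>auto simp: solver_state_def\<close>)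
  moreover have "(\<Sum>v<n. int (load_at (es i) a v) * dp.pw v) = dp.code i a"
    unfolding dp.code_def using XV by (intro sum.mono_neutral_right) (auto simp: dp.pw_def)
  ultimately show "rg t 43 = dp.code i a" "rg t 44 = int (item_cost n X c (es i) a)" "has_fun n 9 (load_at (es i) a) t"
    by auto
qed

end

context solver
begin

text \<open>Describes row \<open>i + 1\<close> while it is computed from the finished row
  \<open>D0\<close>; \<open>Done\<close> holds the pairs of option and source index that have been
  relaxed.\<close>

definition rowinv :: "(nat \<Rightarrow> nat) \<Rightarrow> nat \<Rightarrow> (int \<Rightarrow> int) \<Rightarrow> (nat \<times> int) set \<Rightarrow> (int \<Rightarrow> int) \<Rightarrow> (int \<Rightarrow> int) \<Rightarrow> (int \<Rightarrow> int) \<Rightarrow> bool" where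
  "rowinv z i D0 Done D CH PJ \<longleftrightarrow>
    (\<forall>j. 0 \<le> j \<and> j < dp.T \<longrightarrow>
      (0 \<le> PJ j \<and> PJ j < dp.T \<and> 0 \<le> CH j \<and> CH j < int opts \<and>
       D j = D0 (PJ j) + dp.wd z i (nat (CH j)) \<and>
       (PJ j = j \<and> CH j = int (z i) \<or> j = PJ j + dp.sh z i (nat (CH j)))) \<and>
      D j \<le> D0 j) \<and>
    (\<forall>(a, j)\<in>Done. 0 \<le> j \<and> j < dp.T \<and> 0 \<le> j + dp.sh z i a \<and> j + dp.sh z i a < dp.T \<longrightarrow>
      D (j + dp.sh z i a) \<le> D0 j + dp.wd z i a)"

lemma rowinv_update:
  assumes inv: "rowinv z i D0 Done D CH PJ" and a: "a < opts" and j: "0 \<le> j" "j < dp.T"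
    and less: "D0 j + dp.wd z i a < D (j + dp.sh z i a)"
  shows "rowinv z i D0 (insert (a, j) Done) (D(j + dp.sh z i a := D0 j + dp.wd z i a))
    (CH(j + dp.sh z i a := int a)) (PJ(j + dp.sh z i a := j))"
  unfolding rowinv_def
proof (intro conjI)
  show "\<forall>ja. 0 \<le> ja \<and> ja < dp.T \<longrightarrow>
      (0 \<le> (PJ(j + dp.sh z i a := j)) ja \<and> (PJ(j + dp.sh z i a := j)) ja < dp.T \<and>
       0 \<le> (CH(j + dp.sh z i a := int a)) ja \<and> (CH(j + dp.sh z i a := int a)) ja < int opts \<and>
       (D(j + dp.sh z i a := D0 j + dp.wd z i a)) ja =
         D0 ((PJ(j + dp.sh z i a := j)) ja) + dp.wd z i (nat ((CH(j + dp.sh z i a := int a)) ja)) \<and>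
       ((PJ(j + dp.sh z i a := j)) ja = ja \<and> (CH(j + dp.sh z i a := int a)) ja = int (z i) \<or>
        ja = (PJ(j + dp.sh z i a := j)) ja + dp.sh z i (nat ((CH(j + dp.sh z i a := int a)) ja)))) \<and>
      (D(j + dp.sh z i a := D0 j + dp.wd z i a)) ja \<le> D0 ja"
  proof (intro allI impI)
    fix j' assume j': "0 \<le> j' \<and> j' < dp.T"
    then have I: "(0 \<le> PJ j' \<and> PJ j' < dp.T \<and> 0 \<le> CH j' \<and> CH j' < int opts \<and>
       D j' = D0 (PJ j') + dp.wd z i (nat (CH j')) \<and>
       (PJ j' = j' \<and> CH j' = int (z i) \<or> j' = PJ j' + dp.sh z i (nat (CH j')))) \<and> D j' \<le> D0 j'"
      using inv unfolding rowinv_def by blast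
    show "(0 \<le> (PJ(j + dp.sh z i a := j)) j' \<and> (PJ(j + dp.sh z i a := j)) j' < dp.T \<and>
       0 \<le> (CH(j + dp.sh z i a := int a)) j' \<and> (CH(j + dp.sh z i a := int a)) j' < int opts \<and>
       (D(j + dp.sh z i a := D0 j + dp.wd z i a)) j' =
         D0 ((PJ(j + dp.sh z i a := j)) j') + dp.wd z i (nat ((CH(j + dp.sh z i a := int a)) j')) \<and>
       ((PJ(j + dp.sh z i a := j)) j' = j' \<and> (CH(j + dp.sh z i a := int a)) j' = int (z i) \<or>
        j' = (PJ(j + dp.sh z i a := j)) j' + dp.sh z i (nat ((CH(j + dp.sh z i a := int a)) j')))) \<and>
      (D(j + dp.sh z i a := D0 j + dp.wd z i a)) j' \<le> D0 j'"
      using I a j less by (cases "j' = j + dp.sh z i a") auto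
  qed
  show "\<forall>(a', j')\<in>insert (a, j) Done. 0 \<le> j' \<and> j' < dp.T \<and> 0 \<le> j' + dp.sh z i a' \<and> j' + dp.sh z i a' < dp.T \<longrightarrow>
      (D(j + dp.sh z i a := D0 j + dp.wd z i a)) (j' + dp.sh z i a') \<le> D0 j' + dp.wd z i a'"
    using inv less unfolding rowinv_def by fastforce
qed

lemma rowinv_skip:
  assumes inv: "rowinv z i D0 Done D CH PJ"
    and no: "\<not> (0 \<le> j + dp.sh z i a \<and> j + dp.sh z i a < dp.T \<and> D0 j + dp.wd z i a < D (j + dp.sh z i a))"
  shows "rowinv z i D0 (insert (a, j) Done) D CH PJ"
  using assms unfolding rowinv_def by auto

lemma table_cong:
  assumes tab: "dp.table z b D CH PJ m"
    and eq: "\<And>i j. i \<le> m \<Longrightarrow> 0 \<le> j \<Longrightarrow> j < dp.T \<Longrightarrow> D' i j = D i j \<and> CH' i j = CH i j \<and> PJ' i j = PJ i j"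
  shows "dp.table z b D' CH' PJ' m"
proof -
  note T = tab[unfolded dp.table_def]
  have h1: "\<forall>j. 0 \<le> j \<and> j < dp.T \<longrightarrow> D' 0 j = (if j = dp.Q then 0 else b)"
    using conjunct1[OF T] eq[of 0] by simp
  have h2: "\<forall>i j. i < m \<and> 0 \<le> j \<and> j < dp.T \<longrightarrow>
      0 \<le> PJ' (Suc i) j \<and> PJ' (Suc i) j < dp.T \<and> 0 \<le> CH' (Suc i) j \<and> CH' (Suc i) j < int opts \<and>
      D' (Suc i) j = D' i (PJ' (Suc i) j) + dp.wd z i (nat (CH' (Suc i) j)) \<and>
      (PJ' (Suc i) j = j \<and> CH' (Suc i) j = int (z i) \<or> j = PJ' (Suc i) j + dp.sh z i (nat (CH' (Suc i) j)))"
  proof (intro allI impI)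
    fix i j assume a: "i < m \<and> 0 \<le> j \<and> j < dp.T"
    have S: "0 \<le> PJ (Suc i) j \<and> PJ (Suc i) j < dp.T \<and> 0 \<le> CH (Suc i) j \<and> CH (Suc i) j < int opts \<and>
      D (Suc i) j = D i (PJ (Suc i) j) + dp.wd z i (nat (CH (Suc i) j)) \<and>
      (PJ (Suc i) j = j \<and> CH (Suc i) j = int (z i) \<or> j = PJ (Suc i) j + dp.sh z i (nat (CH (Suc i) j)))"
      using T a by blast
    have "D' (Suc i) j = D (Suc i) j \<and> CH' (Suc i) j = CH (Suc i) j \<and> PJ' (Suc i) j = PJ (Suc i) j"
      "D' i (PJ (Suc i) j) = D i (PJ (Suc i) j)" using a S eq by auto
    then show "0 \<le> PJ' (Suc i) j \<and> PJ' (Suc i) j < dp.T \<and> 0 \<le> CH' (Suc i) j \<and> CH' (Suc i) j < int opts \<and>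
      D' (Suc i) j = D' i (PJ' (Suc i) j) + dp.wd z i (nat (CH' (Suc i) j)) \<and>
      (PJ' (Suc i) j = j \<and> CH' (Suc i) j = int (z i) \<or> j = PJ' (Suc i) j + dp.sh z i (nat (CH' (Suc i) j)))"
      using S by (simp only:)
  qed
  have h3: "\<forall>i j. i < m \<and> 0 \<le> j \<and> j < dp.T \<longrightarrow> D' (Suc i) j \<le> D' i j"
  proof (intro allI impI)
    fix i j assume a: "i < m \<and> 0 \<le> j \<and> j < dp.T"
    then have "D (Suc i) j \<le> D i j" using T by blast
    then show "D' (Suc i) j \<le> D' i j" using a by (simp add: eq)
  qed
  have h4: "\<forall>i a j. i < m \<and> a < opts \<and> 0 \<le> j \<and> j < dp.T \<and> 0 \<le> j + dp.sh z i a \<and> j + dp.sh z i a < dp.T \<longrightarrow>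
      D' (Suc i) (j + dp.sh z i a) \<le> D' i j + dp.wd z i a"
  proof (intro allI impI)
    fix i a j assume a: "i < m \<and> a < opts \<and> 0 \<le> j \<and> j < dp.T \<and> 0 \<le> j + dp.sh z i a \<and> j + dp.sh z i a < dp.T"
    then have "D (Suc i) (j + dp.sh z i a) \<le> D i j + dp.wd z i a" using T by blast
    then show "D' (Suc i) (j + dp.sh z i a) \<le> D' i j + dp.wd z i a" using a by (simp add: eq)
  qed
  show ?thesis unfolding dp.table_def by (intro conjI h1 h2 h3 h4)
qed

lemma table_Suc:
  assumes tab: "dp.table z b D CH PJ m" and row: "rowinv z m (D m) Done (D (Suc m)) (CH (Suc m)) (PJ (Suc m))"
    and Done: "\<And>a j. a < opts \<Longrightarrow> 0 \<le> j \<Longrightarrow> j < dp.T \<Longrightarrow> (a, j) \<in> Done"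
  shows "dp.table z b D CH PJ (Suc m)"
proof -
  have 1: "(0 \<le> PJ (Suc m) j \<and> PJ (Suc m) j < dp.T \<and> 0 \<le> CH (Suc m) j \<and> CH (Suc m) j < int opts \<and>
       D (Suc m) j = D m (PJ (Suc m) j) + dp.wd z m (nat (CH (Suc m) j)) \<and>
       (PJ (Suc m) j = j \<and> CH (Suc m) j = int (z m) \<or> j = PJ (Suc m) j + dp.sh z m (nat (CH (Suc m) j)))) \<and>
      D (Suc m) j \<le> D m j" if "0 \<le> j" "j < dp.T" for j
    using row that unfolding rowinv_def by blast
  have 2: "D (Suc m) (j + dp.sh z m a) \<le> D m j + dp.wd z m a"
    if "a < opts" "0 \<le> j" "j < dp.T" "0 \<le> j + dp.sh z m a" "j + dp.sh z m a < dp.T" for a j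
    using row Done[OF that(1-3)] that unfolding rowinv_def by blast
  show ?thesis
    unfolding dp.table_def
  proof (intro conjI)
    note T = tab[unfolded dp.table_def]
    show "\<forall>j. 0 \<le> j \<and> j < dp.T \<longrightarrow> D 0 j = (if j = dp.Q then 0 else b)" by (rule conjunct1[OF T])
    show "\<forall>i j. i < Suc m \<and> 0 \<le> j \<and> j < dp.T \<longrightarrow>
      0 \<le> PJ (Suc i) j \<and> PJ (Suc i) j < dp.T \<and> 0 \<le> CH (Suc i) j \<and> CH (Suc i) j < int opts \<and>
      D (Suc i) j = D i (PJ (Suc i) j) + dp.wd z i (nat (CH (Suc i) j)) \<and>
      (PJ (Suc i) j = j \<and> CH (Suc i) j = int (z i) \<or> j = PJ (Suc i) j + dp.sh z i (nat (CH (Suc i) j)))"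
    proof (intro allI impI, elim conjE)
      fix i j assume a: "i < Suc m" "0 \<le> j" "j < dp.T"
      from a(1) show "0 \<le> PJ (Suc i) j \<and> PJ (Suc i) j < dp.T \<and> 0 \<le> CH (Suc i) j \<and> CH (Suc i) j < int opts \<and>
        D (Suc i) j = D i (PJ (Suc i) j) + dp.wd z i (nat (CH (Suc i) j)) \<and>
        (PJ (Suc i) j = j \<and> CH (Suc i) j = int (z i) \<or> j = PJ (Suc i) j + dp.sh z i (nat (CH (Suc i) j)))"
      proof (rule less_SucE)
        assume "i < m"
        then show ?thesis using T a(2,3) by blast
      next
        assume "i = m"
        then show ?thesis using 1[OF a(2,3)] by (simp only:)
      qed
    qed
    show "\<forall>i j. i < Suc m \<and> 0 \<le> j \<and> j < dp.T \<longrightarrow> D (Suc i) j \<le> D i j"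
    proof (intro allI impI, elim conjE)
      fix i j assume a: "i < Suc m" "0 \<le> j" "j < dp.T"
      from a(1) show "D (Suc i) j \<le> D i j"
      proof (rule less_SucE)
        assume "i < m"
        then show ?thesis using T a(2,3) by blast
      next
        assume "i = m"
        then show ?thesis using conjunct2[OF 1[OF a(2,3)]] by (simp only:)
      qed
    qed
    show "\<forall>i a j. i < Suc m \<and> a < opts \<and> 0 \<le> j \<and> j < dp.T \<and> 0 \<le> j + dp.sh z i a \<and> j + dp.sh z i a < dp.T \<longrightarrow>
      D (Suc i) (j + dp.sh z i a) \<le> D i j + dp.wd z i a"
    proof (intro allI impI, elim conjE)
      fix i a j assume a: "i < Suc m" "a < opts" "0 \<le> j" "j < dp.T" "0 \<le> j + dp.sh z i a" "j + dp.sh z i a < dp.T"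
      from a(1) show "D (Suc i) (j + dp.sh z i a) \<le> D i j + dp.wd z i a"
      proof (rule less_SucE)
        assume "i < m"
        then show ?thesis using T a(2-) by blast
      next
        assume "i = m"
        then show ?thesis using 2[of a j] a by simp
      qed
    qed
  qed
qed

definition row :: "state \<Rightarrow> nat \<Rightarrow> nat \<Rightarrow> int \<Rightarrow> int" where
  "row t k i j = ar t k (int i * dp.T + j)"

lemma row_setr [simp]: "row (setr r v s) = row s"
  by (simp add: row_def fun_eq_iff)

lemma row_seta: "k < 32 \<Longrightarrow> k' < 32 \<Longrightarrow> row (seta k' (int i * dp.T + j) v s) k i =
    (if k = k' then (row s k i)(j := v) else row s k i)"
  by (auto simp: row_def fun_eq_iff)

lemma row_sem [simp]: "wf q \<Longrightarrow> k < 32 \<Longrightarrow> k \<notin> written_arrays q \<Longrightarrow> row (sem q s) k = row s k"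
  by (simp add: row_def fun_eq_iff)

text \<open>All rows lie in one array, row \<open>i\<close> starting at cell \<open>i * T\<close>.
  Confining the changes to one row keeps the finished rows valid.\<close>

definition outside :: "nat \<Rightarrow> state \<Rightarrow> state \<Rightarrow> bool" where
  "outside i s t \<longleftrightarrow> (\<forall>k\<in>{13, 14, 15}. \<forall>x. \<not> (int i * dp.T \<le> x \<and> x < int i * dp.T + dp.T) \<longrightarrow> ar t k x = ar s k x)"

lemma outside_trans: "outside i s t \<Longrightarrow> outside i t u \<Longrightarrow> outside i s u"
  by (simp add: outside_def)

lemma outside_refl [simp]: "outside i s s"
  by (simp add: outside_def)

lemma outside_setr [simp]: "outside i s (setr r v t) = outside i s t" "outside i (setr r v s) t = outside i s t"
  by (simp_all add: outside_def)

lemma T_pos: "0 < dp.T"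
  unfolding dp.T_def using dp.Q_pos dp.one_le_L by simp

lemma outside_row:
  assumes "outside (Suc i) s t" "i' \<le> i" "0 \<le> j" "j < dp.T" "k \<in> {13, 14, 15}"
  shows "row t k i' j = row s k i' j"
proof -
  have "int i' * dp.T \<le> int i * dp.T" using assms(2) T_pos by (intro mult_right_mono) auto
  then have "int i' * dp.T + j < int (Suc i) * dp.T" using assms(4) by (simp add: distrib_right)
  then show ?thesis using assms(1,5) by (auto simp: outside_def row_def)
qed

lemma solver_state_row_start:
  assumes "solver_state t" "i \<le> n"
  shows "ar t 16 (int i) = int i * dp.T" "ar t 16 (int i + 1) = int (Suc i) * dp.T"
proof -
  have a: "\<forall>i\<le>n+1. ar t 16 (int i) = int i * dp.T" using assms(1) by (simp add: solver_state_def)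
  show "ar t 16 (int i) = int i * dp.T" using a assms(2) by simp
  have "ar t 16 (int (Suc i)) = int (Suc i) * dp.T" using a assms(2) by (intro a[rule_format]) simp
  then show "ar t 16 (int i + 1) = int (Suc i) * dp.T" by (simp add: add.commute)
qed

lemma UPDATE_spec:
  assumes s: "solver_state s" and i: "rg s 40 = int i" "i \<le> n" and a: "rg s 48 = int a" "a < opts"
    and sh: "rg s 54 = dp.sh z i a" and wd: "rg s 55 = dp.wd z i a"
    and inv: "rowinv z i D0 Done (row s 13 (Suc i)) (row s 14 (Suc i)) (row s 15 (Suc i))"
    and D0: "\<And>j. 0 \<le> j \<Longrightarrow> j < dp.T \<Longrightarrow> row s 13 i j = D0 j"
  shows "rowinv z i D0 (Done \<union> {a} \<times> {0..<dp.T}) (row (sem UPDATE s) 13 (Suc i)) (row (sem UPDATE s) 14 (Suc i)) (row (sem UPDATE s) 15 (Suc i))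
    \<and> outside (Suc i) s (sem UPDATE s)"
proof -
  define body where "body = Asg 51 (Add (R 46) (R 54));;
     when_com (Conj (Le (K 0) (R 51)) (Conj (Less (R 51) (R 13))
         (Less (Add (CELL 13 (R 40) (R 46)) (R 55)) (CELL 13 NEXT (R 51)))))
       (PUT 13 NEXT (R 51) (Add (CELL 13 (R 40) (R 46)) (R 55));;
        PUT 14 NEXT (R 51) (R 48);; PUT 15 NEXT (R 51) (R 46))"
  have U: "UPDATE = For 46 13 body" by (simp add: UPDATE_def body_def)
  have wb: "wf body" "written_regs body = {51}" "written_arrays body = {13, 14, 15}" by (auto simp: body_def)
  have TT: "{0..<dp.T} = int ` {..<nat dp.T}" using T_pos by (simp add: lessThan_atLeast0 image_int_atLeastLessThan)
  show ?thesis
    unfolding U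
  proof (rule For_post[where N = "nat dp.T" and Inv = "\<lambda>j t. rowinv z i D0 (Done \<union> {a} \<times> int ` {..<j}) (row t 13 (Suc i)) (row t 14 (Suc i)) (row t 15 (Suc i))
      \<and> outside (Suc i) s t"])
    show "rg s 13 = int (nat dp.T)" using s T_pos by (simp add: solver_state_def)
  next
    fix j t assume j: "j < nat dp.T" and fr: "frame (For 46 13 body) s t"
      and I: "rowinv z i D0 (Done \<union> {a} \<times> int ` {..<j}) (row t 13 (Suc i)) (row t 14 (Suc i)) (row t 15 (Suc i)) \<and> outside (Suc i) s t"
    have sc: "solver_state t" by (rule solver_state_frame[OF fr s]) (auto simp: wb SR_def SA_def)
    then have a16: "ar t 16 (int i) = int i * dp.T" "ar t 16 (int i + 1) = int (Suc i) * dp.T" "rg t 13 = dp.T"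
      by (auto simp: solver_state_row_start[OF _ i(2)] solver_state_def)
    have rt: "rg t 40 = int i" "rg t 48 = int a" "rg t 54 = dp.sh z i a" "rg t 55 = dp.wd z i a"
      using fr i a sh wd wb by (auto simp: frame_def)
    have jT: "int j < dp.T" using j by linarith
    have d0: "ar t 13 (int i * dp.T + int j) = D0 (int j)"
      using outside_row[of i s t i "int j" 13] I D0[of "int j"] jT by (simp add: row_def)
    define j2 where "j2 = int j + dp.sh z i a"
    have ins: "Done \<union> {a} \<times> int ` {..<Suc j} = insert (a, int j) (Done \<union> {a} \<times> int ` {..<j})"
      by (auto simp: lessThan_Suc)
    show "rowinv z i D0 (Done \<union> {a} \<times> int ` {..<Suc j}) (row (sem body (setr 46 (int j) t)) 13 (Suc i))
        (row (sem body (setr 46 (int j) t)) 14 (Suc i)) (row (sem body (setr 46 (int j) t)) 15 (Suc i)) \<and>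
      outside (Suc i) s (sem body (setr 46 (int j) t))"
    proof (cases "0 \<le> j2 \<and> j2 < dp.T \<and> D0 (int j) + dp.wd z i a < row t 13 (Suc i) j2")
      case True
      then have e: "sem body (setr 46 (int j) t) =
          seta 15 (int (Suc i) * dp.T + j2) (int j) (seta 14 (int (Suc i) * dp.T + j2) (int a)
           (seta 13 (int (Suc i) * dp.T + j2) (D0 (int j) + dp.wd z i a) (setr 51 j2 (setr 46 (int j) t))))"
        using a16 rt d0 by (simp add: body_def j2_def row_def)
      have "outside (Suc i) s (sem body (setr 46 (int j) t))"
        using I True unfolding e by (auto simp: outside_def)
      then show ?thesis unfolding ins using rowinv_update[of z i D0 "Done \<union> {a} \<times> int ` {..<j}" "row t 13 (Suc i)" "row t 14 (Suc i)" "row t 15 (Suc i)" a "int j"]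
          I True a(2) jT unfolding e by (simp add: row_seta j2_def del: of_nat_Suc)
    next
      case False
      then have e: "sem body (setr 46 (int j) t) = setr 51 j2 (setr 46 (int j) t)"
        using a16 rt d0 by (auto simp: body_def j2_def row_def)
      show ?thesis unfolding ins e using rowinv_skip[of z i D0 "Done \<union> {a} \<times> int ` {..<j}" "row t 13 (Suc i)" "row t 14 (Suc i)" "row t 15 (Suc i)" "int j" a]
          I False by (simp add: j2_def)
    qed
  qed (use inv wb in \<open>auto simp: TT\<close>)
qed

definition tab :: "(nat \<Rightarrow> nat) \<Rightarrow> nat \<Rightarrow> state \<Rightarrow> bool" where
  "tab z m s \<longleftrightarrow> dp.table z (int big) (row s 13) (row s 14) (row s 15) m"

lemma DPITEM_spec:
  assumes s: "solver_state s" and i: "rg s 40 = int i" "i \<le> n" and z: "has_fun (n + 1) 11 z s" "z i < opts"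
    and t: "tab z i s"
  shows "tab z (Suc i) (sem DPITEM s)"
proof -
  define cp where "cp = For 46 13 (PUT 13 NEXT (R 46) (CELL 13 (R 40) (R 46));; PUT 14 NEXT (R 46) (AR 11 (R 40));;
       PUT 15 NEXT (R 46) (R 46))"
  define body where "body = Asg 30 (R 48);; EVAL;; Asg 54 (Sub (Add (R 12) (R 43)) (R 52));; Asg 55 (Sub (R 44) (R 53));; UPDATE"
  have wf: "wf cp" "written_regs cp = {46}" "written_arrays cp = {13, 14, 15}" by (auto simp: cp_def)
  have wb: "wf body" "written_regs body = {20, 30, 31, 32, 33, 34, 43, 44, 45, 46, 51, 54, 55}" "written_arrays body = {8, 9, 13, 14, 15}"
    by (auto simp: body_def)
  define s1 where "s1 = sem EVAL (sem (Asg 30 (AR 11 (R 40))) (sem EDGES s))"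
  have z0: "aval (AR 11 (R 40)) (sem EDGES s) = int (z i)" using i z by (simp add: has_fun_def)
  note ev = item_spec[OF s i(1) z0 z(2), folded s1_def]
  have er: "edges_rel (es i) s1"
    using EDGES_spec[of n E c s X lab i] s i by (simp add: solver_state_def s1_def edges_rel_def)
  define s2 where "s2 = setr 53 (rg s1 44) (setr 52 (rg s1 43) s1)"
  have s2: "solver_state s2" "rg s2 40 = int i" "rg s2 52 = dp.code i (z i)" "rg s2 53 = int (item_cost n X c (es i) (z i))"
    "ar s2 11 = ar s 11" "edges_rel (es i) s2" "outside (Suc i) s s2"
    using s i ev er by (simp_all add: s2_def s1_def SR_def SA_def outside_def)
  define D0 where "D0 = row s 13 i"
  have row2: "row s2 13 i = D0" by (simp add: s2_def s1_def D0_def)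
  define s3 where "s3 = sem cp s2"
  \<comment> \<open>The copied row records that item \<open>i\<close> keeps its option, at no cost
    since \<open>wd z i (z i) = 0\<close>; this is the invariant before any relaxation.\<close>
  have s3: "rowinv z i D0 {} (row s3 13 (Suc i)) (row s3 14 (Suc i)) (row s3 15 (Suc i)) \<and> outside (Suc i) s s3"
    unfolding s3_def cp_def
  proof (rule For_post[where N = "nat dp.T" and Inv = "\<lambda>j t. (\<forall>x. 0 \<le> x \<and> x < int j \<longrightarrow> row t 13 (Suc i) x = D0 x \<and>
      row t 14 (Suc i) x = int (z i) \<and> row t 15 (Suc i) x = x) \<and> outside (Suc i) s t"])
    show "rg s2 13 = int (nat dp.T)" using s2 T_pos by (simp add: solver_state_def)
  next
    fix j t
    let ?b = "PUT 13 NEXT (R 46) (CELL 13 (R 40) (R 46));; PUT 14 NEXT (R 46) (AR 11 (R 40));; PUT 15 NEXT (R 46) (R 46)"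
    assume j: "j < nat dp.T" and fr: "frame (For 46 13 ?b) s2 t"
      and I: "(\<forall>x. 0 \<le> x \<and> x < int j \<longrightarrow> row t 13 (Suc i) x = D0 x \<and> row t 14 (Suc i) x = int (z i) \<and> row t 15 (Suc i) x = x) \<and> outside (Suc i) s t"
    have sc: "solver_state t" by (rule solver_state_frame[OF fr s2(1)]) (auto simp: SR_def SA_def)
    then have a16: "ar t 16 (int i) = int i * dp.T" "ar t 16 (int i + 1) = int (Suc i) * dp.T"
      by (auto simp: solver_state_row_start[OF _ i(2)] solver_state_def)
    have rt: "rg t 40 = int i" "ar t 11 = ar s 11" using fr s2 by (auto simp: frame_def)
    have jT: "int j < dp.T" using j by linarith
    have d0: "ar t 13 (int i * dp.T + int j) = D0 (int j)"
      using outside_row[of i s t i "int j" 13] I jT by (simp add: row_def D0_def)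
    have e: "sem ?b (setr 46 (int j) t) =
          seta 15 (int (Suc i) * dp.T + int j) (int j) (seta 14 (int (Suc i) * dp.T + int j) (int (z i))
           (seta 13 (int (Suc i) * dp.T + int j) (D0 (int j)) (setr 46 (int j) t)))"
      using a16 rt d0 z i by (simp add: has_fun_def)
    have o: "outside (Suc i) s (sem ?b (setr 46 (int j) t))" using I jT unfolding e by (auto simp: outside_def)
    show "(\<forall>x. 0 \<le> x \<and> x < int (Suc j) \<longrightarrow> row (sem ?b (setr 46 (int j) t)) 13 (Suc i) x = D0 x \<and>
      row (sem ?b (setr 46 (int j) t)) 14 (Suc i) x = int (z i) \<and> row (sem ?b (setr 46 (int j) t)) 15 (Suc i) x = x) \<and>
      outside (Suc i) s (sem ?b (setr 46 (int j) t))"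
      using I o unfolding e by (auto simp: row_seta simp del: of_nat_Suc)
  next
    fix t assume I: "(\<forall>x. 0 \<le> x \<and> x < int (nat dp.T) \<longrightarrow> row t 13 (Suc i) x = D0 x \<and> row t 14 (Suc i) x = int (z i) \<and> row t 15 (Suc i) x = x) \<and> outside (Suc i) s t"
    then show "rowinv z i D0 {} (row (setr 46 (int (nat dp.T)) t) 13 (Suc i)) (row (setr 46 (int (nat dp.T)) t) 14 (Suc i))
        (row (setr 46 (int (nat dp.T)) t) 15 (Suc i)) \<and> outside (Suc i) s (setr 46 (int (nat dp.T)) t)"
      using z(2) by (auto simp: rowinv_def dp.wd_def)
  qed (use s2 in auto)
  have s3': "solver_state s3" "rg s3 40 = int i" "rg s3 52 = dp.code i (z i)" "rg s3 53 = int (item_cost n X c (es i) (z i))"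
    "edges_rel (es i) s3"
    using s2 by (simp_all add: s3_def wf SR_def SA_def edges_rel_def)
  have fin: "rowinv z i D0 ({..<opts} \<times> {0..<dp.T}) (row (sem (For 48 9 body) s3) 13 (Suc i)) (row (sem (For 48 9 body) s3) 14 (Suc i))
     (row (sem (For 48 9 body) s3) 15 (Suc i)) \<and> outside (Suc i) s (sem (For 48 9 body) s3)"
  proof (rule For_post[where N = opts and Inv = "\<lambda>a t. rowinv z i D0 ({..<a} \<times> {0..<dp.T}) (row t 13 (Suc i)) (row t 14 (Suc i))
     (row t 15 (Suc i)) \<and> outside (Suc i) s t"])
    show "rg s3 9 = int opts" using s3' by (simp add: solver_state_def)
  next
    fix a t assume a: "a < opts" and fr: "frame (For 48 9 body) s3 t"
      and I: "rowinv z i D0 ({..<a} \<times> {0..<dp.T}) (row t 13 (Suc i)) (row t 14 (Suc i)) (row t 15 (Suc i)) \<and> outside (Suc i) s t"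
    have sc: "solver_state t" by (rule solver_state_frame[OF fr s3'(1)]) (auto simp: wb SR_def SA_def)
    have tt: "rg t 40 = int i" "rg t 52 = dp.code i (z i)" "rg t 53 = int (item_cost n X c (es i) (z i))" "edges_rel (es i) t"
      using fr s3' wb by (auto simp: frame_def edges_rel_def)
    define u where "u = sem EVAL (setr 30 (int a) (setr 48 (int a) t))"
    have "rg u 43 = (\<Sum>v<n. int (load_at (es i) a v) * dp.pw v) \<and>
      rg u 44 = int (item_cost n X c (es i) a) \<and> has_fun n 9 (load_at (es i) a) u"
      unfolding u_def
    proof (rule EVAL_spec)
      show "length (es i) \<le> 4 * p * p" by (rule length_es)
      show "set (es i) \<subseteq> {..<n} \<times> {..<n}" by (auto simp: set_item_edges)
    qed (use sc tt a in \<open>auto simp: solver_state_def\<close>)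
    moreover have "(\<Sum>v<n. int (load_at (es i) a v) * dp.pw v) = dp.code i a"
      unfolding dp.code_def using XV by (intro sum.mono_neutral_right) (auto simp: dp.pw_def)
    ultimately have ev: "rg u 43 = dp.code i a" "rg u 44 = int (item_cost n X c (es i) a)" by auto
    define v where "v = setr 55 (rg u 44 - rg u 53) (setr 54 (rg u 12 + rg u 43 - rg u 52) u)"
    have e: "sem body (setr 48 (int a) t) = sem UPDATE v" by (simp add: body_def u_def v_def)
    have scv: "solver_state v" using sc by (simp add: v_def u_def SR_def SA_def)
    have ov: "outside (Suc i) s v" using I by (simp add: v_def u_def outside_def)
    have "rowinv z i D0 ({..<a} \<times> {0..<dp.T} \<union> {a} \<times> {0..<dp.T}) (row (sem UPDATE v) 13 (Suc i)) (row (sem UPDATE v) 14 (Suc i))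
      (row (sem UPDATE v) 15 (Suc i)) \<and> outside (Suc i) v (sem UPDATE v)"
    proof (rule UPDATE_spec[OF scv])
      show "rg v 54 = dp.sh z i a" "rg v 55 = dp.wd z i a"
        using sc tt ev by (simp_all add: v_def u_def[symmetric] dp.sh_def dp.wd_def) (simp_all add: u_def solver_state_def)
      show "row v 13 i j = D0 j" if "0 \<le> j" "j < dp.T" for j
        using outside_row[OF ov order_refl that, of 13] by (simp add: D0_def)
    qed (use tt i a I in \<open>simp_all add: v_def u_def\<close>)
    moreover have "{..<Suc a} \<times> {0..<dp.T} = {..<a} \<times> {0..<dp.T} \<union> {a} \<times> {0..<dp.T}" by (auto simp: less_Suc_eq)
    ultimately show "rowinv z i D0 ({..<Suc a} \<times> {0..<dp.T}) (row (sem body (setr 48 (int a) t)) 13 (Suc i)) (row (sem body (setr 48 (int a) t)) 14 (Suc i))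
      (row (sem body (setr 48 (int a) t)) 15 (Suc i)) \<and> outside (Suc i) s (sem body (setr 48 (int a) t))"
      unfolding e using outside_trans[OF ov] by simp
  qed (use s3 wb in auto)
  have S: "sem DPITEM s = sem (For 48 9 body) s3"
    by (simp add: DPITEM_def cp_def body_def s3_def s2_def s1_def)
  define t' where "t' = sem DPITEM s"
  have o: "outside (Suc i) s t'" using fin by (simp add: t'_def S)
  have ti: "dp.table z (int big) (row t' 13) (row t' 14) (row t' 15) i"
    by (rule table_cong[OF t[unfolded tab_def]]) (use outside_row[OF o] in auto)
  show ?thesis unfolding tab_def t'_def[symmetric]
  proof (rule table_Suc[OF ti])
    have eq: "row t' 13 i j = D0 j" if "0 \<le> j" "j < dp.T" for j
      using outside_row[OF o order_refl that, of 13] by (simp add: D0_def)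
    have "rowinv z i D0 ({..<opts} \<times> {0..<dp.T}) (row t' 13 (Suc i)) (row t' 14 (Suc i)) (row t' 15 (Suc i))"
      using fin by (simp add: t'_def S)
    then show "rowinv z i (row t' 13 i) ({..<opts} \<times> {0..<dp.T}) (row t' 13 (Suc i)) (row t' 14 (Suc i)) (row t' 15 (Suc i))"
      unfolding rowinv_def using eq by auto
  qed auto
qed

lemma DPTABLE_spec:
  assumes s: "solver_state s" and z: "has_fun (n + 1) 11 z s" "\<forall>i<n+1. z i < opts"
  shows "tab z (n + 1) (sem DPTABLE s)"
proof -
  define ini where "ini = For 46 13 (Sto 13 (R 46) (R 14))"
  have wi: "wf ini" "written_regs ini = {46}" "written_arrays ini = {13}" by (auto simp: ini_def)
  have i1: "\<forall>j. 0 \<le> j \<and> j < dp.T \<longrightarrow> ar (sem ini s) 13 j = int big"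
    unfolding ini_def
  proof (rule For_post[where N = "nat dp.T" and Inv = "\<lambda>i t. \<forall>j. 0 \<le> j \<and> j < int i \<longrightarrow> ar t 13 j = int big"])
    show "rg s 13 = int (nat dp.T)" using s T_pos by (simp add: solver_state_def)
    fix i t assume "frame (For 46 13 (Sto 13 (R 46) (R 14))) s t" "\<forall>j. 0 \<le> j \<and> j < int i \<longrightarrow> ar t 13 j = int big"
    then show "\<forall>j. 0 \<le> j \<and> j < int (Suc i) \<longrightarrow> ar (sem (Sto 13 (R 46) (R 14)) (setr 46 (int i) t)) 13 j = int big"
      using s by (auto simp: frame_def solver_state_def)
  qed auto
  define s2 where "s2 = seta 13 (rg (sem ini s) 12) 0 (sem ini s)"
  have s2: "solver_state s2" "has_fun (n + 1) 11 z s2"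
    using s z by (simp_all add: s2_def wi SR_def SA_def)
  have Q: "rg (sem ini s) 12 = dp.Q" using s by (simp add: wi solver_state_def)
  have t0: "tab z 0 s2"
    using i1 unfolding tab_def dp.table_def by (simp add: row_def s2_def Q)
  have "tab z (n + 1) (sem (For 40 3 DPITEM) s2)"
  proof (rule For_post[where N = "n + 1" and Inv = "\<lambda>i t. tab z i t"])
    show "rg s2 3 = int (n + 1)" using s2 by (simp add: solver_state_def ctx_def)
    fix i t assume i: "i < n + 1" and fr: "frame (For 40 3 DPITEM) s2 t" and I: "tab z i t"
    have sc: "solver_state t" by (rule solver_state_frame[OF fr s2(1)]) (auto simp: SR_def SA_def)
    have zt: "has_fun (n + 1) 11 z t" using has_fun_frame[OF fr, of 11] s2(2) by simp
    show "tab z (Suc i) (sem DPITEM (setr 40 (int i) t))"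
      by (rule DPITEM_spec) (use sc zt i z I in \<open>auto simp: SR_def tab_def\<close>)
  qed (use t0 in \<open>auto simp: tab_def\<close>)
  then show ?thesis by (simp add: DPTABLE_def ini_def s2_def)
qed

end

section \<open>Backtracking, the capacity check and the improvement rounds\<close>

context solver
begin

lemma tab_setr [simp]: "tab z m (setr r v s) = tab z m s"
  by (simp add: tab_def)

lemma BACKTRACK_spec:
  assumes s: "solver_state s" and t: "tab z (n + 1) s" and j: "rg s 63 = j" "0 \<le> j" "j < dp.T"
  shows "has_fun (n + 1) 12 (dp.backtrack (row s 14) (row s 15) j) (sem BACKTRACK s)"
proof -
  define bt where "bt = dp.backtrack (row s 14) (row s 15) j"
  define bi where "bi = dp.bidx (row s 15) j"
  define body where "body = Asg 50 (Sub (R 1) (R 49));;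
     Sto 12 (R 50) (CELL 14 (Add (R 50) (K 1)) (R 51));;
     Asg 51 (CELL 15 (Add (R 50) (K 1)) (R 51))"
  have wb: "wf body" "written_regs body = {50, 51}" "written_arrays body = {12}" by (auto simp: body_def)
  have bi: "0 \<le> bi m \<and> bi m < dp.T" if "m \<le> n + 1" for m
    using dp.backtrack_invariant[OF t[unfolded tab_def] j(2,3) that] by (auto simp: bi_def)
  have ch: "0 \<le> row s 14 (Suc i) x" if "i < n + 1" "0 \<le> x" "x < dp.T" for i x
    using t that unfolding tab_def dp.table_def by blast
  have "has_fun (n + 1) 12 bt (sem (For 49 3 body) (setr 51 j s))"
  proof (rule For_post[where N = "n + 1" and Inv = "\<lambda>m t. rg t 51 = bi m \<and>
      (\<forall>i<n+1. n + 1 - m \<le> i \<longrightarrow> ar t 12 (int i) = int (bt i))"])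
    show "rg (setr 51 j s) 3 = int (n + 1)" using s by (simp add: solver_state_def ctx_def)
    show "rg (setr 51 j s) 51 = bi 0 \<and> (\<forall>i<n+1. n + 1 - 0 \<le> i \<longrightarrow> ar (setr 51 j s) 12 (int i) = int (bt i))"
      unfolding bi_def dp.bidx.simps by simp
  next
    fix m t assume m: "m < n + 1" and fr: "frame (For 49 3 body) (setr 51 j s) t"
      and I: "rg t 51 = bi m \<and> (\<forall>i<n+1. n + 1 - m \<le> i \<longrightarrow> ar t 12 (int i) = int (bt i))"
    \<comment> \<open>There are \<open>n + 1\<close> items, so pass \<open>m\<close> determines the
      option of item \<open>n - m\<close> and reads row \<open>n - m + 1\<close>.\<close>
    define i where "i = n - m"
    have i: "i \<le> n" "int n - int m = int i" "n + 1 - m = Suc i" "n + 1 - Suc m = i" "n + 1 - Suc i = m"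
      using m by (auto simp: i_def)
    have sc: "solver_state t" by (rule solver_state_frame[OF fr]) (use s in \<open>auto simp: wb SR_def SA_def\<close>)
    have tt: "rg t 1 = int n" "ar t 14 = ar s 14" "ar t 15 = ar s 15"
      using fr s wb by (auto simp: frame_def solver_state_def ctx_def)
    note a16 = solver_state_row_start[OF sc i(1)]
    have c: "ar t 14 (int (Suc i) * dp.T + bi m) = int (bt i)"
    proof -
      have "bt i = nat (row s 14 (Suc i) (bi m))" unfolding bt_def dp.backtrack_def bi_def i(5) ..
      then show ?thesis using ch[of i "bi m"] bi[of m] m i by (simp add: tt row_def del: of_nat_Suc)
    qed
    have p: "ar t 15 (int (Suc i) * dp.T + bi m) = bi (Suc m)"
      unfolding bi_def dp.bidx.simps i(3) by (simp add: tt row_def del: of_nat_Suc)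
    have e: "sem body (setr 49 (int m) t) = setr 51 (bi (Suc m)) (seta 12 (int i) (int (bt i)) (setr 50 (int i) (setr 49 (int m) t)))"
      using I tt a16 c p by (simp add: body_def i(2) del: of_nat_Suc)
    show "rg (sem body (setr 49 (int m) t)) 51 = bi (Suc m) \<and>
      (\<forall>i<n+1. n + 1 - Suc m \<le> i \<longrightarrow> ar (sem body (setr 49 (int m) t)) 12 (int i) = int (bt i))"
      unfolding e i(4) using I unfolding i(3) by (auto simp: Suc_le_eq le_less)
  qed (auto simp: wb has_fun_def)
  then show ?thesis using j by (simp add: BACKTRACK_def body_def bt_def)
qed

lemma mask_eq: "mk = {v. v < n \<and> v \<in> mk}"
  using mkX XV by auto

lemma CHECK_spec:
  assumes s: "solver_state s" and y: "has_fun (n + 1) 12 y s" "\<forall>i<n+1. y i < opts"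
  shows "rg (sem CHECK s) 56 = of_bool (dp.feasible y)"
proof -
  define clear where "clear = For 20 1 (Sto 17 (R 20) (K 0))"
  define add where "add = For 20 1 (Sto 17 (R 20) (Add (AR 17 (R 20)) (AR 9 (R 20))))"
  define b1 where "b1 = EDGES;; Asg 30 (AR 12 (R 40));; EVAL;; add"
  define b2 where "b2 = when_com (Less (K 0) (AR 3 (R 20))) (
       Ite (Less (K 0) (AR 4 (R 20)))
         (when_com (Less (CAPA 20) (AR 17 (R 20))) (Asg 56 (K 0)))
         (when_com (Less (K 0) (AR 17 (R 20))) (Asg 56 (K 0))))"
  have C: "CHECK = clear;; For 40 3 b1;; Asg 56 (K 1);; For 20 1 b2"
    by (simp add: CHECK_def clear_def add_def b1_def b2_def)
  have wc: "wf clear" "written_regs clear = {20}" "written_arrays clear = {17}" "wf add" "written_regs add = {20}" "written_arrays add = {17}"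
    "wf b2" "written_regs b2 = {56}" "written_arrays b2 = {}"
    by (auto simp: clear_def add_def b2_def)
  have wb: "wf b1" "written_regs b1 = {20, 21, 41, 42, 30, 31, 32, 33, 34, 43, 44, 45}" "written_arrays b1 = {6, 7, 8, 9, 17}"
    by (auto simp: b1_def wc)
  define s1 where "s1 = sem clear s"
  have n: "rg s 1 = int n" "rg s 3 = int (n + 1)" using s by (simp_all add: solver_state_def ctx_def)
  have c1: "\<forall>v<n. ar s1 17 (int v) = 0"
    unfolding s1_def clear_def
    by (rule For_post[where N = n and Inv = "\<lambda>i t. \<forall>v<i. ar t 17 (int v) = 0"]) (use n in \<open>auto simp: less_Suc_eq\<close>)
  have s1: "solver_state s1" "has_fun (n + 1) 12 y s1" using s y by (simp_all add: s1_def wc SR_def SA_def)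
  define s2 where "s2 = sem (For 40 3 b1) s1"
  have c2: "\<forall>v<n. ar s2 17 (int v) = (\<Sum>i<n+1. int (load_at (es i) (y i) v))"
    unfolding s2_def
  proof (rule For_post[where N = "n + 1" and Inv = "\<lambda>i t. \<forall>v<n. ar t 17 (int v) = (\<Sum>i<i. int (load_at (es i) (y i) v))"])
    show "rg s1 3 = int (n + 1)" using n by (simp add: s1_def wc)
  next
    fix i t assume i: "i < n + 1" and fr: "frame (For 40 3 b1) s1 t"
      and I: "\<forall>v<n. ar t 17 (int v) = (\<Sum>i<i. int (load_at (es i) (y i) v))"
    have sc: "solver_state t" by (rule solver_state_frame[OF fr s1(1)]) (auto simp: wb SR_def SA_def)
    have yt: "has_fun (n + 1) 12 y t" using has_fun_frame[OF fr, of 12] s1(2) by (simp add: wb)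
    define t0 where "t0 = setr 40 (int i) t"
    define t1 where "t1 = sem EVAL (sem (Asg 30 (AR 12 (R 40))) (sem EDGES t0))"
    have ev: "has_fun n 9 (load_at (es i) (y i)) t1"
      unfolding t1_def by (rule item_spec) (use sc yt i y(2) in \<open>auto simp: t0_def SR_def has_fun_def\<close>)
    have t1: "rg t1 1 = int n" "ar t1 17 = ar t 17" using sc by (simp_all add: t1_def t0_def solver_state_def ctx_def)
    have "\<forall>v<n. ar (sem add t1) 17 (int v) = ar t1 17 (int v) + ar t1 9 (int v)"
      unfolding add_def
    proof (rule For_post[where N = n and Inv = "\<lambda>m u. \<forall>v<n. ar u 17 (int v) = ar t1 17 (int v) + (if v < m then ar t1 9 (int v) else 0)"])
      fix m u assume "m < n" and fr: "frame (For 20 1 (Sto 17 (R 20) (Add (AR 17 (R 20)) (AR 9 (R 20))))) t1 u"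
        and I: "\<forall>v<n. ar u 17 (int v) = ar t1 17 (int v) + (if v < m then ar t1 9 (int v) else 0)"
      have "ar u 9 = ar t1 9" using fr by (simp add: frame_def)
      then show "\<forall>v<n. ar (sem (Sto 17 (R 20) (Add (AR 17 (R 20)) (AR 9 (R 20)))) (setr 20 (int m) u)) 17 (int v)
          = ar t1 17 (int v) + (if v < Suc m then ar t1 9 (int v) else 0)"
        using I \<open>m < n\<close> by (auto simp: less_Suc_eq)
    qed (use t1 in auto)
    then show "\<forall>v<n. ar (sem b1 (setr 40 (int i) t)) 17 (int v) = (\<Sum>i<Suc i. int (load_at (es i) (y i) v))"
      using I ev t1 by (simp add: b1_def t1_def[unfolded sem.simps] t0_def[symmetric] has_fun_def)
  qed (use c1 wb in auto)
  have s2: "solver_state s2" using s1 by (simp add: s2_def wb SR_def SA_def)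
  define ok where "ok x \<longleftrightarrow> (\<Sum>i<n+1. load_at (es i) (y i) x) \<le> mask_cap mk c x" for x
  have "rg (sem (For 20 1 b2) (setr 56 1 s2)) 56 = of_bool (\<forall>x\<in>X. x < n \<longrightarrow> ok x)"
  proof (rule For_post[where N = n and Inv = "\<lambda>i t. rg t 56 = of_bool (\<forall>x\<in>X. x < i \<longrightarrow> ok x)"])
    show "rg (setr 56 1 s2) 1 = int n" using s2 by (simp add: solver_state_def ctx_def)
  next
    fix i t assume i: "i < n" and fr: "frame (For 20 1 b2) (setr 56 1 s2) t"
      and I: "rg t 56 = of_bool (\<forall>x\<in>X. x < i \<longrightarrow> ok x)"
    have sc: "solver_state t" by (rule solver_state_frame[OF fr]) (use s2 in \<open>auto simp: wc SR_def SA_def\<close>)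
    have t: "ar t 3 (int i) = of_bool (i \<in> X)" "ar t 4 (int i) = of_bool (i \<in> mk)" "ar t 0 (int i + 2) = int (c i)"
      using sc i by (auto simp: solver_state_def ctx_def has_set_def)
    have u: "ar t 17 (int i) = int (\<Sum>j<n+1. load_at (es j) (y j) i)"
      using fr c2 i wc by (simp add: frame_def del: sum.lessThan_Suc)
    have oki: "ok i \<longleftrightarrow> ar t 17 (int i) \<le> (if i \<in> mk then int (c i) else 0)"
      unfolding ok_def u mask_cap_def by (simp del: sum.lessThan_Suc of_nat_sum)
    have S: "(\<forall>x\<in>X. x < Suc i \<longrightarrow> ok x) \<longleftrightarrow> (\<forall>x\<in>X. x < i \<longrightarrow> ok x) \<and> (i \<in> X \<longrightarrow> ok i)"
      by (auto simp: less_Suc_eq)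
    show "rg (sem b2 (setr 20 (int i) t)) 56 = of_bool (\<forall>x\<in>X. x < Suc i \<longrightarrow> ok x)"
      unfolding S oki using I t by (auto simp: b2_def)
  qed (use wc in auto)
  moreover have "(\<forall>x\<in>X. x < n \<longrightarrow> ok x) \<longleftrightarrow> dp.feasible y"
    unfolding dp.feasible_def ok_def using y(2) XV by auto
  ultimately show ?thesis by (simp add: C s2_def s1_def)
qed

lemma ROUND_spec:
  assumes s: "solver_state s" and z: "has_fun (n + 1) 11 z s" "dp.feasible z" and big: "dp.cost z \<le> big"
  shows "\<exists>z'. has_fun (n + 1) 11 z' (sem ROUND s) \<and> dp.feasible z' \<and> (z' = z \<and> dp.optimal z \<or> dp.cost z' < dp.cost z)"
proof -
  have zo: "\<forall>i<n+1. z i < opts" using z(2) unfolding dp.feasible_def by simp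
  define s1 where "s1 = setr 57 0 (sem DPTABLE s)"
  have t1: "tab z (n + 1) s1" using DPTABLE_spec[OF s z(1) zo] by (simp add: s1_def)
  have s1: "solver_state s1" "has_fun (n + 1) 11 z s1" using s z by (simp_all add: s1_def SR_def SA_def)
  define bt where "bt j = dp.backtrack (row s1 14) (row s1 15) j" for j
  define cp where "cp = For 40 3 (Sto 11 (R 40) (AR 12 (R 40)))"
  define body where "body = when_com (Conj (Less (R 57) (K 1)) (Less (CELL 13 (R 3) (R 63)) (K 0))) (
       BACKTRACK;; CHECK;; when_com (Less (K 0) (R 56)) (cp;; Asg 57 (K 1)))"
  have RR: "ROUND = DPTABLE;; Asg 57 (K 0);; For 63 13 body" by (simp add: ROUND_def body_def cp_def)
  have wc: "wf cp" "written_regs cp = {40}" "written_arrays cp = {11}" by (auto simp: cp_def)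
  have wb: "wf body" "written_regs body = {20, 21, 30, 31, 32, 33, 34, 40, 41, 42, 43, 44, 45, 49, 50, 51, 56, 57}" "written_arrays body = {6, 7, 8, 9, 11, 12, 17}"
    by (auto simp: body_def wc)
  have "\<exists>z'. has_fun (n + 1) 11 z' (sem (For 63 13 body) s1) \<and> dp.feasible z' \<and> (z' = z \<and> dp.optimal z \<or> dp.cost z' < dp.cost z)"
  \<comment> \<open>Register 57 becomes 1 when a choice is adopted. From then on the table, which
    belongs to the old choice \<open>z\<close>, is not consulted any more.\<close>
  proof (rule For_post[where N = "nat dp.T" and Inv = "\<lambda>j t. \<exists>z'. has_fun (n + 1) 11 z' t \<and> dp.feasible z' \<and>
      (rg t 57 = 0 \<and> z' = z \<and> (\<forall>x. 0 \<le> x \<and> x < int j \<longrightarrow> \<not> (row s1 13 (n + 1) x < 0 \<and> dp.feasible (bt x))) \<or>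
       rg t 57 = 1 \<and> dp.cost z' < dp.cost z)"])
    show "rg s1 13 = int (nat dp.T)" using s1 T_pos by (simp add: solver_state_def)
  next
    fix j t assume j: "j < nat dp.T" and fr: "frame (For 63 13 body) s1 t"
      and "\<exists>z'. has_fun (n + 1) 11 z' t \<and> dp.feasible z' \<and>
      (rg t 57 = 0 \<and> z' = z \<and> (\<forall>x. 0 \<le> x \<and> x < int j \<longrightarrow> \<not> (row s1 13 (n + 1) x < 0 \<and> dp.feasible (bt x))) \<or>
       rg t 57 = 1 \<and> dp.cost z' < dp.cost z)"
    then obtain z' where z': "has_fun (n + 1) 11 z' t" "dp.feasible z'"
      "rg t 57 = 0 \<and> z' = z \<and> (\<forall>x. 0 \<le> x \<and> x < int j \<longrightarrow> \<not> (row s1 13 (n + 1) x < 0 \<and> dp.feasible (bt x))) \<or>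
       rg t 57 = 1 \<and> dp.cost z' < dp.cost z" by blast
    have sc: "solver_state t" by (rule solver_state_frame[OF fr s1(1)]) (auto simp: wb SR_def SA_def)
    have ar: "ar t 13 = ar s1 13" "ar t 14 = ar s1 14" "ar t 15 = ar s1 15" using fr wb by (auto simp: frame_def)
    then have rw: "row t 13 = row s1 13" "row t 14 = row s1 14" "row t 15 = row s1 15" by (auto simp: row_def fun_eq_iff)
    have tt: "tab z (n + 1) t" using t1 by (simp add: tab_def rw)
    have n3: "rg t 3 = int n + 1" using sc by (simp add: solver_state_def ctx_def)
    have cell: "ar t 13 (ar t 16 (int n + 1) + int j) = row s1 13 (n + 1) (int j)"
      using solver_state_row_start(2)[OF sc order_refl] by (simp add: ar row_def)
    define t0 where "t0 = setr 63 (int j) t"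
    define u where "u = sem CHECK (sem BACKTRACK t0)"
    have jT: "int j < dp.T" using j by linarith
    show "\<exists>z'. has_fun (n + 1) 11 z' (sem body (setr 63 (int j) t)) \<and> dp.feasible z' \<and>
      (rg (sem body (setr 63 (int j) t)) 57 = 0 \<and> z' = z \<and>
        (\<forall>x. 0 \<le> x \<and> x < int (Suc j) \<longrightarrow> \<not> (row s1 13 (n + 1) x < 0 \<and> dp.feasible (bt x))) \<or>
       rg (sem body (setr 63 (int j) t)) 57 = 1 \<and> dp.cost z' < dp.cost z)"
    proof (cases "rg t 57 = 0 \<and> row s1 13 (n + 1) (int j) < 0")
      case False
      then have e: "sem body (setr 63 (int j) t) = t0" using z'(3) cell n3 by (auto simp: body_def t0_def)
      have "x = int j \<or> x < int j" if "x < int (Suc j)" for x using that by auto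
      then show ?thesis unfolding e using z' False by (intro exI[of _ z']) (auto simp: t0_def)
    next
      case True
      then have zz: "z' = z" "\<forall>x. 0 \<le> x \<and> x < int j \<longrightarrow> \<not> (row s1 13 (n + 1) x < 0 \<and> dp.feasible (bt x))"
        using z'(3) by auto
      have e: "sem body (setr 63 (int j) t) = (if 0 < rg u 56 then setr 57 1 (sem cp u) else u)"
        using True cell n3 by (simp add: body_def t0_def u_def)
      have new: "has_fun (n + 1) 12 (bt (int j)) (sem BACKTRACK t0)"
        using BACKTRACK_spec[of t0 z "int j"] sc tt jT by (simp add: t0_def SR_def bt_def rw)
      obtain Ch where snd: "\<And>i. i < n + 1 \<Longrightarrow> bt (int j) i < opts" "dp.cost (bt (int j)) < dp.cost z"
        unfolding bt_def
        by (rule dp.backtrack_sound[OF t1[unfolded tab_def], of "int j"]) (use jT True zo big in auto)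
      have u56: "rg u 56 = of_bool (dp.feasible (bt (int j)))"
        unfolding u_def by (rule CHECK_spec) (use new snd(1) sc in \<open>auto simp: t0_def SR_def SA_def\<close>)
      show ?thesis
      proof (cases "dp.feasible (bt (int j))")
        case fe: True
        have nu: "has_fun (n + 1) 12 (bt (int j)) u" "rg u 3 = int (n + 1)" using new n3 by (simp_all add: u_def t0_def)
        have "has_fun (n + 1) 11 (bt (int j)) (sem cp u)"
          unfolding cp_def
        proof (rule For_post[where N = "n + 1" and Inv = "\<lambda>i t. \<forall>v<i. ar t 11 (int v) = int (bt (int j) v)"])
          fix i w assume "i < n + 1" "frame (For 40 3 (Sto 11 (R 40) (AR 12 (R 40)))) u w"
            "\<forall>v<i. ar w 11 (int v) = int (bt (int j) v)"
          then show "\<forall>v<Suc i. ar (sem (Sto 11 (R 40) (AR 12 (R 40))) (setr 40 (int i) w)) 11 (int v) = int (bt (int j) v)"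
            using nu by (auto simp: frame_def has_fun_def less_Suc_eq)
        qed (use nu in \<open>auto simp: has_fun_def\<close>)
        then show ?thesis unfolding e using u56 fe snd(2) by (intro exI[of _ "bt (int j)"]) simp
      next
        case nf: False
        have "has_fun (n + 1) 11 z u" "rg u 57 = 0" using z' zz True by (simp_all add: u_def t0_def)
        moreover have "x = int j \<or> x < int j" if "x < int (Suc j)" for x using that by auto
        ultimately show ?thesis unfolding e using u56 nf z'(2) zz by (intro exI[of _ z]) auto
      qed
    qed
  next
    fix t assume "\<exists>z'. has_fun (n + 1) 11 z' t \<and> dp.feasible z' \<and>
      (rg t 57 = 0 \<and> z' = z \<and> (\<forall>x. 0 \<le> x \<and> x < int (nat dp.T) \<longrightarrow> \<not> (row s1 13 (n + 1) x < 0 \<and> dp.feasible (bt x))) \<or>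
       rg t 57 = 1 \<and> dp.cost z' < dp.cost z)"
    then obtain z' where z': "has_fun (n + 1) 11 z' t" "dp.feasible z'"
      "rg t 57 = 0 \<and> z' = z \<and> (\<forall>x. 0 \<le> x \<and> x < int (nat dp.T) \<longrightarrow> \<not> (row s1 13 (n + 1) x < 0 \<and> dp.feasible (bt x))) \<or>
       rg t 57 = 1 \<and> dp.cost z' < dp.cost z" by blast
    have "dp.optimal z" if "\<forall>x. 0 \<le> x \<and> x < int (nat dp.T) \<longrightarrow> \<not> (row s1 13 (n + 1) x < 0 \<and> dp.feasible (bt x))"
    proof (rule ccontr)
      assume "\<not> dp.optimal z"
      from dp.table_finds_improvement[OF t1[unfolded tab_def] z(2) this] big
      obtain j where "0 \<le> j" "j < dp.T" "row s1 13 (n + 1) j < 0" "dp.feasible (bt j)" by (auto simp: bt_def)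
      then show False using that by auto
    qed
    then show "\<exists>z'. has_fun (n + 1) 11 z' (setr 63 (int (nat dp.T)) t) \<and> dp.feasible z' \<and> (z' = z \<and> dp.optimal z \<or> dp.cost z' < dp.cost z)"
      using z' by (intro exI[of _ z']) auto
  qed (use s1 z wb in \<open>auto intro!: exI[of _ z] simp: s1_def\<close>)
  then show ?thesis by (simp add: RR s1_def)
qed

lemma load_at_0: "load_at l 0 v = 0"
  by (simp add: load_at_def digit3_def target_def)

text \<open>Option 0 leaves all edges unassigned: no load arises, so the capacities hold, and each
  edge costs \<open>n + 1\<close>.\<close>

lemma zero_choice: "dp.feasible (\<lambda>_. 0)" "dp.cost (\<lambda>_. 0) \<le> (n + 1) * (n * n)"
proof -
  show "dp.feasible (\<lambda>_. 0)" unfolding dp.feasible_def by (simp add: load_at_0 opts_def)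
  have "item_cost n X c (es i) 0 = (n + 1) * card {uv \<in> set (es i). True}" for i
  proof -
    have "{e. e < length (es i) \<and> digit3 0 e = 0} = {..<length (es i)}" by (auto simp: digit3_def)
    then show ?thesis by (simp add: item_cost_def load_at_0 distinct_card)
  qed
  then have eq: "dp.cost (\<lambda>_. 0) = (n + 1) * card {uv \<in> pairs. True}"
    unfolding dp.cost_def card_pairs_split by (simp only: sum_distrib_left)
  have "card {uv \<in> pairs. True} \<le> card ({..<n} \<times> {..<n})" by (intro card_mono) (auto simp: pairs_def)
  then have "card {uv \<in> pairs. True} \<le> n * n" by (simp add: card_cartesian_product)
  then show "dp.cost (\<lambda>_. 0) \<le> (n + 1) * (n * n)" unfolding eq by (rule mult_le_mono2)
qed

definition solvable :: "int \<Rightarrow> bool" where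
  "solvable k \<longleftrightarrow> (\<exists>z. dp.feasible z \<and> dp.cost z \<le> n \<and> int (dp.cost z + card mk) \<le> k)"

lemma SOLVE_spec:
  assumes ctx: "ctx n E c s" and sets: "has_set n 3 X s" "has_set n 4 mk s" "has_fun n 5 lab s"
    and regs: "rg s 2 = k" "rg s 8 = int (4 * p * p)" "rg s 9 = int opts" "rg s 11 = dp.B" "rg s 12 = dp.Q" "rg s 13 = dp.T" "rg s 14 = int big"
    and rows: "\<forall>i\<le>n+1. ar s 16 (int i) = int i * dp.T" and big: "big = (n + 1) * (n + 1) * (n + 1)"
  shows "rg (sem SOLVE s) 0 = (if solvable k then 1 else rg s 0)"
proof -
  define s1 where "s1 = sem WEIGHTS s"
  have n: "rg s 1 = int n" using ctx by (simp add: ctx_def)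
  have "\<forall>v<n. ar s1 10 (int v) = (if v \<in> X then dp.B ^ card (X \<inter> {..<v}) else 0)"
    unfolding s1_def using WEIGHTS_spec[OF n sets(1) regs(4)] dp.B_bounds(1) by simp
  then have s1: "solver_state s1"
    using ctx sets regs rows unfolding solver_state_def by (simp add: s1_def dp.pw_def)
  define ini where "ini = For 40 3 (Sto 11 (R 40) (K 0))"
  have wi: "wf ini" "written_regs ini = {40}" "written_arrays ini = {11}" by (auto simp: ini_def)
  define s2 where "s2 = sem ini s1"
  have s2: "solver_state s2" using s1 by (simp add: s2_def wi SR_def SA_def)
  have z0: "has_fun (n + 1) 11 (\<lambda>_. 0) s2"
    unfolding s2_def ini_def
    by (rule For_post[where N = "n + 1" and Inv = "\<lambda>i t. \<forall>v<i. ar t 11 (int v) = 0"])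
      (use s1 in \<open>auto simp: has_fun_def less_Suc_eq solver_state_def ctx_def\<close>)
  define c0 where "c0 = dp.cost (\<lambda>_. 0)"
  have "n * n < (n + 1) * (n + 1)" by simp
  then have "(n + 1) * (n * n) < (n + 1) * ((n + 1) * (n + 1))" by (intro mult_strict_left_mono) auto
  then have c0: "c0 < big" using zero_choice(2) unfolding c0_def big mult.assoc by linarith
  define s3 where "s3 = sem (For 58 14 ROUND) s2"
  have s3: "solver_state s3" using s2 by (simp add: s3_def SR_def SA_def)
  have "\<exists>z. has_fun (n + 1) 11 z s3 \<and> dp.feasible z \<and> dp.optimal z"
    unfolding s3_def
  \<comment> \<open>Every round either finds the choice optimal or lowers its integral cost. The
    initial cost \<open>c0\<close> is below the number of rounds, so the second alternative cannot
    persist to the end.\<close>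
  proof (rule For_post[where N = big and Inv = "\<lambda>r t. \<exists>z. has_fun (n + 1) 11 z t \<and> dp.feasible z \<and> dp.cost z \<le> c0 \<and>
      (dp.optimal z \<or> dp.cost z + r \<le> c0)"])
    show "rg s2 14 = int big" using s2 by (simp add: solver_state_def)
    show "\<exists>z. has_fun (n + 1) 11 z s2 \<and> dp.feasible z \<and> dp.cost z \<le> c0 \<and> (dp.optimal z \<or> dp.cost z + 0 \<le> c0)"
      using z0 zero_choice(1) by (intro exI[of _ "\<lambda>_. 0"]) (simp add: c0_def)
  next
    fix r t assume fr: "frame (For 58 14 ROUND) s2 t" and "\<exists>z. has_fun (n + 1) 11 z t \<and> dp.feasible z \<and> dp.cost z \<le> c0 \<and>
      (dp.optimal z \<or> dp.cost z + r \<le> c0)"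
    then obtain z where z: "has_fun (n + 1) 11 z t" "dp.feasible z" "dp.cost z \<le> c0" "dp.optimal z \<or> dp.cost z + r \<le> c0" by blast
    have sc: "solver_state t" by (rule solver_state_frame[OF fr s2]) (auto simp: SR_def SA_def)
    have "\<exists>z'. has_fun (n + 1) 11 z' (sem ROUND (setr 58 (int r) t)) \<and> dp.feasible z' \<and> (z' = z \<and> dp.optimal z \<or> dp.cost z' < dp.cost z)"
      by (rule ROUND_spec) (use sc z c0 in \<open>auto simp: SR_def\<close>)
    then obtain z' where z': "has_fun (n + 1) 11 z' (sem ROUND (setr 58 (int r) t))" "dp.feasible z'"
      "z' = z \<and> dp.optimal z \<or> dp.cost z' < dp.cost z" by blast
    have no: "\<not> dp.cost z' < dp.cost z" if "dp.optimal z" using that z'(2) unfolding dp.optimal_def not_less by blast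
    show "\<exists>z. has_fun (n + 1) 11 z (sem ROUND (setr 58 (int r) t)) \<and> dp.feasible z \<and> dp.cost z \<le> c0 \<and>
      (dp.optimal z \<or> dp.cost z + Suc r \<le> c0)"
      using z z' no by (intro exI[of _ z']) auto
  next
    fix t assume "\<exists>z. has_fun (n + 1) 11 z t \<and> dp.feasible z \<and> dp.cost z \<le> c0 \<and> (dp.optimal z \<or> dp.cost z + big \<le> c0)"
    then show "\<exists>z. has_fun (n + 1) 11 z (setr 58 (int big) t) \<and> dp.feasible z \<and> dp.optimal z" using c0 by auto
  qed auto
  then obtain z where z: "has_fun (n + 1) 11 z s3" "dp.feasible z" "dp.optimal z" by blast
  have zo: "\<forall>i<n+1. z i < opts" using z(2) unfolding dp.feasible_def by simp
  define b where "b = EDGES;; Asg 30 (AR 11 (R 40));; EVAL;; Asg 59 (Add (R 59) (R 44))"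
  have wb: "wf b" "written_regs b = {20, 21, 41, 42, 30, 31, 32, 33, 34, 43, 44, 45, 59}" "written_arrays b = {6, 7, 8, 9}"
    by (auto simp: b_def)
  define s4 where "s4 = sem (For 40 3 b) (setr 59 0 s3)"
  have tot: "rg s4 59 = int (dp.cost z)"
    unfolding s4_def dp.cost_def
  proof (rule For_post[where N = "n + 1" and Inv = "\<lambda>i t. rg t 59 = int (\<Sum>i<i. item_cost n X c (es i) (z i))"])
    show "rg (setr 59 0 s3) 3 = int (n + 1)" using s3 by (simp add: solver_state_def ctx_def)
  next
    fix i t assume i: "i < n + 1" and fr: "frame (For 40 3 b) (setr 59 0 s3) t"
      and I: "rg t 59 = int (\<Sum>i<i. item_cost n X c (es i) (z i))"
    have sc: "solver_state t" by (rule solver_state_frame[OF fr]) (use s3 in \<open>auto simp: wb SR_def SA_def\<close>)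
    have zt: "has_fun (n + 1) 11 z t" using has_fun_frame[OF fr, of 11] z(1) by (simp add: wb)
    define t0 where "t0 = setr 40 (int i) t"
    have "rg (sem EVAL (sem (Asg 30 (AR 11 (R 40))) (sem EDGES t0))) 44 = int (item_cost n X c (es i) (z i))"
      by (rule item_spec) (use sc zt i zo in \<open>auto simp: t0_def SR_def has_fun_def\<close>)
    then show "rg (sem b (setr 40 (int i) t)) 59 = int (\<Sum>i<Suc i. item_cost n X c (es i) (z i))"
      using I by (simp add: b_def t0_def)
  qed (use wb in auto)
  define b2 where "b2 = when_com (Less (K 0) (AR 4 (R 20))) (inc 61)"
  have w2: "wf b2" "written_regs b2 = {61}" "written_arrays b2 = {}" by (auto simp: b2_def)
  define s5 where "s5 = sem (For 20 1 b2) (setr 61 (rg s4 59) s4)"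
  have s4: "rg s4 1 = int n" "has_set n 4 mk s4" using s3 by (simp_all add: s4_def wb solver_state_def ctx_def)
  have "rg s5 61 = int (dp.cost z) + int (card {v. v < n \<and> v \<in> mk})"
    unfolding s5_def
  proof (rule For_post[where N = n and Inv = "\<lambda>i t. rg t 61 = int (dp.cost z) + int (card {v. v < i \<and> v \<in> mk})"])
    fix i t assume i: "i < n" and fr: "frame (For 20 1 b2) (setr 61 (rg s4 59) s4) t"
      and I: "rg t 61 = int (dp.cost z) + int (card {v. v < i \<and> v \<in> mk})"
    have "ar t 4 (int i) = of_bool (i \<in> mk)" using fr s4 i by (auto simp: frame_def has_set_def w2)
    then show "rg (sem b2 (setr 20 (int i) t)) 61 = int (dp.cost z) + int (card {v. v < Suc i \<and> v \<in> mk})"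
      unfolding card_less_Suc using I by (simp add: b2_def)
  qed (use s4 tot w2 in auto)
  then have c61: "rg s5 61 = int (dp.cost z + card mk)" using mask_eq by simp
  have keep: "rg s5 59 = int (dp.cost z)" "rg s5 3 = int n + 1" "rg s5 2 = k" "rg s5 0 = rg s 0"
  proof -
    show "rg s5 59 = int (dp.cost z)" using tot by (simp add: s5_def w2)
    show "rg s5 3 = int n + 1" using s3 by (simp add: s5_def s4_def w2 wb solver_state_def ctx_def)
    show "rg s5 2 = k" "rg s5 0 = rg s 0" using regs by (simp_all add: s5_def s4_def s3_def s2_def s1_def w2 wb wi)
  qed
  have "solvable k \<longleftrightarrow> dp.cost z \<le> n \<and> int (dp.cost z + card mk) \<le> k"
  proof
    assume "solvable k"
    then obtain y where "dp.feasible y" "dp.cost y \<le> n" "int (dp.cost y + card mk) \<le> k" by (auto simp: solvable_def)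
    moreover from this have "dp.cost z \<le> dp.cost y" using z(3) unfolding dp.optimal_def by blast
    ultimately show "dp.cost z \<le> n \<and> int (dp.cost z + card mk) \<le> k" by linarith
  qed (use z in \<open>auto simp: solvable_def\<close>)
  moreover have "sem SOLVE s = sem (when_com (Conj (Less (R 59) (R 3)) (Le (R 61) (R 2))) (Asg 0 (K 1))) s5"
    by (simp add: SOLVE_def s5_def b2_def s4_def b_def s3_def s2_def ini_def s1_def)
  ultimately show ?thesis using keep c61 by auto
qed

end

section \<open>Computing the parameters that depend on \<open>p\<close>\<close>

lemma written_regs_MUL [simp]: "written_regs (MUL r a b) = {r, 62}" and written_arrays_MUL [simp]: "written_arrays (MUL r a b) = {}"
  and written_regs_POW [simp]: "written_regs (POW r b e) = {r, 60, 61, 62}" and written_arrays_POW [simp]: "written_arrays (POW r b e) = {}"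
  by (auto simp: MUL_def POW_def)

lemma wf_MUL [simp]: "r \<noteq> 62 \<Longrightarrow> {a} \<inter> {r, 62} = {} \<Longrightarrow> wf (MUL r a b)"
  by (auto simp: MUL_def)

lemma wf_POW [simp]: "r \<notin> {60, 61, 62} \<Longrightarrow> {b, e} \<inter> {r, 60, 61, 62} = {} \<Longrightarrow> wf (POW r b e)"
  by (auto simp: POW_def)

lemma written_regs_PARAMS [simp]: "written_regs PARAMS = {5, 6, 8, 9, 10, 11, 12, 13, 19, 35, 37, 60, 61, 62}"
  and written_arrays_PARAMS [simp]: "written_arrays PARAMS = {}"
  by (auto simp: PARAMS_def)

lemma MUL_spec:
  assumes "{a, b} \<inter> {r, 62} = {}" "r \<noteq> 62" "rg s a = int x"
  shows "rg (sem (MUL r a b) s) r = int x * rg s b"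
proof -
  have "rg (sem (For 62 a (Asg r (Add (R r) (R b)))) (setr r 0 s)) r = int x * rg s b"
  proof (rule For_post[where N = x and Inv = "\<lambda>i t. rg t r = int i * rg s b"])
    fix i t assume "frame (For 62 a (Asg r (Add (R r) (R b)))) (setr r 0 s) t" "rg t r = int i * rg s b"
    moreover from this(1) have "rg t b = rg s b" using assms by (auto simp: frame_def)
    ultimately show "rg (sem (Asg r (Add (R r) (R b))) (setr 62 (int i) t)) r = int (Suc i) * rg s b"
      using assms by (auto simp: algebra_simps)
  qed (use assms in auto)
  then show ?thesis by (simp add: MUL_def)
qed

lemma POW_spec:
  assumes regs: "{b, e} \<inter> {r, 60, 61, 62} = {}" "r \<notin> {60, 61, 62}" and b: "rg s b = int x" and e: "rg s e = int y"
  shows "rg (sem (POW r b e) s) r = int x ^ y"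
proof -
  define inn where "inn = For 62 b (Asg 60 (Add (R 60) (R r)))"
  define body where "body = Asg 60 (K 0);; inn;; Asg r (R 60)"
  have w: "wf inn" "written_regs inn = {60, 62}" using regs by (auto simp: inn_def)
  have wb: "wf body" "written_regs body = {60, 62, r}" using w by (auto simp: body_def)
  have inn: "rg (sem inn t) 60 = int x * rg t r" if "rg t b = int x" "rg t 60 = 0" for t
    unfolding inn_def
  proof (rule For_post[where N = x and Inv = "\<lambda>i u. rg u 60 = int i * rg t r"])
    fix i u assume "frame (For 62 b (Asg 60 (Add (R 60) (R r)))) t u" "rg u 60 = int i * rg t r"
    moreover from this(1) have "rg u r = rg t r" using regs by (auto simp: frame_def)
    ultimately show "rg (sem (Asg 60 (Add (R 60) (R r))) (setr 62 (int i) u)) 60 = int (Suc i) * rg t r"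
      using regs by (auto simp: algebra_simps)
  qed (use regs that in auto)
  have "rg (sem (For 61 e body) (setr r 1 s)) r = int x ^ y"
  proof (rule For_post[where N = y and Inv = "\<lambda>i t. rg t r = int x ^ i"])
    fix i t assume fr: "frame (For 61 e body) (setr r 1 s) t" and I: "rg t r = int x ^ i"
    have "rg t b = int x" using fr b regs wb by (auto simp: frame_def)
    then have "rg (sem inn (setr 60 0 (setr 61 (int i) t))) 60 = int x * int x ^ i"
      using inn[of "setr 60 0 (setr 61 (int i) t)"] I regs by auto
    then show "rg (sem body (setr 61 (int i) t)) r = int x ^ Suc i" by (simp add: body_def)
  qed (use regs e wb in auto)
  then show ?thesis by (simp add: POW_def body_def inn_def)
qed

text \<open>\<open>par_L\<close>, \<open>par_B\<close> and \<open>par_T\<close> are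
  \<open>L\<close>, \<open>B\<close> and \<open>T\<close> of the dynamic program as natural numbers,
  available without fixing a separator.\<close>

definition par_L :: "nat \<Rightarrow> nat" where "par_L p = (4 * p * p + 1) ^ p"
definition par_B :: "nat \<Rightarrow> nat" where "par_B p = 4 * p * (par_L p + 2) + 1"
definition par_T :: "nat \<Rightarrow> nat" where "par_T p = (par_L p + 2) * par_B p ^ p"

definition params :: "nat \<Rightarrow> state \<Rightarrow> bool" where
  "params p s \<longleftrightarrow> rg s 5 = int p \<and> rg s 19 = int (Suc p) \<and> rg s 35 = int (4 * p) \<and> rg s 6 = int ((4 * p) ^ p) \<and>
     rg s 8 = int (4 * p * p) \<and> rg s 9 = int (3 ^ (4 * p * p)) \<and> rg s 11 = int (par_B p) \<and>
     rg s 12 = int (par_B p ^ p) \<and> rg s 13 = int (par_T p)"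

text \<open>Collects the bounds on the loop limits that depend on \<open>p\<close>, both while the
  parameters are computed and during an attempt.\<close>

definition fits :: "nat \<Rightarrow> nat \<Rightarrow> bool" where
  "fits p Y \<longleftrightarrow> 3 \<le> Y \<and> Suc p \<le> Y \<and> 4 * p \<le> Y \<and> (4 * p) ^ p \<le> Y \<and> 4 * p * p + 1 \<le> Y \<and> 3 ^ (4 * p * p) \<le> Y \<and>
     par_L p + 2 \<le> Y \<and> par_B p \<le> Y \<and> par_T p \<le> Y"

lemma limits_bounded_MUL: "r \<noteq> 62 \<Longrightarrow> {a} \<inter> {r, 62} = {} \<Longrightarrow> rg s a \<le> int Y \<Longrightarrow> limits_bounded (MUL r a b) s Y"
  by (rule limits_bounded_static) (auto simp: MUL_def nat_le_iff)

lemma limits_bounded_POW: "r \<notin> {60, 61, 62} \<Longrightarrow> {b, e} \<inter> {r, 60, 61, 62} = {} \<Longrightarrow> rg s b \<le> int Y \<Longrightarrow> rg s e \<le> int Y \<Longrightarrow> limits_bounded (POW r b e) s Y"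
  by (rule limits_bounded_static) (auto simp: POW_def nat_le_iff)

lemma PARAMS_spec:
  assumes p: "rg s 4 = int i" "p = Suc i" and three: "rg s 36 = 3"
  shows "params p (sem PARAMS s)" "fits p Y \<Longrightarrow> limits_bounded PARAMS s Y"
proof -
  define s1 where "s1 = setr 35 (int (4 * p)) (setr 19 (int (Suc p)) (setr 5 (int p) s))"
  define s2 where "s2 = sem (POW 6 35 5) s1"
  define s3 where "s3 = sem (MUL 8 35 5) s2"
  define s4 where "s4 = sem (POW 9 36 8) s3"
  define s5 where "s5 = setr 37 (int (4 * p * p + 1)) s4"
  define s6 where "s6 = sem (POW 10 37 5) s5"
  define s7 where "s7 = setr 10 (int (par_L p + 2)) s6"
  define s8 where "s8 = sem (MUL 11 35 10) s7"
  define s9 where "s9 = setr 11 (int (par_B p)) s8"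
  define s10 where "s10 = sem (POW 12 11 5) s9"
  define s11 where "s11 = sem (MUL 13 10 12) s10"
  have 1: "rg s1 5 = int p" "rg s1 19 = int (Suc p)" "rg s1 35 = int (4 * p)" "rg s1 36 = int 3"
    using three by (simp_all add: s1_def)
  have 2: "rg s2 6 = int (4 * p) ^ p" unfolding s2_def by (rule POW_spec) (use 1 in auto)
  have P2: "rg s2 5 = int p" "rg s2 19 = int (Suc p)" "rg s2 35 = int (4 * p)" "rg s2 36 = int 3"
    using 1 by (simp_all add: s2_def)
  have 3: "rg s3 8 = int (4 * p) * rg s2 5" unfolding s3_def by (rule MUL_spec) (use P2 in auto)
  have P3: "rg s3 5 = int p" "rg s3 19 = int (Suc p)" "rg s3 35 = int (4 * p)" "rg s3 36 = int 3" "rg s3 8 = int (4 * p * p)"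
    "rg s3 6 = int (4 * p) ^ p" using 2 P2 3 by (simp_all add: s3_def)
  have 4: "rg s4 9 = int 3 ^ (4 * p * p)" unfolding s4_def by (rule POW_spec) (use P3 in auto)
  have 5: "rg s5 5 = int p" "rg s5 19 = int (Suc p)" "rg s5 35 = int (4 * p)" "rg s5 8 = int (4 * p * p)"
    "rg s5 6 = int (4 * p) ^ p" "rg s5 9 = int 3 ^ (4 * p * p)" "rg s5 37 = int (4 * p * p + 1)"
    using P3 4 by (simp_all add: s5_def s4_def)
  have 6: "rg s6 10 = int (4 * p * p + 1) ^ p" unfolding s6_def by (rule POW_spec) (use 5 in auto)
  have 7: "rg s7 5 = int p" "rg s7 19 = int (Suc p)" "rg s7 35 = int (4 * p)" "rg s7 8 = int (4 * p * p)"
    "rg s7 6 = int (4 * p) ^ p" "rg s7 9 = int 3 ^ (4 * p * p)" "rg s7 10 = int (par_L p + 2)"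
    using 5 by (simp_all add: s7_def s6_def)
  have 8: "rg s8 11 = int (4 * p) * rg s7 10" unfolding s8_def by (rule MUL_spec) (use 7 in auto)
  have 9: "rg s9 5 = int p" "rg s9 19 = int (Suc p)" "rg s9 35 = int (4 * p)" "rg s9 8 = int (4 * p * p)"
    "rg s9 6 = int (4 * p) ^ p" "rg s9 9 = int 3 ^ (4 * p * p)" "rg s9 10 = int (par_L p + 2)" "rg s9 11 = int (par_B p)"
    using 7 by (simp_all add: s9_def s8_def)
  have 10: "rg s10 12 = int (par_B p) ^ p" unfolding s10_def by (rule POW_spec) (use 9 in auto)
  have P10: "rg s10 5 = int p" "rg s10 19 = int (Suc p)" "rg s10 35 = int (4 * p)" "rg s10 8 = int (4 * p * p)"
    "rg s10 6 = int (4 * p) ^ p" "rg s10 9 = int 3 ^ (4 * p * p)" "rg s10 10 = int (par_L p + 2)" "rg s10 11 = int (par_B p)"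
    using 9 by (simp_all add: s10_def)
  have 11: "rg s11 13 = int (par_L p + 2) * rg s10 12" unfolding s11_def by (rule MUL_spec) (use P10 in auto)
  have e1: "setr 35 (aval (Add (Add (R 5) (R 5)) (Add (R 5) (R 5))) (setr 19 (int (Suc p)) (setr 5 (int p) s))) (setr 19 (int (Suc p)) (setr 5 (int p) s)) = s1"
    by (simp add: s1_def)
  have c1: "setr 5 (aval (Add (R 4) (K 1)) s) s = setr 5 (int p) s" "setr 19 (aval (Add (R 5) (K 1)) (setr 5 (int p) s)) (setr 5 (int p) s) = setr 19 (int (Suc p)) (setr 5 (int p) s)"
    using p by (simp_all add: add.commute)
  have c5: "setr 37 (aval (Add (R 8) (K 1)) s4) s4 = s5" using P3 by (simp add: s5_def s4_def add.commute)
  have c7: "setr 10 (aval (Add (R 10) (K 2)) s6) s6 = s7" using 6 by (simp add: s7_def par_L_def add.commute)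
  have "aval (Add (R 11) (K 1)) s8 = int (par_B p)" using 8 7(7) by (simp add: par_B_def algebra_simps)
  then have c9: "setr 11 (aval (Add (R 11) (K 1)) s8) s8 = s9" by (simp only: s9_def)
  have S: "sem PARAMS s = s11"
    unfolding PARAMS_def sem.simps c1 e1 s2_def[symmetric] s3_def[symmetric] s4_def[symmetric] c5
      s6_def[symmetric] c7 s8_def[symmetric] c9 s10_def[symmetric] s11_def[symmetric] ..
  show "params p (sem PARAMS s)"
    unfolding S params_def using 10 P10 11 by (simp add: s11_def par_T_def algebra_simps)
  show "limits_bounded PARAMS s Y" if "fits p Y"
  proof -
    have f: "3 \<le> Y" "p \<le> Y" "4 * p \<le> Y" "4 * p * p + 1 \<le> Y" "4 * p * p \<le> Y" "par_L p + 2 \<le> Y" "par_B p \<le> Y"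
      using that by (auto simp: fits_def)
    show ?thesis
      unfolding PARAMS_def limits_bounded.simps sem.simps c1 e1 s2_def[symmetric] s3_def[symmetric] s4_def[symmetric] c5
        s6_def[symmetric] c7 s8_def[symmetric] c9 s10_def[symmetric]
      using f 1 P2 P3 5 7 9 P10
      by (intro conjI TrueI limits_bounded_POW limits_bounded_MUL) (simp_all only: of_nat_le_iff, auto)
  qed
qed

section \<open>All guesses for a fixed \<open>p\<close>\<close>

definition guess_digit :: "nat \<Rightarrow> nat \<Rightarrow> nat \<Rightarrow> nat" where
  "guess_digit p g j = (g div (4 * p) ^ j) mod (4 * p)"

definition found_X :: "nat \<Rightarrow> nat \<Rightarrow> nat set set \<Rightarrow> nat \<Rightarrow> nat set" where
  "found_X n p E g = fst (search n p E (guess_digit p g) p)"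

definition found_mask :: "nat \<Rightarrow> nat \<Rightarrow> nat set set \<Rightarrow> nat \<Rightarrow> nat set" where
  "found_mask n p E g = snd (search n p E (guess_digit p g) p)"

definition found_lab :: "nat \<Rightarrow> nat \<Rightarrow> nat set set \<Rightarrow> nat \<Rightarrow> nat \<Rightarrow> nat" where
  "found_lab n p E g = fst (labels n p E (found_X n p E g))"

definition success :: "nat \<Rightarrow> nat \<Rightarrow> nat set set \<Rightarrow> nat \<Rightarrow> bool" where
  "success n p E g \<longleftrightarrow> \<not> oversized n p E (found_X n p E g)"

definition good :: "nat \<Rightarrow> nat \<Rightarrow> nat set set \<Rightarrow> (nat \<Rightarrow> nat) \<Rightarrow> int \<Rightarrow> nat \<Rightarrow> bool" where
  "good n p E c k g \<longleftrightarrow> success n p E g \<and>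
     solver.solvable n E (found_X n p E g) (found_lab n p E g) p c (found_mask n p E g) k"

lemma solver_found:
  assumes "simple_graph {..<n} E" "1 \<le> p" "success n p E g"
  shows "solver n E (found_X n p E g) (found_lab n p E g) p (found_mask n p E g)"
proof -
  have b: "found_X n p E g \<subseteq> {..<n}" "found_mask n p E g \<subseteq> found_X n p E g" "card (found_X n p E g) \<le> p"
    using search_bounds[OF assms(2), of n E "guess_digit p g" p] by (auto simp: found_X_def found_mask_def)
  obtain lab l where l: "labels n p E (found_X n p E g) = (lab, False, l)"
    using assms(3) by (cases "labels n p E (found_X n p E g)") (auto simp: success_def oversized_def)
  have "separation n E (found_X n p E g) lab p"
    by (rule separation_if_not_oversized[OF assms(1) b(1) assms(2) b(3) l])
  then have "separation n E (found_X n p E g) (found_lab n p E g) p" by (simp add: found_lab_def l)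
  then show ?thesis using b(2) by (simp add: solver_def solver_axioms_def)
qed

lemma (in solver) solvable_imp_cvc: "solvable k \<Longrightarrow> capacitated_vertex_cover {..<n} E c k"
  unfolding solvable_def dp.feasible_def dp.cost_def
  using choice_imp_cover[OF mkX] by blast

lemma (in solver) cover_imp_solvable:
  assumes f: "\<forall>e\<in>E. f e \<in> e" "\<forall>v. card {e \<in> E. f e = v} \<le> c v" "int (card (f ` E)) \<le> k" and mk: "mk = X \<inter> f ` E"
  shows "solvable k"
proof -
  obtain z where z: "\<forall>i<n+1. z i < 3 ^ (4 * p * p)"
    "\<forall>x\<in>X. (\<Sum>i<n+1. load_at (es i) (z i) x) \<le> mask_cap mk c x"
    "(\<Sum>i<n+1. item_cost n X c (es i) (z i)) + card mk \<le> card (f ` E)"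
    using cover_imp_choice[OF f(1,2) mk] by blast
  have "f ` E \<subseteq> {..<n}" using f(1) graph by (auto simp: simple_graph_def)
  then have "card (f ` E) \<le> card {..<n}" by (intro card_mono) auto
  then have "card (f ` E) \<le> n" by simp
  then have "(\<Sum>i<n+1. item_cost n X c (es i) (z i)) \<le> n"
    "int ((\<Sum>i<n+1. item_cost n X c (es i) (z i)) + card mk) \<le> k"
    using z(3) f(3) by linarith+
  then show ?thesis unfolding solvable_def dp.feasible_def dp.cost_def
    using z(1,2) unfolding opts_def by blast
qed

lemma ex_guess:
  assumes "separator n E p Y" "1 \<le> p"
  shows "\<exists>g<(4 * p) ^ p. success n p E g \<and> found_mask n p E g = found_X n p E g \<inter> S"
proof -
  obtain d where d: "\<forall>j. d j < 4 * p" "\<not> oversized n p E (fst (search n p E d p))"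
    "snd (search n p E d p) = fst (search n p E d p) \<inter> S"
    using search_complete[OF assms, of S] by blast
  obtain g where g: "g < (4 * p) ^ p" "\<forall>e<p. (g div (4 * p) ^ e) mod (4 * p) = d e"
    using ex_number_with_digits[of p d "4 * p"] d(1) by blast
  have "search n p E (guess_digit p g) p = search n p E d p"
    using g(2) by (intro search_cong) (simp add: guess_digit_def)
  then show ?thesis using d g(1) by (intro exI[of _ g]) (simp add: success_def found_X_def found_mask_def)
qed

lemma ex_success:
  assumes "simple_graph {..<n} E" "vertex_integrity {..<n} E \<le> p" "1 \<le> p"
  shows "\<exists>g<(4 * p) ^ p. success n p E g"
  using ex_separator[OF assms(1,2)] ex_guess assms(3) by blast

text \<open>A successful guess shows that some separator exists. Directing the branching towards
  this separator, with the image of an optimal or any other admissible assignment as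
  \<open>S\<close>, gives a guess that records the cover correctly. Hence \<open>p\<close> has to
  admit a success only, and may be smaller than the vertex integrity.\<close>

lemma good_iff_cvc:
  assumes g: "simple_graph {..<n} E" and p: "1 \<le> p" and suc: "\<exists>g<(4 * p) ^ p. success n p E g"
  shows "(\<exists>g<(4 * p) ^ p. good n p E c k g) \<longleftrightarrow> capacitated_vertex_cover {..<n} E c k"
proof
  assume "\<exists>g<(4 * p) ^ p. good n p E c k g"
  then show "capacitated_vertex_cover {..<n} E c k"
    using solver.solvable_imp_cvc[OF solver_found[OF g p]] by (auto simp: good_def)
next
  assume "capacitated_vertex_cover {..<n} E c k"
  then obtain f where f: "\<forall>e\<in>E. f e \<in> e" "\<forall>v. card {e \<in> E. f e = v} \<le> c v" "int (card (f ` E)) \<le> k"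
    using cvc_iff[OF g] by blast
  obtain h where h: "success n p E h" using suc by blast
  have "separator n E p (found_X n p E h)"
    using search_bounds[OF p, of n E "guess_digit p h" p] h
    by (intro separator_if_not_oversized p) (auto simp: found_X_def success_def)
  from ex_guess[OF this p, of "f ` E"] obtain x where x: "x < (4 * p) ^ p" "success n p E x"
    "found_mask n p E x = found_X n p E x \<inter> f ` E" by blast
  have "good n p E c k x"
    unfolding good_def using x(2) solver.cover_imp_solvable[OF solver_found[OF g p x(2)] f x(3)] by simp
  then show "\<exists>g<(4 * p) ^ p. good n p E c k g" using x(1) by blast
qed

lemma ROWS_spec:
  assumes "rg s 38 = int n + 2" "rg s 13 = T"
  shows "\<forall>i\<le>n+1. ar (sem ROWS s) 16 (int i) = int i * T"
proof -
  define body where "body = Sto 16 (R 40) (R 61);; Asg 61 (Add (R 61) (R 13))"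
  have wb: "wf body" "written_regs body = {61}" "written_arrays body = {16}" by (auto simp: body_def)
  have "\<forall>i\<le>n+1. ar (sem (For 40 38 body) (setr 61 0 s)) 16 (int i) = int i * T"
  proof (rule For_post[where N = "n + 2" and Inv = "\<lambda>i t. rg t 61 = int i * T \<and> (\<forall>j<i. ar t 16 (int j) = int j * T)"])
    fix i t assume "frame (For 40 38 body) (setr 61 0 s) t" "rg t 61 = int i * T \<and> (\<forall>j<i. ar t 16 (int j) = int j * T)"
    then show "rg (sem body (setr 40 (int i) t)) 61 = int (Suc i) * T \<and> (\<forall>j<Suc i. ar (sem body (setr 40 (int i) t)) 16 (int j) = int j * T)"
      using assms wb by (auto simp: body_def frame_def algebra_simps less_Suc_eq)
  qed (use assms wb in \<open>auto simp: less_Suc_eq_le[symmetric]\<close>)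
  then show ?thesis by (simp add: ROWS_def body_def)
qed

lemma ATTEMPT_spec:
  assumes g: "simple_graph {..<n} E" and ctx: "ctx n E c s" and par: "params p s" "1 \<le> p"
    and regs: "rg s 2 = k" "rg s 38 = int n + 2" "rg s 14 = int ((n + 1) * (n + 1) * (n + 1))" "rg s 0 = 0"
  shows "rg (sem ATTEMPT s) 16 = of_bool (\<exists>g<(4 * p) ^ p. success n p E g) \<and>
    rg (sem ATTEMPT s) 0 = of_bool (\<exists>g<(4 * p) ^ p. good n p E c k g)"
proof -
  define body where "body = SEARCH;; when_com (Less (R 17) (K 1)) (Asg 16 (K 1);; SOLVE)"
  have A: "ATTEMPT = ROWS;; Asg 16 (K 0);; For 7 6 body" by (simp add: ATTEMPT_def body_def)
  have wb: "wf body" "written_regs body = written_regs SEARCH \<union> written_regs SOLVE \<union> {16}" "written_arrays body = written_arrays SEARCH \<union> written_arrays SOLVE"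
    by (auto simp: body_def)
  define s1 where "s1 = setr 16 0 (sem ROWS s)"
  have rows: "\<forall>i\<le>n+1. ar s1 16 (int i) = int i * int (par_T p)"
    unfolding s1_def using ROWS_spec[of s n "int (par_T p)"] regs par by (simp add: params_def)
  have s1: "ctx n E c s1" "params p s1" "rg s1 2 = k" "rg s1 14 = int ((n + 1) * (n + 1) * (n + 1))" "rg s1 0 = 0"
    using ctx par regs by (simp_all add: s1_def params_def)
  have ex_Suc: "(\<exists>h<Suc i. Pr h) \<longleftrightarrow> (\<exists>h<i. Pr h) \<or> Pr i" for i Pr by (auto simp: less_Suc_eq)
  have "rg (sem (For 7 6 body) s1) 16 = of_bool (\<exists>g<(4 * p) ^ p. success n p E g) \<and>
    rg (sem (For 7 6 body) s1) 0 = of_bool (\<exists>g<(4 * p) ^ p. good n p E c k g)"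
  proof (rule For_post[where N = "(4 * p) ^ p" and Inv = "\<lambda>i t. rg t 16 = of_bool (\<exists>h<i. success n p E h) \<and>
      rg t 0 = of_bool (\<exists>h<i. good n p E c k h)"])
    show "rg s1 6 = int ((4 * p) ^ p)" using s1 by (simp add: params_def)
  next
    fix i t assume i: "i < (4 * p) ^ p" and fr: "frame (For 7 6 body) s1 t"
      and I: "rg t 16 = of_bool (\<exists>h<i. success n p E h) \<and> rg t 0 = of_bool (\<exists>h<i. good n p E c k h)"
    have tc: "ctx n E c t" by (rule ctx_frame[OF fr s1(1)]) (auto simp: wb)
    have tr: "params p t" "rg t 2 = k" "rg t 14 = int ((n + 1) * (n + 1) * (n + 1))" "ar t 16 = ar s1 16"
      using fr s1 wb by (auto simp: frame_def params_def)
    define t1 where "t1 = sem SEARCH (setr 7 (int i) t)"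
    have se: "searched n p E (guess_digit p i) t1"
      unfolding t1_def guess_digit_def[abs_def]
      by (rule SEARCH_spec[where G = "(4 * p) ^ p"]) (use tc tr i par in \<open>auto simp: params_def\<close>)
    show "rg (sem body (setr 7 (int i) t)) 16 = of_bool (\<exists>h<Suc i. success n p E h) \<and>
        rg (sem body (setr 7 (int i) t)) 0 = of_bool (\<exists>h<Suc i. good n p E c k h)"
    proof (cases "success n p E i")
      case False
      then have "\<not> good n p E c k i" by (simp add: good_def)
      moreover have "rg t1 17 = 1" using se False by (simp add: searched_def success_def found_X_def)
      moreover have "rg t1 16 = rg t 16" "rg t1 0 = rg t 0" by (simp_all add: t1_def)
      ultimately show ?thesis unfolding ex_Suc using I False by (simp add: body_def t1_def[symmetric])
    next
      case True
      interpret S: solver n E "found_X n p E i" "found_lab n p E i" p c "found_mask n p E i" "(n + 1) * (n + 1) * (n + 1)"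
        by (rule solver_found[OF g par(2) True])
      have L: "S.dp.L = int (par_L p)" by (simp add: S.dp.L_def par_L_def add.commute)
      have B: "S.dp.B = int (par_B p)" by (simp add: S.dp.B_def L par_B_def algebra_simps)
      have Q: "S.dp.Q = int (par_B p ^ p)" by (simp add: S.dp.Q_def B)
      have T: "S.dp.T = int (par_T p)" by (simp add: S.dp.T_def L Q par_T_def algebra_simps)
      define t2 where "t2 = setr 16 1 t1"
      have "rg t1 17 = 0" using se True by (simp add: searched_def success_def found_X_def)
      then have e: "sem body (setr 7 (int i) t) = sem SOLVE t2" by (simp add: body_def t1_def[symmetric] t2_def)
      have "rg (sem SOLVE t2) 0 = (if S.solvable k then 1 else rg t2 0)"
      proof (rule S.SOLVE_spec)
        show "has_set n 3 (found_X n p E i) t2" "has_set n 4 (found_mask n p E i) t2" "has_fun n 5 (found_lab n p E i) t2"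
          using se True by (simp_all add: t2_def searched_def success_def found_X_def found_mask_def found_lab_def)
        show "\<forall>i\<le>n+1. ar t2 16 (int i) = int i * S.dp.T" using rows by (simp add: t2_def t1_def tr T)
        show "rg t2 9 = int S.opts" using tr by (simp add: t2_def t1_def S.opts_def params_def)
      qed (use tc tr in \<open>simp_all add: t2_def t1_def params_def B Q T\<close>)
      moreover have "rg t2 0 = rg t 0" by (simp add: t2_def t1_def)
      moreover have "rg (sem SOLVE t2) 16 = 1" by (simp add: t2_def)
      moreover have "good n p E c k i \<longleftrightarrow> S.solvable k" by (simp add: good_def True)
      ultimately show ?thesis unfolding ex_Suc e using I True by auto
    qed
  qed (use s1 wb in \<open>auto simp: s1_def\<close>)
  then show ?thesis by (simp add: A s1_def)
qed

text \<open>Needed for the main loop, whose body recomputes the limits of its inner loops, so that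
  \<open>limits_bounded_static\<close> does not apply to it.\<close>

lemma limits_bounded_For:
  assumes "wf (For r l p)" "rg s l = int N" "N \<le> Y" "Inv 0 s"
    and step: "\<And>i t. i < N \<Longrightarrow> frame (For r l p) s t \<Longrightarrow> Inv i t \<Longrightarrow> Inv (Suc i) (sem p (setr r (int i) t))"
    and body: "\<And>i t. i < N \<Longrightarrow> frame (For r l p) s t \<Longrightarrow> Inv i t \<Longrightarrow> limits_bounded p (setr r (int i) t) Y"
  shows "limits_bounded (For r l p) s Y"
proof -
  define F where "F i = fold (\<lambda>i t. sem p (setr r (int i) t)) [0..<i] s" for i
  have "i \<le> N \<Longrightarrow> frame (For r l p) s (F i) \<and> Inv i (F i)" for i
  proof (induction i)
    case 0
    then show ?case using assms(4) by (simp add: frame_def F_def)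
  next
    case (Suc i)
    then have IH: "frame (For r l p) s (F i)" "Inv i (F i)" by auto
    have "F (Suc i) = sem p (setr r (int i) (F i))" by (simp add: F_def)
    then show ?case
      using IH step[OF _ IH] Suc.prems assms(1) frame_sem[of p "setr r (int i) (F i)"] by (simp add: frame_def)
  qed
  then show ?thesis using assms(2,3) body by (simp add: F_def)
qed

section \<open>Reading the input and the main loop\<close>

lemma nth_concat_map:
  assumes "\<And>u. u < m \<Longrightarrow> length (f u) = n" "u < m" "v < n"
  shows "concat (map f [0..<m]) ! (u * n + v) = f u ! v \<and> length (concat (map f [0..<m])) = m * n"
  using assms
proof (induction m)
  case (Suc m)
  have len: "length (concat (map f [0..<m])) = m * n"
  proof -
    have "length (concat (map f [0..<m])) = sum_list (map (length \<circ> f) [0..<m])" by (simp add: length_concat)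
    also have "map (length \<circ> f) [0..<m] = map (\<lambda>_. n) [0..<m]" using Suc.prems(1) by simp
    finally show ?thesis by (simp add: sum_list_triv)
  qed
  show ?case
  proof (cases "u = m")
    case True
    then show ?thesis using len Suc.prems by (simp add: nth_append)
  next
    case False
    then have "u < m" using Suc.prems by simp
    then have "u * n + v < m * n"
      using Suc.prems(3) mult_le_mono1[of "Suc u" m n] by simp
    then show ?thesis using Suc.IH[OF Suc.prems(1)] \<open>u < m\<close> Suc.prems len by (simp add: nth_append)
  qed
qed simp

lemma cvc_input_nth:
  shows "length (cvc_input n E c k) = n + 2 + n * n" "cvc_input n E c k ! 0 = int n" "cvc_input n E c k ! 1 = k"
    "\<And>v. v < n \<Longrightarrow> cvc_input n E c k ! (v + 2) = int (c v)"
    "\<And>u v. u < n \<Longrightarrow> v < n \<Longrightarrow> cvc_input n E c k ! (n + 2 + u * n + v) = of_bool ({u, v} \<in> E)"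
proof -
  have c: "cvc_input n E c k = int n # k # (map (\<lambda>v. int (c v)) [0..<n] @
      concat (map (\<lambda>u. map (\<lambda>v. of_bool ({u, v} \<in> E)) [0..<n]) [0..<n]))"
    by (simp add: cvc_input_def)
  show "length (cvc_input n E c k) = n + 2 + n * n"
    by (simp add: c length_concat comp_def sum_list_triv)
  show "cvc_input n E c k ! 0 = int n" "cvc_input n E c k ! 1 = k" by (simp_all add: c)
  show "cvc_input n E c k ! (v + 2) = int (c v)" if "v < n" for v
    using that by (simp add: c nth_append)
  show "cvc_input n E c k ! (n + 2 + u * n + v) = of_bool ({u, v} \<in> E)" if "u < n" "v < n" for u v
    using nth_concat_map[of n "\<lambda>u. map (\<lambda>v. of_bool ({u, v} \<in> E)) [0..<n]" n u v] that
    by (auto simp: c nth_append)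
qed

lemma INIT_spec:
  assumes s: "s = load (cvc_input n E c k)"
  shows "ctx n E c (sem INIT s) \<and> rg (sem INIT s) 2 = k \<and> rg (sem INIT s) 38 = int n + 2 \<and>
      rg (sem INIT s) 14 = int ((n + 1) * (n + 1) * (n + 1))"
    "2 * ((n + 1) * (n + 1) * (n + 1)) \<le> Y \<Longrightarrow> limits_bounded INIT s Y"
proof -
  define inp where "inp = cvc_input n E c k"
  have raw: "snd s a = inp ! nat a" if "0 \<le> a" "a < int (n + 2 + n * n)" for a
    using that cvc_input_nth(1)[of n E c k] by (simp add: s load_def inp_def)
  have raw0: "snd s 0 = int n" "snd s 1 = k"
    using raw[of 0] raw[of 1] cvc_input_nth(2,3)[of n E c k] by (simp_all add: inp_def add_pos_nonneg)
  define l1 where "l1 = For 20 1 (Asg 61 (Add (R 61) (R 1)))"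
  define l2 where "l2 = For 20 39 (Sto 0 (R 20) (Mem (R 20)))"
  define l3 where "l3 = For 20 1 (Sto 1 (R 20) (R 61);; Asg 61 (Add (R 61) (R 1)))"
  have w: "wf l1" "written_regs l1 = {20, 61}" "written_arrays l1 = {}" "wf l2" "written_regs l2 = {20}" "written_arrays l2 = {0}"
    "wf l3" "written_regs l3 = {20, 61}" "written_arrays l3 = {1}"
    by (auto simp: l1_def l2_def l3_def)
  define s1 where "s1 = setr 61 0 (setr 36 3 (setr 38 (int n + 2) (setr 3 (int n + 1) (setr 2 k (setr 1 (int n) s)))))"
  define s2 where "s2 = sem l1 s1"
  have l1: "rg s2 61 = int (n * n) \<and> snd s2 = snd s"
    unfolding s2_def l1_def
    by (rule For_post[where N = n and Inv = "\<lambda>i t. rg t 61 = int (i * n) \<and> snd t = snd s"])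
      (auto simp: s1_def frame_def algebra_simps)
  have r2: "rg s2 1 = int n" "rg s2 2 = k" "rg s2 3 = int n + 1" "rg s2 36 = 3" "rg s2 38 = int n + 2"
    by (simp_all add: s2_def s1_def w)
  define s3 where "s3 = setr 39 (int (n + 2 + n * n)) s2"
  define s4 where "s4 = sem l2 s3"
  \<comment> \<open>The cells of array 0 have negative addresses, so copying does not destroy input
    that is still to be read.\<close>
  have l2: "\<forall>a<n + 2 + n * n. ar s4 0 (int a) = inp ! a"
    unfolding s4_def l2_def
  proof (rule For_post[where N = "n + 2 + n * n" and Inv = "\<lambda>i t. (\<forall>a<i. ar t 0 (int a) = inp ! a) \<and> (\<forall>a\<ge>0. snd t a = snd s a)"])
    fix i t assume i: "i < n + 2 + n * n" and "frame (For 20 39 (Sto 0 (R 20) (Mem (R 20)))) s3 t"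
      and I: "(\<forall>a<i. ar t 0 (int a) = inp ! a) \<and> (\<forall>a\<ge>0. snd t a = snd s a)"
    have "int i < int (n + 2 + n * n)" using i by (simp only: of_nat_less_iff)
    from raw[OF _ this] have ri: "snd s (int i) = inp ! i" by simp
    show "(\<forall>a<Suc i. ar (sem (Sto 0 (R 20) (Mem (R 20))) (setr 20 (int i) t)) 0 (int a) = inp ! a) \<and>
      (\<forall>a\<ge>0. snd (sem (Sto 0 (R 20) (Mem (R 20))) (setr 20 (int i) t)) a = snd s a)"
      using I ri by (auto simp: less_Suc_eq)
  qed (use l1 in \<open>auto simp: s3_def\<close>)
  define s5 where "s5 = setr 61 (int n + 2) s4"
  define s6 where "s6 = sem l3 s5"
  have l3: "\<forall>u<n. ar s6 1 (int u) = int (n + 2 + u * n)"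
    unfolding s6_def l3_def
  proof (rule For_post[where N = n and Inv = "\<lambda>i t. rg t 61 = int (n + 2 + i * n) \<and> (\<forall>u<i. ar t 1 (int u) = int (n + 2 + u * n))"])
    show "rg s5 1 = int n" using r2 by (simp add: s5_def s4_def s3_def w)
    fix i t assume "frame (For 20 1 (Sto 1 (R 20) (R 61);; Asg 61 (Add (R 61) (R 1)))) s5 t"
      "rg t 61 = int (n + 2 + i * n) \<and> (\<forall>u<i. ar t 1 (int u) = int (n + 2 + u * n))"
    moreover from this(1) have "rg t 1 = int n" using r2 by (simp add: frame_def s5_def s4_def s3_def w)
    ultimately show "rg (sem (Sto 1 (R 20) (R 61);; Asg 61 (Add (R 61) (R 1))) (setr 20 (int i) t)) 61 = int (n + 2 + Suc i * n) \<and>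
      (\<forall>u<Suc i. ar (sem (Sto 1 (R 20) (R 61);; Asg 61 (Add (R 61) (R 1))) (setr 20 (int i) t)) 1 (int u) = int (n + 2 + u * n))"
      by (auto simp: algebra_simps less_Suc_eq)
  qed (auto simp: s5_def)
  have r6: "rg s6 1 = int n" "rg s6 2 = k" "rg s6 3 = int (n + 1)" "rg s6 36 = 3" "rg s6 38 = int n + 2" "ar s6 0 = ar s4 0"
    using r2 by (simp_all add: s6_def s5_def s4_def s3_def w)
  have ctx6: "ctx n E c s6"
  proof -
    have "ar s6 0 (ar s6 1 (int u) + int v) = of_bool ({u, v} \<in> E)" if "u < n" "v < n" for u v
    proof -
      have "u * n + v < n * n" using that mult_le_mono1[of "Suc u" n n] by simp
      then have "n + 2 + u * n + v < n + 2 + n * n" by simp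
      from l2[rule_format, OF this] have "ar s4 0 (int (n + 2 + u * n + v)) = of_bool ({u, v} \<in> E)"
        by (simp only: inp_def cvc_input_nth(5)[OF that])
      moreover have "ar s6 1 (int u) + int v = int (n + 2 + u * n + v)" using l3 that by simp
      ultimately show ?thesis unfolding r6 by metis
    qed
    moreover have "ar s6 0 (int v + 2) = int (c v)" if "v < n" for v
    proof -
      have "v + 2 < n + 2 + n * n" using that by simp
      from l2[rule_format, OF this] have "ar s4 0 (int (v + 2)) = int (c v)"
        by (simp only: inp_def cvc_input_nth(4)[OF that])
      then show ?thesis unfolding r6 by (simp add: add.commute)
    qed
    ultimately show ?thesis using r6 by (simp add: ctx_def)
  qed
  define s7 where "s7 = sem (MUL 60 3 3) s6"
  have s7: "rg s7 60 = int ((n + 1) * (n + 1))"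
    using MUL_spec[of 3 3 60 s6 "n + 1"] r6 by (simp add: s7_def algebra_simps)
  have r7: "rg s7 3 = int (n + 1)" using r6 by (simp add: s7_def)
  have s8: "rg (sem (MUL 14 60 3) s7) 14 = int ((n + 1) * (n + 1)) * rg s7 3"
    by (rule MUL_spec) (use s7 in auto)
  have c1: "setr 61 (aval (K 0) s') s' = s1"
    if "s' = setr 36 3 (setr 38 (int n + 2) (setr 3 (int n + 1) (setr 2 k (setr 1 (int n) s))))" for s'
    by (simp add: that s1_def)
  have S: "sem (Asg 1 (Mem (K 0));; Asg 2 (Mem (K 1));; Asg 3 (Add (R 1) (K 1));; Asg 38 (Add (R 1) (K 2));;
     Asg 36 (K 3);; Asg 61 (K 0)) s = s1"
    by (simp add: s1_def raw0)
  have c3: "setr 39 (aval (Add (R 38) (R 61)) s2) s2 = s3" using l1 r2 by (simp add: s3_def algebra_simps)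
  have c5: "setr 61 (aval (R 38) s4) s4 = s5" using r2 by (simp add: s5_def s4_def s3_def w)
  have sINIT: "sem INIT s = sem (MUL 14 60 3) s7"
    using S unfolding INIT_def l1_def[symmetric] l2_def[symmetric] l3_def[symmetric] sem.simps
    by (simp only: s2_def[symmetric] c3 s4_def[symmetric] c5 s6_def[symmetric] s7_def[symmetric])
  show "ctx n E c (sem INIT s) \<and> rg (sem INIT s) 2 = k \<and> rg (sem INIT s) 38 = int n + 2 \<and>
      rg (sem INIT s) 14 = int ((n + 1) * (n + 1) * (n + 1))"
    unfolding sINIT using ctx6 r6 s8 r7 by (simp add: s7_def algebra_simps)
  show "limits_bounded INIT s Y" if Y: "2 * ((n + 1) * (n + 1) * (n + 1)) \<le> Y"
  proof -
    define m where "m = n + 1"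
    have "m * m * 1 \<le> m * m * m" by (intro mult_le_mono2) (simp add: m_def)
    moreover have "m * 1 \<le> m * m" by (intro mult_le_mono2) (simp add: m_def)
    moreover have "n + 2 + n * n \<le> 2 * (m * m)" by (simp add: m_def)
    ultimately have Ys: "n + 1 \<le> Y" "n \<le> Y" "n + 2 + n * n \<le> Y" "(n + 1) * (n + 1) \<le> Y"
      using Y unfolding m_def[symmetric] by (auto simp: m_def)
    have b1: "limits_bounded l1 s1 Y" unfolding l1_def by (rule limits_bounded_static) (use Ys in \<open>auto simp: s1_def\<close>)
    have b2: "limits_bounded l2 s3 Y" unfolding l2_def
      by (rule limits_bounded_static) (use Ys in \<open>auto simp: s3_def nat_le_iff simp flip: of_nat_mult of_nat_add\<close>)
    have b3: "limits_bounded l3 s5 Y" unfolding l3_def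
      by (rule limits_bounded_static) (use Ys r2 in \<open>auto simp: s5_def s4_def s3_def w\<close>)
    have b4: "limits_bounded (MUL 60 3 3) s6 Y" by (rule limits_bounded_MUL) (use Ys r6 in auto)
    have b5: "limits_bounded (MUL 14 60 3) s7 Y" by (rule limits_bounded_MUL) (use Ys s7 in \<open>auto simp flip: of_nat_mult of_nat_Suc\<close>)
    show ?thesis
      using S b1 b2 b3 b4 b5 unfolding INIT_def l1_def[symmetric] l2_def[symmetric] l3_def[symmetric] sem.simps limits_bounded.simps
      by (simp only: s2_def[symmetric] c3 s4_def[symmetric] c5 s6_def[symmetric] s7_def[symmetric])
  qed
qed

lemma vertex_integrity_le: "vertex_integrity {..<n} E \<le> n"
  unfolding vertex_integrity_def by (rule Least_le) (intro exI[of _ "{..<n}"], simp add: components_def)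

lemma MAIN_spec:
  assumes g: "simple_graph {..<n} E" and P: "P = max (vertex_integrity {..<n} E) 1"
    and Y: "2 * ((n + 1) * (n + 1) * (n + 1)) \<le> Y" and fits: "\<And>p. 1 \<le> p \<Longrightarrow> p \<le> P \<Longrightarrow> fits p Y"
    and s: "s = load (cvc_input n E c k)"
  shows "rg (sem MAIN s) 0 = of_bool (capacitated_vertex_cover {..<n} E c k)" "limits_bounded MAIN s Y"
proof -
  define body where "body = when_com (Less (R 15) (K 1)) (PARAMS;; ATTEMPT;; Asg 15 (R 16))"
  define ans :: int where "ans = of_bool (capacitated_vertex_cover {..<n} E c k)"
  have wA: "written_regs ATTEMPT = written_regs ROWS \<union> written_regs SEARCH \<union> written_regs SOLVE \<union> {7, 16}" "written_arrays ATTEMPT = written_arrays ROWS \<union> written_arrays SEARCH \<union> written_arrays SOLVE"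
    by (auto simp: ATTEMPT_def)
  have wb: "wf body" "written_regs body = written_regs PARAMS \<union> written_regs ATTEMPT \<union> {15}" "written_arrays body = written_arrays ATTEMPT"
    by (auto simp: body_def)
  have wfF: "wf (For 4 3 body)" by (simp add: wb wA)
  define s1 where "s1 = setr 0 0 (setr 15 0 (sem INIT s))"
  have s1: "ctx n E c s1" "rg s1 2 = k" "rg s1 38 = int n + 2" "rg s1 14 = int ((n + 1) * (n + 1) * (n + 1))"
    "rg s1 0 = 0" "rg s1 15 = 0"
    using INIT_spec(1)[OF s] by (simp_all add: s1_def)
  then have n3: "rg s1 3 = int (n + 1)" by (simp add: ctx_def)
  \<comment> \<open>Without success in \<open>i\<close> passes, \<open>i < P\<close>, since
    \<open>p = P\<close> succeeds at the latest. The same inequality ensures that parameters are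
    computed for \<open>p \<le> P\<close> only, where \<open>fits\<close> is available.\<close>
  define Inv where "Inv i t \<longleftrightarrow> rg t 15 = 0 \<and> i < P \<and> rg t 0 = 0 \<or> rg t 15 = 1 \<and> rg t 0 = ans" for i t
  have step: "Inv (Suc i) (sem body (setr 4 (int i) t)) \<and> limits_bounded body (setr 4 (int i) t) Y"
    if i: "i < n + 1" and fr: "frame (For 4 3 body) s1 t" and I: "Inv i t" for i t
  proof (cases "rg t 15 = 0")
    case False
    then show ?thesis using I by (auto simp: body_def Inv_def)
  next
    case True
    then have iP: "i < P" and t0: "rg t 0 = 0" using I by (auto simp: Inv_def)
    define p where "p = Suc i"
    have p: "1 \<le> p" "p \<le> P" using iP by (auto simp: p_def)
    have tc: "ctx n E c t" by (rule ctx_frame[OF fr s1(1)]) (auto simp: wb wA)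
    have tr: "rg t 2 = k" "rg t 38 = int n + 2" "rg t 14 = int ((n + 1) * (n + 1) * (n + 1))"
      using fr s1 by (auto simp: frame_def wb wA)
    define t1 where "t1 = setr 4 (int i) t"
    have pr: "params p (sem PARAMS t1)" and bp: "limits_bounded PARAMS t1 Y"
      using PARAMS_spec(1)[of t1 i p] PARAMS_spec(2)[of t1 i p Y] fits[OF p] tc by (auto simp: t1_def p_def ctx_def)
    define t2 where "t2 = sem PARAMS t1"
    have t2: "ctx n E c t2" "params p t2" "rg t2 2 = k" "rg t2 38 = int n + 2" "rg t2 14 = int ((n + 1) * (n + 1) * (n + 1))" "rg t2 0 = 0"
      using tc tr pr t0 by (simp_all add: t2_def t1_def)
    have A: "rg (sem ATTEMPT t2) 16 = of_bool (\<exists>g<(4 * p) ^ p. success n p E g)"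
      "rg (sem ATTEMPT t2) 0 = of_bool (\<exists>g<(4 * p) ^ p. good n p E c k g)"
      using ATTEMPT_spec[OF g t2(1,2) p(1) t2(3-6)] by auto
    have "rg t1 15 = 0" using True by (simp add: t1_def)
    then have e: "sem body (setr 4 (int i) t) = setr 15 (rg (sem ATTEMPT t2) 16) (sem ATTEMPT t2)"
      by (simp add: body_def t1_def[symmetric] t2_def)
    have "Inv (Suc i) (sem body (setr 4 (int i) t))"
    proof (cases "\<exists>g<(4 * p) ^ p. success n p E g")
      case suc: True
      have "rg (sem ATTEMPT t2) 0 = ans" unfolding A(2) good_iff_cvc[OF g p(1) suc] ans_def ..
      then show ?thesis unfolding e Inv_def using A(1) suc by simp
    next
      case no: False
      then have "\<not> (\<exists>g<(4 * p) ^ p. good n p E c k g)" by (auto simp: good_def)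
      moreover have "Suc i < P"
      proof (rule ccontr)
        assume "\<not> Suc i < P"
        then have "vertex_integrity {..<n} E \<le> p" using iP by (auto simp: p_def P)
        then show False using ex_success[OF g _ p(1)] no by blast
      qed
      ultimately show ?thesis unfolding e Inv_def using A no by simp
    qed
    moreover have "limits_bounded ATTEMPT t2 Y"
    proof (rule limits_bounded_static)
      show "wf ATTEMPT" by simp
      show "limit_regs ATTEMPT \<inter> written_regs ATTEMPT = {}" by (rule static_ATTEMPT)
      fix l assume "l \<in> limit_regs ATTEMPT"
      then have l: "l \<in> {1, 3, 5, 6, 8, 9, 11, 13, 14, 19, 38}" by (simp only: limit_regs_ATTEMPT)
      define m where "m = n + 1"
      have "m * m * 1 \<le> m * m * m" by (intro mult_le_mono2) (simp add: m_def)
      moreover have "m * 1 \<le> m * m" by (intro mult_le_mono2) (simp add: m_def)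
      ultimately have Ys: "n + 1 \<le> Y" "n \<le> Y" "n + 2 \<le> Y" "(n + 1) * (n + 1) * (n + 1) \<le> Y"
        using Y unfolding m_def[symmetric] by (auto simp: m_def)
      have f: "fits p Y" by (rule fits[OF p])
      have "rg t2 1 = int n" "rg t2 3 = int (n + 1)" "rg t2 38 = int (n + 2)" using t2 by (simp_all add: ctx_def)
      then show "nat (rg t2 l) \<le> Y" using l t2(2,5) Ys f unfolding params_def fits_def
        by (elim insertE emptyE; hypsubst) (simp_all only: nat_int, auto)
    qed
    ultimately show ?thesis using bp by (simp add: body_def t1_def[symmetric] t2_def)
  qed
  have MAIN: "MAIN = INIT;; Asg 15 (K 0);; Asg 0 (K 0);; For 4 3 body" by (simp add: MAIN_def body_def)
  have I0: "Inv 0 s1" using s1 by (simp add: Inv_def P)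
  have Pn: "P \<le> n + 1" using vertex_integrity_le[of n E] by (simp add: P)
  have "rg (sem (For 4 3 body) s1) 0 = ans"
  proof (rule For_post[where N = "n + 1" and Inv = Inv])
    fix t assume "Inv (n + 1) t"
    then show "rg (setr 4 (int (n + 1)) t) 0 = ans" using Pn by (auto simp: Inv_def)
  qed (use wfF n3 I0 step in auto)
  then show "rg (sem MAIN s) 0 = of_bool (capacitated_vertex_cover {..<n} E c k)"
    by (simp add: MAIN s1_def ans_def)
  have "n + 1 \<le> Y"
  proof -
    define m where "m = (n + 1) * ((n + 1) * (n + 1))"
    have "n + 1 \<le> m" unfolding m_def using mult_le_mono2[of 1 "(n + 1) * (n + 1)" "n + 1"] by simp
    moreover have "2 * m \<le> Y" using Y by (simp only: m_def mult.assoc)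
    ultimately show ?thesis by linarith
  qed
  then have "limits_bounded (For 4 3 body) s1 Y"
    by (intro limits_bounded_For[where Inv = Inv and N = "n + 1"] wfF n3 I0) (use step in auto)
  then show "limits_bounded MAIN s Y"
    using INIT_spec(2)[OF s Y] by (simp add: MAIN s1_def)
qed

section \<open>The time bound\<close>

lemma power_le_power_square: "1 \<le> (a :: nat) \<Longrightarrow> 1 \<le> p \<Longrightarrow> a ^ p \<le> a ^ p\<^sup>2"
  by (rule power_increasing) (auto simp: power2_eq_square)

text \<open>The table length dominates. It is at most
  \<open>(15 * p ^ 2) ^ p * (75 * p ^ 3) ^ (p ^ 2)\<close>, where 15 and 75 come from absorbing
  small summands and factors into the \<open>p\<close>-th power.\<close>

lemma fits_bound:
  assumes p: "1 \<le> p" and Z: "(2000 * p ^ 5) ^ p\<^sup>2 \<le> Y"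
  shows "fits p Y"
proof -
  \<comment> \<open>The exponent 5 is 2 + 3 and the constant leaves room above 15 * 75 = 1125,
    according to the two factors of the table length.\<close>
  define W where "W = 2000 * p ^ 5"
  have pp: "1 \<le> p * p" "p \<le> p * p" "p * p \<le> p ^ 3" "p ^ 3 \<le> p ^ 5" "p \<le> p ^ 5" "p * p \<le> p ^ 5" "1 \<le> p ^ 5" "1 \<le> p ^ 3"
    using p power_increasing[of 1 5 p] power_increasing[of 2 5 p] power_increasing[of 2 3 p] power_increasing[of 3 5 p]
    by (auto simp: power2_eq_square)
  have W1: "1 \<le> W" using pp by (simp add: W_def)
  have Wp: "W ^ p \<le> Y" using power_le_power_square[OF W1 p] Z by (simp add: W_def)
  have WY: "W \<le> Y" using Wp power_increasing[of 1 p W] W1 p by simp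
  have small: "a \<le> Y" if "a \<le> W" for a using that WY by simp
  have L: "par_L p + 2 \<le> (15 * (p * p)) ^ p"
  proof -
    have "par_L p \<le> (5 * (p * p)) ^ p" unfolding par_L_def using pp by (intro power_mono) auto
    moreover have "1 \<le> (5 * (p * p)) ^ p" using pp by (intro one_le_power) auto
    ultimately have "par_L p + 2 \<le> 3 * (5 * (p * p)) ^ p" by linarith
    also have "\<dots> \<le> 3 ^ p * (5 * (p * p)) ^ p" using power_increasing[of 1 p "3 :: nat"] p by (intro mult_le_mono1) simp
    also have "\<dots> = (15 * (p * p)) ^ p" unfolding power_mult_distrib[symmetric] by simp
    finally show ?thesis .
  qed
  have B: "par_B p \<le> (75 * p ^ 3) ^ p"
  proof -
    have "1 \<le> p * (15 * (p * p)) ^ p" using p pp by (simp add: Suc_le_eq)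
    then have "par_B p \<le> 5 * p * (15 * (p * p)) ^ p"
      unfolding par_B_def using mult_le_mono2[OF L, of "4 * p"] by simp
    also have "\<dots> \<le> (5 * p) ^ p * (15 * (p * p)) ^ p" using power_increasing[of 1 p "5 * p"] p by (intro mult_le_mono1) simp
    also have "\<dots> = (75 * p ^ 3) ^ p" unfolding power_mult_distrib[symmetric] by (simp add: power3_eq_cube algebra_simps)
    finally show ?thesis .
  qed
  have T: "par_T p \<le> W ^ p\<^sup>2"
  proof -
    have "par_T p \<le> (15 * (p * p)) ^ p * ((75 * p ^ 3) ^ p) ^ p"
      unfolding par_T_def using L power_mono[OF B, of p] by (intro mult_le_mono) auto
    also have "((75 * p ^ 3) ^ p) ^ p = (75 * p ^ 3) ^ p\<^sup>2" by (simp add: power_mult power2_eq_square)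
    also have "(15 * (p * p)) ^ p * (75 * p ^ 3) ^ p\<^sup>2 \<le> (15 * (p * p)) ^ p\<^sup>2 * (75 * p ^ 3) ^ p\<^sup>2"
      using pp p by (intro mult_le_mono1 power_le_power_square) auto
    also have "\<dots> = (15 * (p * p) * (75 * p ^ 3)) ^ p\<^sup>2" by (simp only: power_mult_distrib)
    also have "\<dots> \<le> W ^ p\<^sup>2"
    proof (rule power_mono)
      have "p * p * p ^ 3 = p ^ 5" using power_add[of p 2 3] by (simp add: power2_eq_square)
      then have "15 * (p * p) * (75 * p ^ 3) = 1125 * p ^ 5" by simp
      then show "15 * (p * p) * (75 * p ^ 3) \<le> W" by (simp add: W_def)
    qed simp
    finally show ?thesis .
  qed
  show ?thesis
    unfolding fits_def
  proof (intro conjI)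
    show "3 \<le> Y" "Suc p \<le> Y" "4 * p \<le> Y" "4 * p * p + 1 \<le> Y"
      using pp by (auto intro!: small simp: W_def)
    have "(4 * p) ^ p \<le> W ^ p" using pp by (intro power_mono) (auto simp: W_def)
    then show "(4 * p) ^ p \<le> Y" using Wp by simp
    have "(3 :: nat) ^ (4 * p * p) = 81 ^ p\<^sup>2" by (simp add: power_mult power2_eq_square mult.assoc)
    also have "\<dots> \<le> W ^ p\<^sup>2" using pp by (intro power_mono) (auto simp: W_def)
    finally show "3 ^ (4 * p * p) \<le> Y" using Z by (simp add: W_def)
    have "(15 * (p * p)) ^ p \<le> W ^ p" using pp by (intro power_mono) (auto simp: W_def)
    then show "par_L p + 2 \<le> Y" using L Wp by simp
    have "(75 * p ^ 3) ^ p \<le> W ^ p" using pp by (intro power_mono) (auto simp: W_def)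
    then show "par_B p \<le> Y" using B Wp by simp
    show "par_T p \<le> Y" using T Z by (simp add: W_def)
  qed
qed

text \<open>The constant 2000 has to be absorbed. For \<open>vi \<ge> 2\<close> it is at most
  \<open>vi ^ 11\<close>, which together with \<open>vi ^ 5\<close> explains the 16 in
  \<open>C\<close>. For \<open>vi = 1\<close> powers of \<open>vi\<close> are of no help, and the
  factor \<open>64000 ^ d = (32 * 2000) ^ d\<close> in \<open>C\<close> takes over; the 32 comes
  from the polynomial in \<open>n\<close>.\<close>

lemma limits_imp_time_bound:
  fixes K d n vi P C :: nat
  assumes P: "P = max vi 1" and vi: "n \<noteq> 0 \<Longrightarrow> 1 \<le> vi" "vi \<le> n" and C: "C = K * 64000 ^ d + 16 * d"
  shows "K * (2 * ((n + 1) * (n + 1) * (n + 1)) * (2000 * P ^ 5) ^ P\<^sup>2 + 1) ^ d \<le> C * vi ^ (C * vi\<^sup>2) * n ^ C + C"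
\<comment> \<open>For the empty graph the product on the right may vanish; the additive
  \<open>C\<close> covers the constant running time.\<close>
proof (cases "n = 0")
  case True
  then have "P = 1" using P vi by simp
  then have "K * (2 * ((n + 1) * (n + 1) * (n + 1)) * (2000 * P ^ 5) ^ P\<^sup>2 + 1) ^ d = K * 4001 ^ d"
    using True by simp
  also have "\<dots> \<le> K * 64000 ^ d" by (intro mult_le_mono2 power_mono) auto
  also have "\<dots> \<le> C" by (simp add: C)
  finally show ?thesis by simp
next
  case False
  then have n: "1 \<le> n" and PV: "P = vi" "1 \<le> vi" using P vi by auto
  define W where "W = 2000 * vi ^ 5"
  define Z where "Z = W ^ vi\<^sup>2"
  have Z1: "1 \<le> Z" unfolding Z_def W_def using PV by (intro one_le_power) simp
  have "(n + 1) * (n + 1) * (n + 1) \<le> (2 * n) * (2 * n) * (2 * n)" using n by (intro mult_le_mono) auto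
  then have "2 * ((n + 1) * (n + 1) * (n + 1)) \<le> 16 * n ^ 3" by (simp add: power3_eq_cube)
  then have a: "2 * ((n + 1) * (n + 1) * (n + 1)) * Z \<le> 16 * n ^ 3 * Z" by (rule mult_le_mono1)
  have "1 * 1 \<le> n ^ 3 * Z" using n Z1 by (intro mult_le_mono one_le_power) auto
  then have "1 \<le> n ^ 3 * Z" by simp
  then have "2 * ((n + 1) * (n + 1) * (n + 1)) * Z + 1 \<le> 32 * (n ^ 3 * Z)" using a unfolding mult.assoc by linarith
  then have "(2 * ((n + 1) * (n + 1) * (n + 1)) * Z + 1) ^ d \<le> (32 * (n ^ 3 * Z)) ^ d" by (rule power_mono) simp
  also have "\<dots> = 32 ^ d * (n ^ (3 * d) * Z ^ d)" by (simp add: power_mult_distrib power_mult)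
  finally have b: "(2 * ((n + 1) * (n + 1) * (n + 1)) * Z + 1) ^ d \<le> 32 ^ d * (n ^ (3 * d) * Z ^ d)" .
  have nC: "n ^ (3 * d) \<le> n ^ C" if "0 < K" using n that by (intro power_increasing) (auto simp: C)
  have zd: "32 ^ d * Z ^ d \<le> 64000 ^ d * vi ^ (C * vi\<^sup>2)"
  proof (cases "vi = 1")
    case True
    then have "32 ^ d * Z ^ d = (32 * 2000) ^ d" unfolding power_mult_distrib by (simp add: Z_def W_def)
    then show ?thesis using True by simp
  next
    case False
    then have v2: "2 \<le> vi" using PV by simp
    have "(2000 :: nat) \<le> 2 ^ 11" by simp
    also have "\<dots> \<le> vi ^ 11" using v2 by (intro power_mono) auto
    finally have "W \<le> vi ^ 11 * vi ^ 5" unfolding W_def by (rule mult_le_mono1)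
    also have "\<dots> = vi ^ 16" by (simp flip: power_add)
    finally have "(W ^ vi\<^sup>2) ^ d \<le> ((vi ^ 16) ^ vi\<^sup>2) ^ d" by (intro power_mono) auto
    also have "\<dots> = vi ^ (16 * d * vi\<^sup>2)" by (simp add: mult.commute mult.left_commute flip: power_mult)
    also have "\<dots> \<le> vi ^ (C * vi\<^sup>2)" using PV by (intro power_increasing mult_le_mono1) (auto simp: C)
    finally have "Z ^ d \<le> vi ^ (C * vi\<^sup>2)" by (simp only: Z_def)
    moreover have "(32 :: nat) ^ d \<le> 64000 ^ d" by (intro power_mono) auto
    ultimately show ?thesis by (intro mult_le_mono)
  qed
  show ?thesis
  proof (cases "K = 0")
    case False
    have "K * (2 * ((n + 1) * (n + 1) * (n + 1)) * Z + 1) ^ d \<le> K * (32 ^ d * (n ^ (3 * d) * Z ^ d))"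
      by (rule mult_le_mono2[OF b])
    also have "\<dots> = K * ((32 ^ d * Z ^ d) * n ^ (3 * d))" by (simp only: mult.commute mult.left_commute)
    also have "\<dots> \<le> K * ((64000 ^ d * vi ^ (C * vi\<^sup>2)) * n ^ C)"
      using nC False by (intro mult_le_mono2 mult_le_mono zd) auto
    also have "\<dots> = (K * 64000 ^ d) * (vi ^ (C * vi\<^sup>2) * n ^ C)" by (simp only: mult.assoc)
    also have "\<dots> \<le> C * (vi ^ (C * vi\<^sup>2) * n ^ C)" by (intro mult_le_mono1) (simp add: C)
    finally show ?thesis unfolding PV(1) W_def[symmetric] Z_def[symmetric] mult.assoc by linarith
  qed simp
qed

theorem theorem4p2:
  "\<exists>(p :: com) (C :: nat).
     solves_cvc_in_time p
       (\<lambda>E n. let vi = vertex_integrity {..<n} E in C * vi ^ (C * vi\<^sup>2) * n ^ C + C)"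
proof -
  define C where "C = step_factor MAIN * 64000 ^ depth MAIN + 16 * depth MAIN"
  show ?thesis
    unfolding solves_cvc_in_time_def
  proof (rule exI[of _ "compile MAIN"], rule exI[of _ C], intro allI impI)
    fix n :: nat and E c k assume g: "simple_graph {..<n} E"
    define vi where "vi = vertex_integrity {..<n} E"
    define P where "P = max vi 1"
    \<comment> \<open>A product of two factors that are at least 1 bounds at once the limits that
      depend on \<open>n\<close> and those that depend on \<open>p\<close>.\<close>
    define Y where "Y = 2 * ((n + 1) * (n + 1) * (n + 1)) * (2000 * P ^ 5) ^ P\<^sup>2"
    define s where "s = load (cvc_input n E c k)"
    have "1 \<le> (2000 * P ^ 5) ^ P\<^sup>2" by (intro one_le_power) (simp add: P_def)
    then have Y1: "2 * ((n + 1) * (n + 1) * (n + 1)) \<le> Y" "(2000 * P ^ 5) ^ P\<^sup>2 \<le> Y"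
      unfolding Y_def using mult_le_mono2[of 1 "(2000 * P ^ 5) ^ P\<^sup>2" "2 * ((n + 1) * (n + 1) * (n + 1))"]
        mult_le_mono1[of 1 "2 * ((n + 1) * (n + 1) * (n + 1))" "(2000 * P ^ 5) ^ P\<^sup>2"] by simp_all
    have fits: "fits p Y" if p: "1 \<le> p" "p \<le> P" for p
    proof (rule fits_bound[OF p(1)])
      have "(2000 * p ^ 5) ^ p\<^sup>2 \<le> (2000 * P ^ 5) ^ p\<^sup>2" using p by (intro power_mono mult_le_mono2) auto
      also have "\<dots> \<le> (2000 * P ^ 5) ^ P\<^sup>2" using p by (intro power_increasing power_mono) (auto simp: Suc_le_eq)
      finally show "(2000 * p ^ 5) ^ p\<^sup>2 \<le> Y" using Y1(2) by simp
    qed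
    have M: "rg (sem MAIN s) 0 = of_bool (capacitated_vertex_cover {..<n} E c k)" "limits_bounded MAIN s Y"
      using MAIN_spec[OF g P_def[unfolded vi_def] Y1(1) fits s_def] by auto
    obtain t where t: "exec (compile MAIN) s t (sem MAIN s)" "t \<le> step_factor MAIN * (Y + 1) ^ depth MAIN"
      using exec_compile[OF wf_MAIN M(2)] by blast
    have "1 \<le> vi" if "n \<noteq> 0" unfolding vi_def using that by (intro vertex_integrity_pos[OF g]) auto
    moreover have "vi \<le> n" unfolding vi_def by (rule vertex_integrity_le)
    ultimately have "step_factor MAIN * (Y + 1) ^ depth MAIN \<le> C * vi ^ (C * vi\<^sup>2) * n ^ C + C"
      unfolding Y_def by (rule limits_imp_time_bound[OF P_def _ _ C_def])
    then show "\<exists>t s. exec (compile MAIN) (load (cvc_input n E c k)) t s \<and>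
        fst s 0 = of_bool (capacitated_vertex_cover {..<n} E c k) \<and>
        t \<le> (let vi = vertex_integrity {..<n} E in C * vi ^ (C * vi\<^sup>2) * n ^ C + C)"
      using t M(1) unfolding s_def[symmetric] vi_def[symmetric] Let_def rg_def
      by (intro exI[of _ t] exI[of _ "sem MAIN s"]) simp
  qed
qed

end
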